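(* Let $X$ be a diffeological $n$-orbifold and let $\{\psi_i:X\dashrightarrow\mathbb{R}^n/\Gamma_i\}$ be a countable collection of transitions whose domains cover $X$, where each $\Gamma_i$ is a finite subgroup of $\mathrm{Diff}(\mathbb{R}^n)$. Let $\pi_i:\mathbb{R}^n\to\mathbb{R}^n/\Gamma_i$ be the quotient map, $V_i:=\pi_i^{-1}(\mathrm{image}(\psi_i))$, and $\varphi_i:=\psi_i^{-1}\circ\pi_i:V_i\to X$. Let $\Psi$ be the pseudogroup on $\coprod_iV_i$ generated by all transitions $f:V_i\dashrightarrow V_j$ with $\pi_j\circ f=\psi_j\circ\psi_i^{-1}\circ\pi_i$. Let $\mathsf{C}$ be the category whose objects are the maps $\varphi_i$ and whose morphisms $\varphi_i\to\varphi_j$ are the smooth maps $f:V_i\to V_j$ with $\varphi_j\circ f=\varphi_i$. Let $\eta$ be a Riemannian metric on $\coprod_iV_i$ that is invariant under $\Psi$, and let $\tilde{\eta}:\mathrm{colim}_{\mathsf{C}}\,T_2V_i\to\mathbb{R}$ be the map it induces. Then there exists a weak Riemannian metric $\overline{\eta}:T_2X\to\mathbb{R}$ whose composition with the canonical map $\mathrm{colim}_{\mathsf{C}}\,T_2V_i\to T_2X$ (induced by the maps $T_2\varphi_i$) equals $\tilde{\eta}$. Furthermore, $\overline{\eta}$ is definite with respect to the quotient map $\coprod_iV_i\to X$, so that $(X,\overline{\eta})$ is a Riemannian diffeological orbifold.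
   Context: Diffeology. A diffeological space is a set $X$ with, for each open subset $U$ of each $\mathbb{R}^n$ ($n\ge 0$), a set of maps $U\to X$ called plots, such that constant maps are plots, plots are closed under precomposition with $C^\infty$ maps between open subsets of Euclidean spaces, and a map that is locally a plot is a plot. A map is smooth if it sends plots to plots by composition; a diffeomorphism is a smooth bijection with smooth inverse. Manifolds have the $C^\infty$ maps as plots; subsets carry the plots of $X$ with image in the subset; a quotient has as plots the maps that locally lift to plots. The D-topology on $X$: $A$ is open iff $p^{-1}(A)$ is open for every plot $p$. A transition $\psi:X\dashrightarrow Y$ is a diffeomorphism from a D-open subset of $X$ onto a D-open subset of $Y$. A pseudogroup on a manifold is a collection of transitions containing the identity and closed under inversion, composition (on the natural domain), restriction to open subsets, and gluing (a transition whose restrictions to the members of an open cover belong to the collection belongs to it). A diffeological orbifold is a diffeological space whose D-topology is Hausdorff and second-countable and such that every point lies in the domain of a transition (orbifold chart) to some $\mathbb{R}^n/\Gamma$, with $\Gamma$ a finite subgroup of $\mathrm{Diff}(\mathbb{R}^n)$; it is an $n$-orbifold if $n$ is the same for all charts. The functor $T_2$. $T_2X$ is the quotient of $\coprod_{p:U\to X \text{ plot},\,U\subseteq\mathbb{R}^m} U\times\mathbb{R}^m\times\mathbb{R}^m$ by the equivalence relation generated by $(p;r,v,w)\sim(q;f(r),D_rf(v),D_rf(w))$ whenever $q\circ f=p$ with $f$ a $C^\infty$ map, with the quotient diffeology; write $T_2p(r,v,w)$ for the class. A smooth $h:X\to Y$ induces $T_2h(T_2p(r,v,w))=T_2(h\circ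 p)(r,v,w)$. For a manifold, $T_2M=TM\times_M TM$. The colimit $\mathrm{colim}_{\mathsf{C}}\,T_2V_i$ is the quotient of $\coprod_iT_2V_i$ by the relation generated by $(v,w)\sim(Tf(v),Tf(w))$ for morphisms $f$ of $\mathsf{C}$. (Each morphism $f$ is a local diffeomorphism, hence locally coincides with elements of $\Psi$, so a $\Psi$-invariant $\eta$ does descend to $\tilde\eta$.) A weak Riemannian metric on $X$ is a smooth map $g:T_2X\to\mathbb{R}$ such that for each plot $p:U\to X$, $p^*g:=g\circ T_2p$ is a symmetric and positive (i.e. positive semi-definite) covariant $2$-tensor on $U$. It is definite with respect to a smooth map from a manifold (or a family of these) generating the diffeology if the pullback along that map (each of these) is a Riemannian metric. A Riemannian diffeological orbifold is a diffeological orbifold with a weak Riemannian metric that is definite with respect to the family of all maps $\psi^{-1}\circ\pi:\pi^{-1}(\mathrm{image}(\psi))\to X$, where $\psi:X\dashrightarrow\mathbb{R}^n/\Gamma$ is an orbifold chart and $\pi:\mathbb{R}^n\to\mathbb{R}^n/\Gamma$ is the quotient map. *)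

theory Defs
  imports "HOL-Analysis.Analysis" "HOL-Algebra.Bij"
begin

section \<open>Smooth maps between open subsets of Euclidean spaces\<close>

text \<open>The dimension of a plot varies inside the definitions, so $\mathbb{R}^n$ is the carrier
  of the library's \<^const>\<open>Euclidean_space\<close> (real sequences vanishing from index \<open>n\<close> on) and not
  a type. As these sequences do not form a normed type, $C^\infty$ and the derivative are defined
  through iterated partial derivatives.\<close>

type_synonym vec = "nat \<Rightarrow> real"

abbreviation Rn :: "nat \<Rightarrow> vec set" where
  "Rn n \<equiv> topspace (Euclidean_space n)"

definition partial_deriv :: "nat \<Rightarrow> (vec \<Rightarrow> real) \<Rightarrow> vec \<Rightarrow> real" where
  "partial_deriv i f x = deriv (\<lambda>t. f (x(i := t))) (x i)"

primrec C_k :: "nat \<Rightarrow> nat \<Rightarrow> vec set \<Rightarrow> (vec \<Rightarrow> real) \<Rightarrow> bool" where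
  "C_k 0 n U f \<longleftrightarrow> continuous_map (subtopology (Euclidean_space n) U) euclideanreal f"
| "C_k (Suc k) n U f \<longleftrightarrow>
     continuous_map (subtopology (Euclidean_space n) U) euclideanreal f \<and>
     (\<forall>i<n. (\<forall>x\<in>U. (\<lambda>t. f (x(i := t))) field_differentiable (at (x i))) \<and>
            C_k k n U (partial_deriv i f))"

definition C_inf_fun :: "nat \<Rightarrow> vec set \<Rightarrow> (vec \<Rightarrow> real) \<Rightarrow> bool" where
  "C_inf_fun n U f \<longleftrightarrow> (\<forall>k. C_k k n U f)"

definition C_inf :: "nat \<Rightarrow> vec set \<Rightarrow> nat \<Rightarrow> (vec \<Rightarrow> vec) \<Rightarrow> bool" where
  "C_inf m U n f \<longleftrightarrow> f ` U \<subseteq> Rn n \<and> (\<forall>j<n. C_inf_fun m U (\<lambda>x. f x j))"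

text \<open>\<open>jacobian m f r v\<close> is $D_r f(v)$ for \<open>f\<close> defined near \<open>r\<close> in $\mathbb{R}^m$.\<close>

definition jacobian :: "nat \<Rightarrow> (vec \<Rightarrow> vec) \<Rightarrow> vec \<Rightarrow> vec \<Rightarrow> vec" where
  "jacobian m f r v = (\<lambda>j. \<Sum>i<m. partial_deriv i (\<lambda>x. f x j) r * v i)"


section \<open>Diffeological spaces\<close>

text \<open>A map \<open>U \<rightarrow> X\<close> from an open subset of $\mathbb{R}^m$ is a partial map with domain \<open>U\<close>;
  \<open>plots X m\<close> are the plots whose domain is regarded as an open subset of $\mathbb{R}^m$.\<close>

record 'a diffeology =
  points :: "'a set"
  plots :: "nat \<Rightarrow> (vec \<rightharpoonup> 'a) set"

definition diffeological_space :: "'a diffeology \<Rightarrow> bool" where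
  "diffeological_space X \<longleftrightarrow>
     (\<forall>m. \<forall>p \<in> plots X m. openin (Euclidean_space m) (dom p) \<and> ran p \<subseteq> points X) \<and>
     (\<forall>m U x. openin (Euclidean_space m) U \<and> x \<in> points X \<longrightarrow> (\<lambda>_. Some x) |` U \<in> plots X m) \<and>
     (\<forall>m U k f. \<forall>p \<in> plots X k.
        openin (Euclidean_space m) U \<and> C_inf m U k f \<and> f ` U \<subseteq> dom p \<longrightarrow> (p \<circ> f) |` U \<in> plots X m) \<and>
     (\<forall>m p. openin (Euclidean_space m) (dom p) \<and>
        (\<forall>u \<in> dom p. \<exists>W. openin (Euclidean_space m) W \<and> u \<in> W \<and> W \<subseteq> dom p \<and> p |` W \<in> plots X m)
        \<longrightarrow> p \<in> plots X m)"

definition smooth_map :: "'a diffeology \<Rightarrow> 'b diffeology \<Rightarrow> ('a \<Rightarrow> 'b) \<Rightarrow> bool" where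
  "smooth_map X Y h \<longleftrightarrow>
     h ` points X \<subseteq> points Y \<and> (\<forall>m. \<forall>p \<in> plots X m. map_option h \<circ> p \<in> plots Y m)"

definition diffeomorphism :: "'a diffeology \<Rightarrow> 'b diffeology \<Rightarrow> ('a \<Rightarrow> 'b) \<Rightarrow> bool" where
  "diffeomorphism X Y h \<longleftrightarrow>
     bij_betw h (points X) (points Y) \<and> smooth_map X Y h \<and> smooth_map Y X (inv_into (points X) h)"

definition euclid :: "nat \<Rightarrow> vec diffeology" where
  "euclid n = \<lparr>points = Rn n,
     plots = (\<lambda>m. {p. openin (Euclidean_space m) (dom p) \<and> C_inf m (dom p) n (the \<circ> p)})\<rparr>"

definition real_line :: "real diffeology" where
  "real_line = \<lparr>points = UNIV,
     plots = (\<lambda>m. {p. openin (Euclidean_space m) (dom p) \<and> C_inf_fun m (dom p) (the \<circ> p)})\<rparr>"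

definition subspace :: "'a diffeology \<Rightarrow> 'a set \<Rightarrow> 'a diffeology" where
  "subspace X A = \<lparr>points = points X \<inter> A, plots = (\<lambda>m. {p \<in> plots X m. ran p \<subseteq> A})\<rparr>"

definition prod_space :: "'a diffeology \<Rightarrow> 'b diffeology \<Rightarrow> ('a \<times> 'b) diffeology" where
  "prod_space X Y = \<lparr>points = points X \<times> points Y,
     plots = (\<lambda>m. {p. map_option fst \<circ> p \<in> plots X m \<and> map_option snd \<circ> p \<in> plots Y m})\<rparr>"

definition coproduct :: "'k set \<Rightarrow> ('k \<Rightarrow> 'a diffeology) \<Rightarrow> ('k \<times> 'a) diffeology" where
  "coproduct K X = \<lparr>points = Sigma K (\<lambda>k. points (X k)),
     plots = (\<lambda>m. {p. openin (Euclidean_space m) (dom p) \<and>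
       (\<forall>u \<in> dom p. \<exists>k \<in> K. \<exists>l \<in> plots (X k) m. u \<in> dom l \<and> map_option (Pair k) \<circ> l \<subseteq>\<^sub>m p)})\<rparr>"

text \<open>\<open>quotient X q\<close> is the quotient of \<open>X\<close> by the relation \<open>q x = q y\<close>, realised on the image of \<open>q\<close>.\<close>

definition quotient :: "'a diffeology \<Rightarrow> ('a \<Rightarrow> 'b) \<Rightarrow> 'b diffeology" where
  "quotient X q = \<lparr>points = q ` points X,
     plots = (\<lambda>m. {p. openin (Euclidean_space m) (dom p) \<and>
       (\<forall>u \<in> dom p. \<exists>l \<in> plots X m. u \<in> dom l \<and> map_option q \<circ> l \<subseteq>\<^sub>m p)})\<rparr>"

text \<open>The map induced on a quotient whose points are equivalence classes \<open>c\<close>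
  by a map \<open>f\<close> that is constant on classes.\<close>

definition descend :: "('a \<Rightarrow> 'b) \<Rightarrow> 'a set \<Rightarrow> 'b" where
  "descend f c = the_elem (f ` c)"

definition D_topology :: "'a diffeology \<Rightarrow> 'a topology" where
  "D_topology X = topology (\<lambda>A. A \<subseteq> points X \<and>
     (\<forall>m. \<forall>p \<in> plots X m. openin (Euclidean_space m) {u \<in> dom p. the (p u) \<in> A}))"

lemma openin_D_topology:
  "openin (D_topology X) A \<longleftrightarrow> A \<subseteq> points X \<and>
     (\<forall>m. \<forall>p \<in> plots X m. openin (Euclidean_space m) {u \<in> dom p. the (p u) \<in> A})"
proof -
  have "istopology (\<lambda>A. A \<subseteq> points X \<and>
     (\<forall>m. \<forall>p \<in> plots X m. openin (Euclidean_space m) {u \<in> dom p. the (p u) \<in> A}))"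
    unfolding istopology_def
  proof (intro conjI allI impI ballI)
    fix S T m p
    assume *: "S \<subseteq> points X \<and> (\<forall>m. \<forall>p \<in> plots X m. openin (Euclidean_space m) {u \<in> dom p. the (p u) \<in> S})"
      "T \<subseteq> points X \<and> (\<forall>m. \<forall>p \<in> plots X m. openin (Euclidean_space m) {u \<in> dom p. the (p u) \<in> T})"
      "p \<in> plots X m"
    have "{u \<in> dom p. the (p u) \<in> S \<inter> T} = {u \<in> dom p. the (p u) \<in> S} \<inter> {u \<in> dom p. the (p u) \<in> T}"
      by auto
    then show "openin (Euclidean_space m) {u \<in> dom p. the (p u) \<in> S \<inter> T}"
      using * by (simp add: openin_Int)
  next
    fix \<A> m p
    assume *: "\<forall>A\<in>\<A>. A \<subseteq> points X \<and>
        (\<forall>m. \<forall>p \<in> plots X m. openin (Euclidean_space m) {u \<in> dom p. the (p u) \<in> A})"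
      "p \<in> plots X m"
    have "{u \<in> dom p. the (p u) \<in> \<Union>\<A>} = (\<Union>A\<in>\<A>. {u \<in> dom p. the (p u) \<in> A})"
      by auto
    then show "openin (Euclidean_space m) {u \<in> dom p. the (p u) \<in> \<Union>\<A>}"
      using * by auto
  qed auto
  then show ?thesis
    by (simp add: D_topology_def topology_inverse')
qed

definition generates :: "('m diffeology \<times> ('m \<Rightarrow> 'a)) set \<Rightarrow> 'a diffeology \<Rightarrow> bool" where
  "generates \<F> X \<longleftrightarrow>
     (\<forall>(M, \<Phi>) \<in> \<F>. smooth_map M X \<Phi>) \<and>
     (\<forall>Y. diffeological_space Y \<and> points Y = points X \<and> (\<forall>(M, \<Phi>) \<in> \<F>. smooth_map M Y \<Phi>)
        \<longrightarrow> (\<forall>m. plots X m \<subseteq> plots Y m))"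


section \<open>Transitions, pseudogroups, manifolds and orbifolds\<close>

definition transition :: "'a diffeology \<Rightarrow> 'b diffeology \<Rightarrow> ('a \<rightharpoonup> 'b) \<Rightarrow> bool" where
  "transition X Y \<psi> \<longleftrightarrow>
     openin (D_topology X) (dom \<psi>) \<and> openin (D_topology Y) (ran \<psi>) \<and>
     diffeomorphism (subspace X (dom \<psi>)) (subspace Y (ran \<psi>)) (the \<circ> \<psi>)"

definition partial_inverse :: "('a \<rightharpoonup> 'b) \<Rightarrow> ('b \<rightharpoonup> 'a)" where
  "partial_inverse \<psi> = (\<lambda>y. if y \<in> ran \<psi> then Some (inv_into (dom \<psi>) (the \<circ> \<psi>) y) else None)"

definition pseudogroup :: "'a diffeology \<Rightarrow> ('a \<rightharpoonup> 'a) set \<Rightarrow> bool" where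
  "pseudogroup M P \<longleftrightarrow>
     (\<forall>f \<in> P. transition M M f) \<and>
     Some |` points M \<in> P \<and>
     (\<forall>f \<in> P. partial_inverse f \<in> P) \<and>
     (\<forall>f \<in> P. \<forall>g \<in> P. g \<circ>\<^sub>m f \<in> P) \<and>
     (\<forall>f \<in> P. \<forall>W. openin (D_topology M) W \<longrightarrow> f |` W \<in> P) \<and>
     (\<forall>f \<W>. transition M M f \<and> \<Union>\<W> = dom f \<and>
        (\<forall>W \<in> \<W>. openin (D_topology M) W \<and> f |` W \<in> P) \<longrightarrow> f \<in> P)"

definition manifold :: "'a diffeology \<Rightarrow> bool" where
  "manifold M \<longleftrightarrow>
     diffeological_space M \<and> Hausdorff_space (D_topology M) \<and> second_countable (D_topology M) \<and>
     (\<forall>x \<in> points M. \<exists>n \<xi>. transition (euclid n) M \<xi> \<and> x \<in> ran \<xi>)"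

definition Diff :: "'a diffeology \<Rightarrow> ('a \<Rightarrow> 'a) monoid" where
  "Diff X = BijGroup (points X)\<lparr>carrier := {f \<in> Bij (points X). diffeomorphism X X f}\<rparr>"

definition orbit_map :: "(vec \<Rightarrow> vec) set \<Rightarrow> vec \<Rightarrow> vec set" where
  "orbit_map \<Gamma> x = (\<lambda>\<gamma>. \<gamma> x) ` \<Gamma>"

definition orbifold_chart ::
  "'a diffeology \<Rightarrow> nat \<Rightarrow> (vec \<Rightarrow> vec) set \<Rightarrow> ('a \<rightharpoonup> vec set) \<Rightarrow> bool" where
  "orbifold_chart X n \<Gamma> \<psi> \<longleftrightarrow>
     finite \<Gamma> \<and> subgroup \<Gamma> (Diff (euclid n)) \<and> transition X (quotient (euclid n) (orbit_map \<Gamma>)) \<psi>"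

definition diffeological_orbifold :: "'a diffeology \<Rightarrow> bool" where
  "diffeological_orbifold X \<longleftrightarrow>
     diffeological_space X \<and> Hausdorff_space (D_topology X) \<and> second_countable (D_topology X) \<and>
     (\<forall>x \<in> points X. \<exists>n \<Gamma> \<psi>. orbifold_chart X n \<Gamma> \<psi> \<and> x \<in> dom \<psi>)"

text \<open>The empty map is a chart of every dimension, so only nonempty charts count.\<close>

definition diffeological_n_orbifold :: "nat \<Rightarrow> 'a diffeology \<Rightarrow> bool" where
  "diffeological_n_orbifold n X \<longleftrightarrow>
     diffeological_orbifold X \<and>
     (\<forall>m \<Gamma> \<psi>. orbifold_chart X m \<Gamma> \<psi> \<and> dom \<psi> \<noteq> {} \<longrightarrow> m = n)"


section \<open>The functor $T_2$\<close>

text \<open>An element \<open>((m, p), r, v, w)\<close> stands for $(p; r, v, w)$ with $p : U \to X$,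
  $U \subseteq \mathbb{R}^m$.\<close>

type_synonym 'a pre_T2 = "(nat \<times> (vec \<rightharpoonup> 'a)) \<times> vec \<times> vec \<times> vec"

definition pre_T2 :: "'a diffeology \<Rightarrow> 'a pre_T2 diffeology" where
  "pre_T2 X = coproduct {(m, p). p \<in> plots X m}
     (\<lambda>(m, p). prod_space (subspace (euclid m) (dom p)) (prod_space (euclid m) (euclid m)))"

definition T2_step :: "'a diffeology \<Rightarrow> 'a pre_T2 \<Rightarrow> 'a pre_T2 \<Rightarrow> bool" where
  "T2_step X = (\<lambda>((m, p), r, v, w) ((k, q), r', v', w').
     p \<in> plots X m \<and> q \<in> plots X k \<and> r \<in> dom p \<and> v \<in> Rn m \<and> w \<in> Rn m \<and>
     (\<exists>f. C_inf m (dom p) k f \<and> f ` dom p \<subseteq> dom q \<and> (\<forall>x \<in> dom p. q (f x) = p x) \<and>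
          r' = f r \<and> v' = jacobian m f r v \<and> w' = jacobian m f r w))"

definition T2_class :: "'a diffeology \<Rightarrow> 'a pre_T2 \<Rightarrow> 'a pre_T2 set" where
  "T2_class X a = {b. equivclp (T2_step X) a b}"

definition T2 :: "'a diffeology \<Rightarrow> 'a pre_T2 set diffeology" where
  "T2 X = quotient (pre_T2 X) (T2_class X)"

definition T2_map :: "'b diffeology \<Rightarrow> ('a \<Rightarrow> 'b) \<Rightarrow> 'a pre_T2 set \<Rightarrow> 'b pre_T2 set" where
  "T2_map Y h = descend (\<lambda>((m, p), z). T2_class Y ((m, map_option h \<circ> p), z))"

lemma T2_class_eqI:
  assumes "equivclp (T2_step X) a b"
  shows "T2_class X a = T2_class X b"
  using assms by (auto simp: T2_class_def intro: equivclp_trans equivclp_sym)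

lemma T2_map_T2_class:
  assumes h: "smooth_map X Y h"
  shows "T2_map Y h (T2_class X ((m, p), z)) = T2_class Y ((m, map_option h \<circ> p), z)"
proof -
  define H :: "'a pre_T2 \<Rightarrow> 'b pre_T2" where "H = (\<lambda>((m, p), z). ((m, map_option h \<circ> p), z))"
  have step: "T2_step Y (H a) (H b)" if ab: "T2_step X a b" for a b
  proof -
    obtain m p r v w k q r' v' w' where eq: "a = ((m, p), r, v, w)" "b = ((k, q), r', v', w')"
      by (metis prod.exhaust)
    have "map_option h \<circ> p \<in> plots Y m" if "p \<in> plots X m" for m p
      using h that by (simp add: smooth_map_def)
    moreover have "dom (map_option h \<circ> p) = dom p" for p :: "vec \<rightharpoonup> 'a"
      by (auto simp: dom_def)
    ultimately show ?thesis
      using ab by (simp add: eq T2_step_def H_def) metis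
  qed
  have "equivclp (T2_step Y) (H a) (H b)" if "equivclp (T2_step X) a b" for a b
    using that
  proof (induction rule: equivclp_induct)
    case base
    then show ?case by simp
  next
    case (step y z)
    from step.hyps(2) have "equivclp (T2_step Y) (H y) (H z)"
      using \<open>\<And>a b. T2_step X a b \<Longrightarrow> T2_step Y (H a) (H b)\<close>
      by (meson equivclp_sym r_into_equivclp)
    with step.IH show ?case by (rule equivclp_trans)
  qed
  then have "T2_class Y (H b) = T2_class Y (H a)" if "b \<in> T2_class X a" for a b
    using that by (metis T2_class_eqI T2_class_def mem_Collect_eq)
  moreover have "a \<in> T2_class X a" for a
    by (simp add: T2_class_def)
  ultimately have "(\<lambda>b. T2_class Y (H b)) ` T2_class X a = {T2_class Y (H a)}" for a
    by blast
  moreover have "T2_map Y h c = the_elem ((\<lambda>b. T2_class Y (H b)) ` c)" for c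
    unfolding T2_map_def descend_def H_def by (simp add: case_prod_unfold)
  ultimately show ?thesis by (simp add: H_def)
qed


section \<open>Riemannian metrics\<close>

definition pullback ::
  "'a diffeology \<Rightarrow> ('a pre_T2 set \<Rightarrow> real) \<Rightarrow> nat \<Rightarrow> (vec \<rightharpoonup> 'a) \<Rightarrow> vec \<Rightarrow> vec \<Rightarrow> vec \<Rightarrow> real" where
  "pullback X g m p r v w = g (T2_class X ((m, p), r, v, w))"

definition covariant_2_tensor ::
  "nat \<Rightarrow> vec set \<Rightarrow> (vec \<Rightarrow> vec \<Rightarrow> vec \<Rightarrow> real) \<Rightarrow> bool" where
  "covariant_2_tensor m U B \<longleftrightarrow>
     (\<forall>r \<in> U. \<forall>u \<in> Rn m. \<forall>v \<in> Rn m. \<forall>w \<in> Rn m. \<forall>a b.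
        B r (\<lambda>i. a * u i + b * v i) w = a * B r u w + b * B r v w \<and>
        B r w (\<lambda>i. a * u i + b * v i) = a * B r w u + b * B r w v) \<and>
     (\<forall>i<m. \<forall>j<m. C_inf_fun m U (\<lambda>r. B r ((\<lambda>_. 0)(i := 1)) ((\<lambda>_. 0)(j := 1))))"

definition symmetric_tensor ::
  "nat \<Rightarrow> vec set \<Rightarrow> (vec \<Rightarrow> vec \<Rightarrow> vec \<Rightarrow> real) \<Rightarrow> bool" where
  "symmetric_tensor m U B \<longleftrightarrow> (\<forall>r \<in> U. \<forall>v \<in> Rn m. \<forall>w \<in> Rn m. B r v w = B r w v)"

definition positive_tensor ::
  "nat \<Rightarrow> vec set \<Rightarrow> (vec \<Rightarrow> vec \<Rightarrow> vec \<Rightarrow> real) \<Rightarrow> bool" where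
  "positive_tensor m U B \<longleftrightarrow> (\<forall>r \<in> U. \<forall>v \<in> Rn m. B r v v \<ge> 0)"

definition positive_definite_tensor ::
  "nat \<Rightarrow> vec set \<Rightarrow> (vec \<Rightarrow> vec \<Rightarrow> vec \<Rightarrow> real) \<Rightarrow> bool" where
  "positive_definite_tensor m U B \<longleftrightarrow> (\<forall>r \<in> U. \<forall>v \<in> Rn m. v \<noteq> (\<lambda>_. 0) \<longrightarrow> B r v v > 0)"

definition weak_riemannian_metric :: "'a diffeology \<Rightarrow> ('a pre_T2 set \<Rightarrow> real) \<Rightarrow> bool" where
  "weak_riemannian_metric X g \<longleftrightarrow>
     smooth_map (T2 X) real_line g \<and>
     (\<forall>m. \<forall>p \<in> plots X m.
        covariant_2_tensor m (dom p) (pullback X g m p) \<and>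
        symmetric_tensor m (dom p) (pullback X g m p) \<and>
        positive_tensor m (dom p) (pullback X g m p))"

text \<open>A Riemannian metric on a manifold \<open>M\<close>, as a function on $T_2M = TM \times_M TM$: its
  expression in every local parametrization \<open>\<xi>\<close> (the inverse of a chart) is a smooth field of
  inner products.\<close>

definition riemannian_metric :: "'a diffeology \<Rightarrow> ('a pre_T2 set \<Rightarrow> real) \<Rightarrow> bool" where
  "riemannian_metric M g \<longleftrightarrow>
     manifold M \<and>
     (\<forall>n \<xi>. transition (euclid n) M \<xi> \<longrightarrow>
        covariant_2_tensor n (dom \<xi>) (pullback M g n \<xi>) \<and>
        symmetric_tensor n (dom \<xi>) (pullback M g n \<xi>) \<and>
        positive_definite_tensor n (dom \<xi>) (pullback M g n \<xi>))"

definition definite_wrt ::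
  "'a diffeology \<Rightarrow> ('a pre_T2 set \<Rightarrow> real) \<Rightarrow> ('m diffeology \<times> ('m \<Rightarrow> 'a)) set \<Rightarrow> bool" where
  "definite_wrt X g \<F> \<longleftrightarrow>
     generates \<F> X \<and> (\<forall>(M, \<Phi>) \<in> \<F>. riemannian_metric M (g \<circ> T2_map X \<Phi>))"

text \<open>\<open>orbifold_param n \<Gamma> \<psi>\<close> is $\psi^{-1} \circ \pi$ on $\mathbb{R}^n$, with natural domain
  $\pi^{-1}(\mathrm{image}(\psi))$.\<close>

definition orbifold_param :: "nat \<Rightarrow> (vec \<Rightarrow> vec) set \<Rightarrow> ('a \<rightharpoonup> vec set) \<Rightarrow> (vec \<rightharpoonup> 'a)" where
  "orbifold_param n \<Gamma> \<psi> = (partial_inverse \<psi> \<circ> orbit_map \<Gamma>) |` Rn n"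

definition chart_domain :: "nat \<Rightarrow> (vec \<Rightarrow> vec) set \<Rightarrow> ('a \<rightharpoonup> vec set) \<Rightarrow> vec diffeology" where
  "chart_domain n \<Gamma> \<psi> = subspace (euclid n) (dom (orbifold_param n \<Gamma> \<psi>))"

definition riemannian_orbifold :: "'a diffeology \<Rightarrow> ('a pre_T2 set \<Rightarrow> real) \<Rightarrow> bool" where
  "riemannian_orbifold X g \<longleftrightarrow>
     diffeological_orbifold X \<and> weak_riemannian_metric X g \<and>
     definite_wrt X g {(chart_domain n \<Gamma> \<psi>, the \<circ> orbifold_param n \<Gamma> \<psi>) | n \<Gamma> \<psi>. orbifold_chart X n \<Gamma> \<psi>}"

definition invariant_metric ::
  "'a diffeology \<Rightarrow> ('a pre_T2 set \<Rightarrow> real) \<Rightarrow> ('a \<rightharpoonup> 'a) set \<Rightarrow> bool" where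
  "invariant_metric M g P \<longleftrightarrow>
     (\<forall>f \<in> P. \<forall>c \<in> points (T2 (subspace M (dom f))).
        g (T2_map M (the \<circ> f) c) = g (T2_map M id c))"


section \<open>Colimits of $T_2$ and the data attached to a family of charts\<close>

definition colim_T2_step ::
  "'i set \<Rightarrow> ('i \<Rightarrow> 'm diffeology) \<Rightarrow> ('i \<Rightarrow> 'i \<Rightarrow> ('m \<Rightarrow> 'm) set) \<Rightarrow>
   'i \<times> 'm pre_T2 set \<Rightarrow> 'i \<times> 'm pre_T2 set \<Rightarrow> bool" where
  "colim_T2_step I V mor = (\<lambda>(i, c) (j, d).
     i \<in> I \<and> j \<in> I \<and> c \<in> points (T2 (V i)) \<and> (\<exists>f \<in> mor i j. d = T2_map (V j) f c))"

definition colim_T2 ::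
  "'i set \<Rightarrow> ('i \<Rightarrow> 'm diffeology) \<Rightarrow> ('i \<Rightarrow> 'i \<Rightarrow> ('m \<Rightarrow> 'm) set) \<Rightarrow>
   ('i \<times> 'm pre_T2 set) set diffeology" where
  "colim_T2 I V mor =
     quotient (coproduct I (\<lambda>i. T2 (V i))) (\<lambda>a. {b. equivclp (colim_T2_step I V mor) a b})"

context
  fixes n :: nat and \<Gamma> :: "'i \<Rightarrow> (vec \<Rightarrow> vec) set" and \<psi> :: "'i \<Rightarrow> 'a \<rightharpoonup> vec set"
begin

definition charts_phi :: "'i \<Rightarrow> vec \<rightharpoonup> 'a" where
  "charts_phi i = orbifold_param n (\<Gamma> i) (\<psi> i)"

definition charts_V :: "'i \<Rightarrow> vec diffeology" where
  "charts_V i = chart_domain n (\<Gamma> i) (\<psi> i)"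

definition charts_sum :: "'i set \<Rightarrow> ('i \<times> vec) diffeology" where
  "charts_sum I = coproduct I charts_V"

definition charts_quotient_map :: "'i \<times> vec \<Rightarrow> 'a" where
  "charts_quotient_map = (\<lambda>(i, x). the (charts_phi i x))"

definition summand_map :: "'i \<Rightarrow> 'i \<Rightarrow> (vec \<rightharpoonup> vec) \<Rightarrow> ('i \<times> vec \<rightharpoonup> 'i \<times> vec)" where
  "summand_map i j f = (\<lambda>(k, x). if k = i then map_option (Pair j) (f x) else None)"

text \<open>The condition $\pi_j \circ f = \psi_j \circ \psi_i^{-1} \circ \pi_i$ is imposed on the domain
  of the transition \<open>f\<close>.\<close>

definition charts_pseudogroup :: "'i set \<Rightarrow> ('i \<times> vec \<rightharpoonup> 'i \<times> vec) set" where
  "charts_pseudogroup I = pseudogroup (charts_sum I) hull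
     {summand_map i j f | i j f. i \<in> I \<and> j \<in> I \<and> transition (charts_V i) (charts_V j) f \<and>
        map_option (orbit_map (\<Gamma> j)) \<circ> f \<subseteq>\<^sub>m \<psi> j \<circ>\<^sub>m charts_phi i}"

definition charts_mor :: "'i \<Rightarrow> 'i \<Rightarrow> (vec \<Rightarrow> vec) set" where
  "charts_mor i j = {f. smooth_map (charts_V i) (charts_V j) f \<and>
     (\<forall>x \<in> points (charts_V i). charts_phi j (f x) = charts_phi i x)}"

definition charts_colim :: "'i set \<Rightarrow> ('i \<times> vec pre_T2 set) set diffeology" where
  "charts_colim I = colim_T2 I charts_V charts_mor"

definition charts_colim_metric ::
  "'i set \<Rightarrow> (('i \<times> vec) pre_T2 set \<Rightarrow> real) \<Rightarrow> ('i \<times> vec pre_T2 set) set \<Rightarrow> real" where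
  "charts_colim_metric I \<eta> = descend (\<lambda>(i, c). \<eta> (T2_map (charts_sum I) (Pair i) c))"

definition charts_colim_map :: "'a diffeology \<Rightarrow> ('i \<times> vec pre_T2 set) set \<Rightarrow> 'a pre_T2 set" where
  "charts_colim_map X = descend (\<lambda>(i, c). T2_map X (the \<circ> charts_phi i) c)"

end

end

(*
  The metric on T_2 X must be given at (p; r, v, w) by the value of the metric of V_i at (Dl v, Dl w),
  where l is a local lift of the plot p through some phi_i, so the point is that this value does not
  depend on the lift.

  Two lifts of the same map through the same chart differ pointwise by elements of the finite group
  Gamma_i. The sets where a given group element works are closed and finite in number, so on a dense
  open set the two lifts differ locally by a fixed group element, and group elements preserve the
  metric. The same argument shows that a lift f of phi_i through phi_j restricts, near the points of a
  dense open set, to a transition in the pseudogroup, so f preserves the metric there. In both cases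
  continuity extends the equality of the pulled-back tensors to all points. Finiteness of the group
  also shows that the derivative of a composite of lifts V_i -> V_j -> V_i is everywhere the derivative
  of a group element; so lifts are immersions, which gives definiteness.
*)

theory Submission
  imports Defs
begin

section \<open>Calculus on open subsets of Euclidean spaces\<close>

text \<open>Invariance under the pseudogroup speaks of diffeomorphisms between open sets, whereas
  the maps to be compared are merely smooth and compatible with the charts. Localizing further
  cannot replace the passage to a dense set: for the group of the reflection x -> -x of the line,
  l(x) = exp(-1/x^2) and l'(x) = sgn(x) exp(-1/x^2), both 0 at 0, lift the same plot, yet no single
  group element carries one to the other near 0. Only the pulled-back tensors agree there, which is
  why tensors and derivatives are compared, not maps. Lifts through different charts are brought
  together by the quotient diffeology: each \<open>\<phi> i\<close> is itself a plot of X, so it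
  lifts locally through every chart that reaches the point in question. This supplies maps between
  two charts in both directions. Vectors in a plot of T_2 X vary with the parameter, while
  smoothness of a tensor is imposed on constant basis fields; the expansion in the coefficient
  matrix bridges this.\<close>

lemma Euclidean_space_eq_top_of_set: "Euclidean_space n = top_of_set (Rn n)"
  unfolding topspace_Euclidean_space by (simp add: Euclidean_space_def euclidean_product_topology)

lemma openin_Euclidean_space_iff: "openin (Euclidean_space n) U \<longleftrightarrow> openin (top_of_set (Rn n)) U"
  by (subst Euclidean_space_eq_top_of_set) (rule refl)

lemma Rn_iff: "x \<in> Rn n \<longleftrightarrow> (\<forall>i\<ge>n. x i = 0)"
  by (simp add: topspace_Euclidean_space)

lemma openin_Euclidean_subset: "openin (Euclidean_space n) U \<Longrightarrow> U \<subseteq> Rn n"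
  by (rule openin_subset)

lemma continuous_map_subtopology_Euclidean_space:
  assumes "U \<subseteq> Rn n"
  shows "continuous_map (subtopology (Euclidean_space n) U) euclidean f \<longleftrightarrow> continuous_on U f"
  using assms by (subst Euclidean_space_eq_top_of_set) (simp add: subtopology_subtopology Int_absorb1)

lemma openin_Euclidean_trans:
  assumes "openin (Euclidean_space n) U" "openin (top_of_set U) W"
  shows "openin (Euclidean_space n) W"
  using assms openin_trans unfolding openin_Euclidean_space_iff by blast

lemma openin_Euclidean_preimage:
  assumes "openin (Euclidean_space m) U" "continuous_on U f" "f ` U \<subseteq> Rn n"
    and "openin (Euclidean_space n) W"
  shows "openin (Euclidean_space m) {x \<in> U. f x \<in> W}"
proof -
  have "openin (top_of_set U) (U \<inter> f -` W)"
    using assms continuous_openin_preimage[of U f "Rn n" W]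
    by (auto simp: openin_Euclidean_space_iff)
  moreover have "U \<inter> f -` W = {x \<in> U. f x \<in> W}"
    by auto
  ultimately show ?thesis
    using openin_Euclidean_trans assms(1) by auto
qed

text \<open>A basic open set of the product topology is a product of open sets of reals. From index
  \<open>n\<close> on, \<open>z\<close> and \<open>x\<close> both vanish, so only the first
  \<open>n\<close> coordinates need a margin.\<close>

lemma openin_Euclidean_contains_box:
  assumes "openin (Euclidean_space n) U" "x \<in> U"
  obtains d where "d > 0" "\<And>z. z \<in> Rn n \<Longrightarrow> (\<And>j. j < n \<Longrightarrow> \<bar>z j - x j\<bar> < d) \<Longrightarrow> z \<in> U"
proof -
  obtain T where T: "open T" "U = Rn n \<inter> T"
    using assms(1) by (auto simp: openin_Euclidean_space_iff openin_open)
  then have "\<exists>Y. x \<in> Pi\<^sub>E UNIV Y \<and> (\<forall>i. open (Y i)) \<and> finite {i. Y i \<noteq> UNIV} \<and> Pi\<^sub>E UNIV Y \<subseteq> T"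
    using product_topology_open_contains_basis[of "\<lambda>_. euclidean" UNIV T] assms(2)
    by (simp add: open_fun_def)
  then obtain Y where Y: "x \<in> Pi\<^sub>E UNIV Y" "\<And>i. open (Y i)" "Pi\<^sub>E UNIV Y \<subseteq> T"
    by metis
  have "\<exists>e>0. \<forall>t. \<bar>t - x i\<bar> < e \<longrightarrow> t \<in> Y i" for i
    using Y(1) Y(2)[of i] by (metis PiE_mem UNIV_I dist_real_def open_dist)
  then obtain e where e: "\<And>i. e i > 0" "\<And>i t. \<bar>t - x i\<bar> < e i \<Longrightarrow> t \<in> Y i"
    by metis
  \<comment> \<open>The element 1 keeps the minimum defined for n = 0.\<close>
  define d where "d = Min (insert 1 (e ` {..<n}))"
  have "d > 0" "\<And>i. i < n \<Longrightarrow> d \<le> e i"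
    using e(1) by (auto simp: d_def)
  moreover have "z \<in> U" if z: "z \<in> Rn n" "\<And>j. j < n \<Longrightarrow> \<bar>z j - x j\<bar> < d" for z
  proof -
    have "z i \<in> Y i" for i
    proof (cases "i < n")
      case True
      then show ?thesis
        using e(2) z(2) \<open>\<And>i. i < n \<Longrightarrow> d \<le> e i\<close> by (meson less_le_trans)
    next
      case False
      then have "z i = x i"
        using z(1) T(2) assms(2) by (simp add: Rn_iff)
      then show ?thesis
        using Y(1) by auto
    qed
    then show ?thesis
      using Y(3) T(2) z(1) by (auto simp: PiE_iff)
  qed
  ultimately show ?thesis
    using that by blast
qed

lemma fun_upd_in_Rn: "x \<in> Rn n \<Longrightarrow> i < n \<Longrightarrow> x(i := t) \<in> Rn n"
  by (simp add: Rn_iff)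

text \<open>\<open>partial_deriv\<close> differentiates a total function along a slice. Near its
  base point the slice stays inside the open set \<open>U\<close>, which is what makes partial
  derivatives local.\<close>

lemma eventually_slice:
  assumes "openin (Euclidean_space n) U" "x \<in> U" "i < n"
  shows "\<forall>\<^sub>F t in nhds (x i). x(i := t) \<in> U"
proof -
  obtain d where d: "d > 0" "\<And>z. z \<in> Rn n \<Longrightarrow> (\<And>j. j < n \<Longrightarrow> \<bar>z j - x j\<bar> < d) \<Longrightarrow> z \<in> U"
    using openin_Euclidean_contains_box[OF assms(1,2)] by metis
  have "x \<in> Rn n"
    using assms openin_Euclidean_subset by blast
  then have "x(i := t) \<in> U" if "dist t (x i) < d" for t
    using that d assms(3) by (auto simp: dist_real_def fun_upd_in_Rn)
  then show ?thesis
    using d(1) eventually_nhds_metric by blast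
qed


subsection \<open>Locality\<close>

lemma eventually_slice_eq:
  assumes "openin (Euclidean_space n) U" "x \<in> U" "i < n" "\<And>y. y \<in> U \<Longrightarrow> f y = g y"
  shows "\<forall>\<^sub>F t in nhds (x i). f (x(i := t)) = g (x(i := t))"
  using eventually_slice[OF assms(1-3)] by (rule eventually_mono) (simp add: assms(4))

lemma partial_deriv_cong:
  assumes "openin (Euclidean_space n) U" "x \<in> U" "i < n" "\<And>y. y \<in> U \<Longrightarrow> f y = g y"
  shows "partial_deriv i f x = partial_deriv i g x"
  unfolding partial_deriv_def
  by (rule deriv_cong_ev[OF eventually_slice_eq[of n U x i f g]]) (use assms in auto)

lemma field_differentiable_slice_cong:
  assumes "openin (Euclidean_space n) U" "x \<in> U" "i < n" "\<And>y. y \<in> U \<Longrightarrow> f y = g y"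
  shows "(\<lambda>t. f (x(i := t))) field_differentiable (at (x i)) \<longleftrightarrow>
         (\<lambda>t. g (x(i := t))) field_differentiable (at (x i))"
  unfolding field_differentiable_def
  using DERIV_cong_ev[OF refl eventually_slice_eq[of n U x i f g] refl] assms by simp

lemma C_k_0: "U \<subseteq> Rn n \<Longrightarrow> C_k 0 n U f \<longleftrightarrow> continuous_on U f"
  by (simp add: continuous_map_subtopology_Euclidean_space)

lemma C_k_Suc:
  "U \<subseteq> Rn n \<Longrightarrow> C_k (Suc k) n U f \<longleftrightarrow> continuous_on U f \<and>
     (\<forall>i<n. (\<forall>x\<in>U. (\<lambda>t. f (x(i := t))) field_differentiable (at (x i))) \<and>
            C_k k n U (partial_deriv i f))"
  by (simp add: continuous_map_subtopology_Euclidean_space)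

lemma C_k_SucD:
  assumes "openin (Euclidean_space n) U" "C_k (Suc k) n U f"
  shows "continuous_on U f"
    and "i < n \<Longrightarrow> x \<in> U \<Longrightarrow> (\<lambda>t. f (x(i := t))) field_differentiable (at (x i))"
    and "i < n \<Longrightarrow> C_k k n U (partial_deriv i f)"
  using assms(2) C_k_Suc[OF openin_Euclidean_subset[OF assms(1)]] by blast+

lemma C_k_SucI:
  assumes "openin (Euclidean_space n) U" "continuous_on U f"
    and "\<And>i x. i < n \<Longrightarrow> x \<in> U \<Longrightarrow> (\<lambda>t. f (x(i := t))) field_differentiable (at (x i))"
    and "\<And>i. i < n \<Longrightarrow> C_k k n U (partial_deriv i f)"
  shows "C_k (Suc k) n U f"
  using assms(2-) C_k_Suc[OF openin_Euclidean_subset[OF assms(1)]] by blast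

lemma C_k_continuous: "openin (Euclidean_space n) U \<Longrightarrow> C_k k n U f \<Longrightarrow> continuous_on U f"
  by (cases k) (use C_k_0 openin_Euclidean_subset in blast, use C_k_SucD(1) in blast)

lemma C_k_cong:
  assumes "openin (Euclidean_space n) U" "\<And>y. y \<in> U \<Longrightarrow> f y = g y"
  shows "C_k k n U f \<longleftrightarrow> C_k k n U g"
  using assms(2)
proof (induction k arbitrary: f g)
  case 0
  have "continuous_on U f \<longleftrightarrow> continuous_on U g"
    by (rule continuous_on_cong) (use 0 in auto)
  then show ?case
    using openin_Euclidean_subset[OF assms(1)]
    by (simp add: continuous_map_subtopology_Euclidean_space)
next
  case (Suc k)
  have "continuous_on U f \<longleftrightarrow> continuous_on U g"
    by (rule continuous_on_cong) (use Suc in auto)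
  moreover have "C_k k n U (partial_deriv i f) \<longleftrightarrow> C_k k n U (partial_deriv i g)" if "i < n" for i
    by (rule Suc.IH) (rule partial_deriv_cong[OF assms(1) _ that Suc.prems], assumption+)
  ultimately show ?case
    using C_k_Suc[OF openin_Euclidean_subset[OF assms(1)]]
      field_differentiable_slice_cong[of n U _ _ f g] assms(1) Suc.prems
    by (simp del: C_k.simps)
qed

lemma C_k_local:
  assumes "\<And>x. x \<in> U \<Longrightarrow> \<exists>W. x \<in> W \<and> openin (Euclidean_space n) W \<and> C_k k n W f"
    and U: "openin (Euclidean_space n) U"
  shows "C_k k n U f"
  using assms(1)
proof (induction k arbitrary: f)
  have ctn: "continuous_on U f"
    if *: "\<And>x. x \<in> U \<Longrightarrow> \<exists>W. x \<in> W \<and> openin (Euclidean_space n) W \<and> continuous_on W f" for f :: "vec \<Rightarrow> real"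
    unfolding continuous_on_eq_continuous_within
  proof
    fix x assume x: "x \<in> U"
    then obtain W where W: "x \<in> W" "openin (Euclidean_space n) W" "continuous_on W f"
      using * by blast
    obtain T where T: "open T" "W = Rn n \<inter> T"
      using W(2) by (auto simp: openin_Euclidean_space_iff openin_open)
    obtain T' where T': "open T'" "U = Rn n \<inter> T'"
      using U by (auto simp: openin_Euclidean_space_iff openin_open)
    have "at x within U = at x within W"
      by (rule at_within_nhd[of x "T \<inter> T'"]) (use x W(1) T T' in auto)
    then show "continuous (at x within U) f"
      using W(1,3) by (simp add: continuous_on_eq_continuous_within continuous_within)
  qed
  have ctn': "continuous_on U f"
    if "\<And>x. x \<in> U \<Longrightarrow> \<exists>W. x \<in> W \<and> openin (Euclidean_space n) W \<and> C_k k n W f" for f k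
  proof (rule ctn)
    fix x assume "x \<in> U"
    then show "\<exists>W. x \<in> W \<and> openin (Euclidean_space n) W \<and> continuous_on W f"
      using that[of x] C_k_continuous by meson
  qed
  {
    case 0
    then show ?case
      using ctn' C_k_0 openin_Euclidean_subset[OF U] by blast
  next
    case (Suc k)
    show ?case
    proof (rule C_k_SucI[OF U ctn'[OF Suc.prems]])
      fix i assume i: "i < n"
      show "C_k k n U (partial_deriv i f)"
      proof (rule Suc.IH)
        fix x assume "x \<in> U"
        then show "\<exists>W. x \<in> W \<and> openin (Euclidean_space n) W \<and> C_k k n W (partial_deriv i f)"
          using Suc.prems[of x] C_k_SucD(3)[OF _ _ i] by blast
      qed
      fix x assume "x \<in> U"
      then show "(\<lambda>t. f (x(i := t))) field_differentiable at (x i)"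
        using Suc.prems[of x] C_k_SucD(2)[OF _ _ i] by blast
    qed
  }
qed

lemma C_k_subset:
  assumes "C_k k n U f" "W \<subseteq> U" "U \<subseteq> Rn n"
  shows "C_k k n W f"
  using assms(1)
proof (induction k arbitrary: f)
  case 0
  then show ?case
    using assms(2,3) by (simp add: continuous_map_subtopology_Euclidean_space continuous_on_subset)
next
  case (Suc k)
  then show ?case
    using assms(2,3) continuous_on_subset
    by (auto simp add: continuous_map_subtopology_Euclidean_space)
qed

lemma C_k_Suc_imp: "C_k (Suc k) n U f \<Longrightarrow> C_k k n U f"
  by (induction k arbitrary: f) auto

lemma partial_deriv_DERIV:
  assumes "(\<lambda>t. f (x(i := t))) field_differentiable (at (x i))"
  shows "((\<lambda>t. f (x(i := t))) has_field_derivative partial_deriv i f x) (at (x i))"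
  using assms by (simp add: partial_deriv_def DERIV_deriv_iff_field_differentiable)


subsection \<open>The chain rule\<close>

text \<open>Move from \<open>y\<close> to \<open>z\<close> by changing one coordinate at a time. On
  each segment the mean value inequality, applied to f minus its linear term, bounds the error by
  \<open>e\<close> times the increment, because continuity keeps the partial derivatives within
  \<open>e\<close> of their values at \<open>y\<close> on a small box.\<close>

lemma C_1_differentiable:
  assumes U: "openin (Euclidean_space n) U" and f: "C_k 1 n U f" and y: "y \<in> U" and e: "e > 0"
  shows "\<exists>d>0. \<forall>z\<in>Rn n. (\<forall>j<n. \<bar>z j - y j\<bar> < d) \<longrightarrow>
     z \<in> U \<and> \<bar>f z - f y - (\<Sum>j<n. partial_deriv j f y * (z j - y j))\<bar> \<le> e * (\<Sum>j<n. \<bar>z j - y j\<bar>)"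
proof -
  note Usub = openin_Euclidean_subset[OF U]
  have f': "C_k (Suc 0) n U f"
    using f by simp
  have cont: "continuous_on U (partial_deriv j f)" if "j < n" for j
    using f' that Usub by (simp add: C_k_0 C_k_Suc del: C_k.simps)
  have diff: "((\<lambda>t. f (x(i := t))) has_field_derivative partial_deriv i f x) (at (x i))"
    if "x \<in> U" "i < n" for x i
    using f' that Usub by (intro partial_deriv_DERIV) (simp add: C_k_Suc del: C_k.simps)
  define W where "W = U \<inter> (\<Inter>j\<in>{..<n}. {z \<in> U. partial_deriv j f z \<in> ball (partial_deriv j f y) e})"
  have "openin (Euclidean_space n) {z \<in> U. partial_deriv j f z \<in> ball (partial_deriv j f y) e}" if "j < n" for j
  proof -
    have "openin (top_of_set U) (U \<inter> partial_deriv j f -` ball (partial_deriv j f y) e)"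
      using cont[OF that] by (intro continuous_openin_preimage_gen) auto
    moreover have "U \<inter> partial_deriv j f -` ball (partial_deriv j f y) e = {z \<in> U. partial_deriv j f z \<in> ball (partial_deriv j f y) e}"
      by auto
    ultimately show ?thesis
      using openin_Euclidean_trans[OF U] by auto
  qed
  then have "openin (Euclidean_space n) W"
  proof (cases "n = 0")
    case False
    assume *: "\<And>j. j < n \<Longrightarrow> openin (Euclidean_space n) {z \<in> U. partial_deriv j f z \<in> ball (partial_deriv j f y) e}"
    have "openin (Euclidean_space n) (\<Inter>j\<in>{..<n}. {z \<in> U. partial_deriv j f z \<in> ball (partial_deriv j f y) e})"
      by (rule openin_INT2) (use * False in auto)
    then show ?thesis
      unfolding W_def using U by blast
  next
    case True
    then show ?thesis
      using U unfolding W_def by simp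
  qed
  moreover have "y \<in> W"
    using y e by (simp add: W_def)
  ultimately obtain d where d: "d > 0" "\<And>z. z \<in> Rn n \<Longrightarrow> (\<And>j. j < n \<Longrightarrow> \<bar>z j - y j\<bar> < d) \<Longrightarrow> z \<in> W"
    using openin_Euclidean_contains_box by metis
  have close: "z \<in> U" "j < n \<Longrightarrow> \<bar>partial_deriv j f z - partial_deriv j f y\<bar> \<le> e" if "z \<in> W" for z j
    using that by (auto simp: W_def dist_real_def abs_minus_commute intro: less_imp_le)
  show ?thesis
  proof (intro exI[of _ d] conjI[OF d(1)] ballI impI)
    fix z assume "z \<in> Rn n" "\<forall>j<n. \<bar>z j - y j\<bar> < d"
    then have z: "z \<in> Rn n" "\<And>j. j < n \<Longrightarrow> \<bar>z j - y j\<bar> < d"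
      by auto
    \<comment> \<open>The corners of the path: the first \<open>k\<close> coordinates come from
      \<open>z\<close>, the others from \<open>y\<close>, so \<open>h 0 = y\<close> and
      \<open>h n = z\<close>.\<close>
    define h where "h k = (\<lambda>j. if j < k then z j else y j)" for k
    have yR: "y \<in> Rn n"
      using y Usub by blast
    have step: "\<bar>f (h (Suc k)) - f (h k) - partial_deriv k f y * (z k - y k)\<bar> \<le> e * \<bar>z k - y k\<bar>"
      if k: "k < n" for k
    proof -
      have mem: "(h k)(k := t) \<in> W" if "t \<in> ball (y k) d" for t
      proof (rule d(2))
        show "(h k)(k := t) \<in> Rn n"
          using z(1) yR k by (auto simp: Rn_iff h_def)
        show "\<bar>((h k)(k := t)) j - y j\<bar> < d" if "j < n" for j
          using z(2)[OF that] \<open>t \<in> ball (y k) d\<close> d(1) by (auto simp: h_def dist_real_def)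
      qed
      have eqs: "h (Suc k) = (h k)(k := z k)" "h k = (h k)(k := y k)"
        by (auto simp: h_def less_Suc_eq)
      have "norm ((f ((h k)(k := z k)) - partial_deriv k f y * z k) - (f ((h k)(k := y k)) - partial_deriv k f y * y k))
        \<le> e * norm (z k - y k)"
      proof (rule field_differentiable_bound[where S = "ball (y k) d"
            and f' = "\<lambda>t. partial_deriv k f ((h k)(k := t)) - partial_deriv k f y"])
        fix t assume t: "t \<in> ball (y k) d"
        have "((\<lambda>s. f (((h k)(k := t))(k := s))) has_field_derivative partial_deriv k f ((h k)(k := t))) (at (((h k)(k := t)) k))"
          by (rule diff) (use close mem[OF t] k in auto)
        then have "((\<lambda>s. f ((h k)(k := s))) has_field_derivative partial_deriv k f ((h k)(k := t))) (at t)"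
          by simp
        then show "((\<lambda>t. f ((h k)(k := t)) - partial_deriv k f y * t) has_field_derivative
            partial_deriv k f ((h k)(k := t)) - partial_deriv k f y) (at t within ball (y k) d)"
          by (auto intro!: derivative_eq_intros intro: has_field_derivative_at_within)
        show "norm (partial_deriv k f ((h k)(k := t)) - partial_deriv k f y) \<le> e"
          using close(2)[OF mem[OF t] k] by simp
      qed (use d(1) z(2)[OF k] in \<open>auto simp: dist_real_def abs_minus_commute\<close>)
      then show ?thesis
        by (simp add: eqs(1) eqs(2)[symmetric] algebra_simps)
    qed
    have "h n = z" "h 0 = y"
      using z(1) yR by (auto simp: h_def Rn_iff)
    then have "f z - f y - (\<Sum>j<n. partial_deriv j f y * (z j - y j)) =
        (\<Sum>k<n. f (h (Suc k)) - f (h k) - partial_deriv k f y * (z k - y k))"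
      using sum_lessThan_telescope[of "\<lambda>k. f (h k)" n] by (simp add: sum_subtractf)
    also have "\<bar>\<dots>\<bar> \<le> (\<Sum>k<n. e * \<bar>z k - y k\<bar>)"
      by (intro order.trans[OF sum_abs] sum_mono) (use step in auto)
    finally have "\<bar>f z - f y - (\<Sum>j<n. partial_deriv j f y * (z j - y j))\<bar> \<le> e * (\<Sum>j<n. \<bar>z j - y j\<bar>)"
      by (simp add: sum_distrib_left)
    moreover have "z \<in> U"
      using d(2)[OF z] close(1) by blast
    ultimately show "z \<in> U \<and> \<bar>f z - f y - (\<Sum>j<n. partial_deriv j f y * (z j - y j))\<bar> \<le> e * (\<Sum>j<n. \<bar>z j - y j\<bar>)"
      by blast
  qed
qed

text \<open>Split f(c t) into its value at \<open>t0\<close>, the linear part \<open>L\<close> and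
  the remainder \<open>R\<close>. The first-order estimate for f and a Lipschitz bound for the
  coordinates of c at \<open>t0\<close> show that \<open>R\<close> has derivative 0.\<close>

lemma chain_rule_curve:
  assumes U: "openin (Euclidean_space n) U" and f: "C_k 1 n U f"
    and c: "c t0 \<in> U" "\<forall>\<^sub>F t in nhds t0. c t \<in> Rn n"
    and c': "\<And>j. j < n \<Longrightarrow> ((\<lambda>t. c t j) has_field_derivative c' j) (at t0)"
  shows "((\<lambda>t. f (c t)) has_field_derivative (\<Sum>j<n. partial_deriv j f (c t0) * c' j)) (at t0)"
proof -
  define y where "y = c t0"
  define L where "L t = (\<Sum>j<n. partial_deriv j f y * (c t j - y j))" for t
  define R where "R t = f (c t) - f y - L t" for t
  \<comment> \<open>Near \<open>t0\<close> each coordinate moves by at most (|c' j| + 1) |t - t0|,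
    so \<open>K\<close> bounds the total rate. The last 1 makes \<open>K\<close> positive also for n
    = 0, which allows the estimate for f to be used with \<open>e / K\<close>.\<close>
  define K where "K = (\<Sum>j<n. \<bar>c' j\<bar> + 1) + 1"
  have K: "K > 0"
    unfolding K_def by (intro add_nonneg_pos sum_nonneg) auto
  have lip: "\<forall>\<^sub>F t in at t0. \<bar>c t j - y j\<bar> \<le> (\<bar>c' j\<bar> + 1) * \<bar>t - t0\<bar>" if "j < n" for j
  proof -
    have "((\<lambda>t. c t j) has_derivative (\<lambda>h. c' j * h)) (at t0)"
      using c'[OF that] by (simp add: has_field_derivative_def)
    then have "\<forall>\<^sub>F t in at t0. norm (c t j - c t0 j - c' j * (t - t0)) \<le> 1 * norm (t - t0)"
      unfolding has_derivative_within_alt2 using zero_less_one by blast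
    then show ?thesis
    proof (rule eventually_mono)
      fix t assume *: "norm (c t j - c t0 j - c' j * (t - t0)) \<le> 1 * norm (t - t0)"
      have "\<bar>a\<bar> \<le> \<bar>b\<bar> + d" if "\<bar>a - b\<bar> \<le> d" for a b d :: real
        using that by linarith
      then have "\<bar>c t j - y j\<bar> \<le> \<bar>c' j * (t - t0)\<bar> + \<bar>t - t0\<bar>"
        using * unfolding y_def real_norm_def mult_1 .
      then show "\<bar>c t j - y j\<bar> \<le> (\<bar>c' j\<bar> + 1) * \<bar>t - t0\<bar>"
        unfolding abs_mult distrib_right by simp
    qed
  qed
  have close: "\<forall>\<^sub>F t in at t0. \<bar>c t j - y j\<bar> < d" if "j < n" "d > 0" for j d
  proof -
    have "((\<lambda>t. c t j) \<longlongrightarrow> y j) (at t0)"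
      unfolding y_def using DERIV_isCont[OF c'[OF that(1)]] by (simp add: isCont_def)
    then show ?thesis
      using that(2) by (simp add: tendsto_iff dist_real_def)
  qed
  have "(R has_derivative (\<lambda>h. 0 * h)) (at t0)"
    unfolding has_derivative_within_alt2
  proof (intro conjI allI impI)
    fix e :: real assume e: "e > 0"
    have "y \<in> U" "e / K > 0"
      using c(1) e K by (simp_all add: y_def)
    obtain d where d: "d > 0" "\<forall>z\<in>Rn n. (\<forall>j<n. \<bar>z j - y j\<bar> < d) \<longrightarrow>
        z \<in> U \<and> \<bar>f z - f y - (\<Sum>j<n. partial_deriv j f y * (z j - y j))\<bar> \<le> (e / K) * (\<Sum>j<n. \<bar>z j - y j\<bar>)"
      using C_1_differentiable[OF U f \<open>y \<in> U\<close> \<open>e / K > 0\<close>] by blast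
    have "\<forall>\<^sub>F t in at t0. c t \<in> Rn n"
      using c(2) by (simp add: eventually_nhds_conv_at)
    moreover have "\<forall>\<^sub>F t in at t0. \<forall>j\<in>{..<n}. \<bar>c t j - y j\<bar> < d"
      using close d(1) by (simp add: eventually_ball_finite)
    moreover have "\<forall>\<^sub>F t in at t0. \<forall>j\<in>{..<n}. \<bar>c t j - y j\<bar> \<le> (\<bar>c' j\<bar> + 1) * \<bar>t - t0\<bar>"
      using lip by (simp add: eventually_ball_finite)
    ultimately show "\<forall>\<^sub>F t in at t0. norm (R t - R t0 - 0 * (t - t0)) \<le> e * norm (t - t0)"
    proof eventually_elim
      case (elim t)
      have "(\<Sum>j<n. \<bar>c t j - y j\<bar>) \<le> (\<Sum>j<n. (\<bar>c' j\<bar> + 1) * \<bar>t - t0\<bar>)"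
        by (rule sum_mono) (use elim in auto)
      also have "\<dots> = (K - 1) * \<bar>t - t0\<bar>"
        by (simp add: K_def sum_distrib_right)
      also have "\<dots> \<le> K * \<bar>t - t0\<bar>"
        by (simp add: mult_right_mono)
      finally have "(e / K) * (\<Sum>j<n. \<bar>c t j - y j\<bar>) \<le> (e / K) * (K * \<bar>t - t0\<bar>)"
        using e K by (intro mult_left_mono) auto
      moreover have "\<bar>R t\<bar> \<le> (e / K) * (\<Sum>j<n. \<bar>c t j - y j\<bar>)"
        unfolding R_def L_def using d(2)[rule_format, OF elim(1)] elim(2) by simp
      moreover have "R t0 = 0"
        by (simp add: R_def L_def y_def)
      ultimately show ?case
        using K by simp
    qed
  qed (rule bounded_linear_mult_right)
  then have "(R has_field_derivative 0) (at t0)"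
    by (rule has_derivative_imp_has_field_derivative) simp
  moreover have "(L has_field_derivative (\<Sum>j<n. partial_deriv j f y * c' j)) (at t0)"
    unfolding L_def by (auto intro!: derivative_eq_intros c' simp: mult.commute)
  ultimately have "((\<lambda>t. f y + L t + R t) has_field_derivative (\<Sum>j<n. partial_deriv j f y * c' j)) (at t0)"
    by (auto intro!: derivative_eq_intros)
  then show ?thesis
    by (simp add: R_def y_def)
qed

lemma chain_rule_slice:
  assumes W: "openin (Euclidean_space m) W" and U: "openin (Euclidean_space n) U"
    and f: "C_k 1 n U f" and g: "\<And>j. j < n \<Longrightarrow> C_k 1 m W (\<lambda>x. g x j)" "g ` W \<subseteq> U"
    and x: "x \<in> W" and i: "i < m"
  shows "((\<lambda>t. f (g (x(i := t)))) has_field_derivative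
     (\<Sum>j<n. partial_deriv j f (g x) * partial_deriv i (\<lambda>x. g x j) x)) (at (x i))"
proof -
  have "((\<lambda>t. f (g (x(i := t)))) has_field_derivative
     (\<Sum>j<n. partial_deriv j f (g (x(i := x i))) * partial_deriv i (\<lambda>x. g x j) x)) (at (x i))"
  proof (rule chain_rule_curve[OF U f])
    show "g (x(i := x i)) \<in> U"
      using g(2) x by auto
    show "\<forall>\<^sub>F t in nhds (x i). g (x(i := t)) \<in> Rn n"
      using eventually_slice[OF W x i] by (rule eventually_mono) (use g(2) openin_Euclidean_subset[OF U] in auto)
    show "((\<lambda>t. g (x(i := t)) j) has_field_derivative partial_deriv i (\<lambda>x. g x j) x) (at (x i))" if "j < n" for j
      by (rule partial_deriv_DERIV) (use g(1)[OF that] x i in simp)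
  qed
  then show ?thesis
    by simp
qed

lemma partial_deriv_compose:
  assumes "openin (Euclidean_space m) W" "openin (Euclidean_space n) U"
    and "C_k 1 n U f" "\<And>j. j < n \<Longrightarrow> C_k 1 m W (\<lambda>x. g x j)" "g ` W \<subseteq> U"
    and "x \<in> W" "i < m"
  shows "partial_deriv i (\<lambda>x. f (g x)) x = (\<Sum>j<n. partial_deriv j f (g x) * partial_deriv i (\<lambda>x. g x j) x)"
  unfolding partial_deriv_def[of i "\<lambda>x. f (g x)"] by (rule DERIV_imp_deriv) (rule chain_rule_slice[OF assms])


subsection \<open>Closure properties of smooth functions\<close>

lemma continuous_on_vec:
  assumes "\<And>j. j < n \<Longrightarrow> continuous_on W (\<lambda>x. g x j)" "g ` W \<subseteq> Rn n"
  shows "continuous_on W (g :: 'a::topological_space \<Rightarrow> vec)"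
proof (rule continuous_on_coordinatewise_then_product)
  fix j
  show "continuous_on W (\<lambda>x. g x j)"
  proof (cases "j < n")
    case False
    then have "continuous_on W (\<lambda>x. g x j) \<longleftrightarrow> continuous_on W (\<lambda>x. 0 :: real)"
      by (intro continuous_on_cong) (use assms(2) in \<open>auto simp: Rn_iff\<close>)
    then show ?thesis
      by simp
  qed (use assms in auto)
qed

lemma C_k_const: "openin (Euclidean_space n) U \<Longrightarrow> C_k k n U (\<lambda>x. a)"
proof (induction k arbitrary: a)
  case (Suc k)
  moreover have "partial_deriv i (\<lambda>x. a) = (\<lambda>x. 0)" for i
    unfolding partial_deriv_def by (rule ext) simp
  ultimately show ?case
    using openin_Euclidean_subset by (simp add: C_k_Suc del: C_k.simps(2))
qed simp

lemma C_k_add: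
  assumes U: "openin (Euclidean_space n) U"
  shows "C_k k n U f \<Longrightarrow> C_k k n U g \<Longrightarrow> C_k k n U (\<lambda>x. f x + g x)"
proof (induction k arbitrary: f g)
  case 0
  then show ?case
    using openin_Euclidean_subset[OF U] by (simp add: C_k_0 continuous_on_add del: C_k.simps)
next
  case (Suc k)
  have d: "((\<lambda>t. f (x(i := t)) + g (x(i := t))) has_field_derivative (partial_deriv i f x + partial_deriv i g x)) (at (x i))"
    if "x \<in> U" "i < n" for x i
    by (intro DERIV_add partial_deriv_DERIV C_k_SucD(2)[OF U Suc.prems(1)] C_k_SucD(2)[OF U Suc.prems(2)] that)
  have "C_k k n U (partial_deriv i (\<lambda>x. f x + g x))" if "i < n" for i
  proof -
    have "C_k k n U (\<lambda>x. partial_deriv i f x + partial_deriv i g x)"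
      by (intro Suc.IH C_k_SucD(3)[OF U] that Suc.prems)
    moreover have "partial_deriv i (\<lambda>x. f x + g x) x = partial_deriv i f x + partial_deriv i g x" if "x \<in> U" for x
      unfolding partial_deriv_def[of i "\<lambda>x. f x + g x"] using d[OF that \<open>i < n\<close>] by (rule DERIV_imp_deriv)
    ultimately show ?thesis
      using C_k_cong[OF U] by (metis (no_types, lifting))
  qed
  then show ?case
    using continuous_on_add[OF C_k_SucD(1)[OF U Suc.prems(1)] C_k_SucD(1)[OF U Suc.prems(2)]] d
    by (intro C_k_SucI[OF U]) (auto simp only: field_differentiable_def)
qed

lemma C_k_mult:
  assumes U: "openin (Euclidean_space n) U"
  shows "C_k k n U f \<Longrightarrow> C_k k n U g \<Longrightarrow> C_k k n U (\<lambda>x. f x * g x)"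
proof (induction k arbitrary: f g)
  case 0
  then show ?case
    using openin_Euclidean_subset[OF U] by (simp add: C_k_0 continuous_on_mult del: C_k.simps)
next
  case (Suc k)
  \<comment> \<open>The product rule leaves one factor undifferentiated; it is needed at order
    \<open>k\<close>.\<close>
  note fg = Suc.prems(1)[THEN C_k_Suc_imp] Suc.prems(2)[THEN C_k_Suc_imp]
  have d: "((\<lambda>t. f (x(i := t)) * g (x(i := t))) has_field_derivative (partial_deriv i f x * g x + f x * partial_deriv i g x)) (at (x i))"
    if "x \<in> U" "i < n" for x i
  proof -
    have "((\<lambda>t. f (x(i := t)) * g (x(i := t))) has_field_derivative (f (x(i := x i)) * partial_deriv i g x + partial_deriv i f x * g (x(i := x i)))) (at (x i))"
      by (intro DERIV_mult' partial_deriv_DERIV C_k_SucD(2)[OF U Suc.prems(1)] C_k_SucD(2)[OF U Suc.prems(2)] that)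
    then show ?thesis
      by (simp add: add.commute)
  qed
  have "C_k k n U (partial_deriv i (\<lambda>x. f x * g x))" if "i < n" for i
  proof -
    have "C_k k n U (\<lambda>x. partial_deriv i f x * g x + f x * partial_deriv i g x)"
      by (intro C_k_add[OF U] Suc.IH C_k_SucD(3)[OF U] that Suc.prems fg)
    moreover have "partial_deriv i (\<lambda>x. f x * g x) x = partial_deriv i f x * g x + f x * partial_deriv i g x" if "x \<in> U" for x
      unfolding partial_deriv_def[of i "\<lambda>x. f x * g x"] using d[OF that \<open>i < n\<close>] by (rule DERIV_imp_deriv)
    ultimately show ?thesis
      using C_k_cong[OF U] by (metis (no_types, lifting))
  qed
  then show ?case
    using continuous_on_mult[OF C_k_SucD(1)[OF U Suc.prems(1)] C_k_SucD(1)[OF U Suc.prems(2)]] d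
    by (intro C_k_SucI[OF U]) (auto simp only: field_differentiable_def)
qed

lemma C_k_sum:
  assumes "openin (Euclidean_space n) U" "\<And>a. a \<in> A \<Longrightarrow> C_k k n U (f a)"
  shows "C_k k n U (\<lambda>x. \<Sum>a\<in>A. f a x)"
  using assms by (induction A rule: infinite_finite_induct) (auto intro: C_k_add C_k_const)

text \<open>Induction on \<open>k\<close> with g fixed and f arbitrary: by the chain rule a partial
  derivative of the composite is a sum of products of a partial derivative of f after g, to which
  the induction hypothesis applies, and a partial derivative of a coordinate of g.\<close>

lemma C_k_compose:
  assumes W: "openin (Euclidean_space m) W" and U: "openin (Euclidean_space n) U" and gW: "g ` W \<subseteq> U"
  shows "C_k k n U f \<Longrightarrow> (\<And>j. j < n \<Longrightarrow> C_k k m W (\<lambda>x. g x j)) \<Longrightarrow> C_k k m W (\<lambda>x. f (g x))"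
proof (induction k arbitrary: f)
  have ctn: "continuous_on W (\<lambda>x. f (g x))"
    if "continuous_on U f" "\<And>j. j < n \<Longrightarrow> continuous_on W (\<lambda>x. g x j)" for f :: "vec \<Rightarrow> real"
  proof -
    have "continuous_on W g"
      by (rule continuous_on_vec[of n]) (use that gW openin_Euclidean_subset[OF U] in auto)
    then show ?thesis
      using continuous_on_compose2 that(1) gW by blast
  qed
  {
    case 0
    then show ?case
      using ctn openin_Euclidean_subset[OF U] openin_Euclidean_subset[OF W]
      by (simp add: C_k_0 del: C_k.simps)
  next
    case (Suc k)
    note simps = C_k_Suc[OF openin_Euclidean_subset[OF U]] C_k_Suc[OF openin_Euclidean_subset[OF W]]
    have C1: "C_k 1 n U f" "\<And>j. j < n \<Longrightarrow> C_k 1 m W (\<lambda>x. g x j)"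
    proof -
      have "C_k (Suc k) p T h \<Longrightarrow> C_k 1 p T h" for p T h
        by (induction k) (metis One_nat_def, metis C_k_Suc_imp)
      then show "C_k 1 n U f" "\<And>j. j < n \<Longrightarrow> C_k 1 m W (\<lambda>x. g x j)"
        using Suc.prems by blast+
    qed
    have d: "((\<lambda>t. f (g (x(i := t)))) has_field_derivative
        (\<Sum>j<n. partial_deriv j f (g x) * partial_deriv i (\<lambda>x. g x j) x)) (at (x i))"
      if "x \<in> W" "i < m" for x i
      by (rule chain_rule_slice[OF W U C1 gW that])
    have "C_k k m W (partial_deriv i (\<lambda>x. f (g x)))" if i: "i < m" for i
    proof -
      have "C_k k m W (\<lambda>x. \<Sum>j<n. partial_deriv j f (g x) * partial_deriv i (\<lambda>x. g x j) x)"
      proof (intro C_k_sum[OF W] C_k_mult[OF W])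
        fix j assume "j \<in> {..<n}"
        then have j: "j < n"
          by simp
        show "C_k k m W (\<lambda>x. partial_deriv j f (g x))"
        proof (rule Suc.IH)
          show "C_k k n U (partial_deriv j f)"
            using Suc.prems(1) j unfolding simps by blast
          show "C_k k m W (\<lambda>x. g x j')" if "j' < n" for j'
            using Suc.prems(2)[OF that] by (rule C_k_Suc_imp)
        qed
        show "C_k k m W (partial_deriv i (\<lambda>x. g x j))"
          using Suc.prems(2)[OF j] i unfolding simps by blast
      qed
      moreover have "partial_deriv i (\<lambda>x. f (g x)) x = (\<Sum>j<n. partial_deriv j f (g x) * partial_deriv i (\<lambda>x. g x j) x)"
        if "x \<in> W" for x
        by (rule partial_deriv_compose[OF W U C1 gW that i])
      ultimately show ?thesis
        using C_k_cong[OF W] by (metis (no_types, lifting))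
    qed
    moreover have "continuous_on W (\<lambda>x. f (g x))"
    proof (rule ctn)
      show "continuous_on U f"
        using Suc.prems(1) unfolding simps by blast
      show "continuous_on W (\<lambda>x. g x j)" if "j < n" for j
        using Suc.prems(2)[OF that] unfolding simps by blast
    qed
    ultimately show ?case
      using d unfolding simps field_differentiable_def by blast
  }
qed

subsection \<open>Smooth maps\<close>

lemma C_inf_fun_cong:
  "openin (Euclidean_space n) U \<Longrightarrow> (\<And>y. y \<in> U \<Longrightarrow> f y = g y) \<Longrightarrow> C_inf_fun n U f \<longleftrightarrow> C_inf_fun n U g"
  unfolding C_inf_fun_def using C_k_cong[of n U f g] by blast

lemma C_inf_fun_local:
  assumes "openin (Euclidean_space n) U"
    and "\<And>x. x \<in> U \<Longrightarrow> \<exists>W. x \<in> W \<and> openin (Euclidean_space n) W \<and> C_inf_fun n W f"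
  shows "C_inf_fun n U f"
  unfolding C_inf_fun_def
proof
  fix k
  show "C_k k n U f"
    by (rule C_k_local[OF _ assms(1)]) (use assms(2) C_inf_fun_def in metis)
qed

lemma C_inf_fun_subset: "C_inf_fun n U f \<Longrightarrow> W \<subseteq> U \<Longrightarrow> U \<subseteq> Rn n \<Longrightarrow> C_inf_fun n W f"
  unfolding C_inf_fun_def using C_k_subset by blast

lemma C_inf_fun_const: "openin (Euclidean_space n) U \<Longrightarrow> C_inf_fun n U (\<lambda>x. a)"
  unfolding C_inf_fun_def using C_k_const by blast

lemma C_inf_fun_mult:
  "openin (Euclidean_space n) U \<Longrightarrow> C_inf_fun n U f \<Longrightarrow> C_inf_fun n U g \<Longrightarrow> C_inf_fun n U (\<lambda>x. f x * g x)"
  unfolding C_inf_fun_def using C_k_mult by blast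

lemma C_inf_fun_sum:
  "openin (Euclidean_space n) U \<Longrightarrow> (\<And>a. a \<in> A \<Longrightarrow> C_inf_fun n U (f a)) \<Longrightarrow> C_inf_fun n U (\<lambda>x. \<Sum>a\<in>A. f a x)"
  unfolding C_inf_fun_def using C_k_sum[of n U A _ f] by blast

lemma C_inf_fun_continuous: "openin (Euclidean_space n) U \<Longrightarrow> C_inf_fun n U f \<Longrightarrow> continuous_on U f"
  unfolding C_inf_fun_def using C_k_continuous by blast

lemma C_inf_fun_partial_deriv:
  "openin (Euclidean_space n) U \<Longrightarrow> C_inf_fun n U f \<Longrightarrow> i < n \<Longrightarrow> C_inf_fun n U (partial_deriv i f)"
  unfolding C_inf_fun_def using C_k_SucD(3) by blast

lemma C_inf_fun_coordinate:
  assumes U: "openin (Euclidean_space n) U"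
  shows "C_inf_fun n U (\<lambda>x. x j)"
proof -
  have c: "continuous_on U (\<lambda>x. x j)"
    by (rule continuous_on_subset[OF continuous_on_product_coordinates]) simp
  have *: "((\<lambda>t. (x(i := t)) j) has_field_derivative (if i = j then 1 else 0)) (at (x i))" for x :: vec and i
    by (auto simp: fun_upd_def)
  then have fd: "(\<lambda>t. (x(i := t)) j) field_differentiable at (x i)" for x :: vec and i
    unfolding field_differentiable_def by blast
  have "partial_deriv i (\<lambda>x. x j) = (\<lambda>x. if i = j then 1 else 0)" for i
    using * by (intro ext) (simp add: partial_deriv_def DERIV_imp_deriv)
  then have "C_k k n U (\<lambda>x. x j)" for k
    by (cases k)
      (use fd c C_k_const[OF U] C_k_0[OF openin_Euclidean_subset[OF U]] in
        \<open>auto simp del: C_k.simps fun_upd_apply intro!: C_k_SucI[OF U]\<close>)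
  then show ?thesis
    by (simp add: C_inf_fun_def)
qed

lemma C_infD: "C_inf m U n f \<Longrightarrow> f ` U \<subseteq> Rn n" "C_inf m U n f \<Longrightarrow> j < n \<Longrightarrow> C_inf_fun m U (\<lambda>x. f x j)"
  by (auto simp: C_inf_def)

lemma C_inf_continuous:
  assumes "openin (Euclidean_space m) U" "C_inf m U n f"
  shows "continuous_on U f"
proof (rule continuous_on_vec)
  show "continuous_on U (\<lambda>x. f x j)" if "j < n" for j
    by (rule C_inf_fun_continuous[OF assms(1) C_infD(2)[OF assms(2) that]])
qed (rule C_infD(1)[OF assms(2)])

lemma C_inf_cong:
  assumes "openin (Euclidean_space m) U" "\<And>y. y \<in> U \<Longrightarrow> f y = g y"
  shows "C_inf m U n f \<longleftrightarrow> C_inf m U n g"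
proof -
  have "C_inf_fun m U (\<lambda>x. f x j) \<longleftrightarrow> C_inf_fun m U (\<lambda>x. g x j)" for j
    by (rule C_inf_fun_cong) (use assms in auto)
  moreover have "f ` U = g ` U"
    using assms(2) by force
  ultimately show ?thesis
    by (simp add: C_inf_def)
qed

lemma C_inf_subset: "C_inf m U n f \<Longrightarrow> W \<subseteq> U \<Longrightarrow> U \<subseteq> Rn m \<Longrightarrow> C_inf m W n f"
  unfolding C_inf_def using C_inf_fun_subset by blast

lemma C_inf_local:
  assumes "openin (Euclidean_space m) U"
    and "\<And>x. x \<in> U \<Longrightarrow> \<exists>W. x \<in> W \<and> openin (Euclidean_space m) W \<and> C_inf m W n f"
  shows "C_inf m U n f"
  unfolding C_inf_def
proof (intro conjI allI impI)
  show "f ` U \<subseteq> Rn n"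
    using assms(2) C_infD(1) by blast
  show "C_inf_fun m U (\<lambda>x. f x j)" if j: "j < n" for j
  proof (rule C_inf_fun_local[OF assms(1)])
    fix x assume "x \<in> U"
    then show "\<exists>W. x \<in> W \<and> openin (Euclidean_space m) W \<and> C_inf_fun m W (\<lambda>x. f x j)"
      using assms(2) C_infD(2)[OF _ j] by meson
  qed
qed

lemma C_inf_id: "openin (Euclidean_space m) U \<Longrightarrow> C_inf m U m (\<lambda>x. x)"
  by (auto simp: C_inf_def C_inf_fun_coordinate dest: openin_Euclidean_subset)

lemma C_inf_fun_compose:
  assumes "openin (Euclidean_space m) W" "openin (Euclidean_space n) U" "g ` W \<subseteq> U"
    and "C_inf_fun n U f" "C_inf m W n g"
  shows "C_inf_fun m W (\<lambda>x. f (g x))"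
  using assms C_k_compose[OF assms(1-3)] unfolding C_inf_def C_inf_fun_def by simp

lemma C_inf_compose:
  assumes "openin (Euclidean_space m) W" "openin (Euclidean_space n) U" "g ` W \<subseteq> U"
    and "C_inf n U k f" "C_inf m W n g"
  shows "C_inf m W k (\<lambda>x. f (g x))"
  using assms C_inf_fun_compose[OF assms(1-3)] unfolding C_inf_def by blast

lemma openin_C_inf_preimage:
  assumes "openin (Euclidean_space m) U" "C_inf m U n f" "openin (Euclidean_space n) W"
  shows "openin (Euclidean_space m) {x \<in> U. f x \<in> W}"
  using openin_Euclidean_preimage[OF assms(1) C_inf_continuous[OF assms(1,2)] C_infD(1)[OF assms(2)] assms(3)] .


subsection \<open>The Jacobian\<close>

lemma jacobian_cong:
  assumes "openin (Euclidean_space m) U" "r \<in> U" "\<And>y. y \<in> U \<Longrightarrow> f y = g y"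
  shows "jacobian m f r v = jacobian m g r v"
proof -
  have "partial_deriv i (\<lambda>x. f x j) r = partial_deriv i (\<lambda>x. g x j) r" if "i < m" for i j
    by (rule partial_deriv_cong[OF assms(1,2) that]) (simp add: assms(3))
  then show ?thesis
    by (simp add: jacobian_def)
qed

text \<open>The formula for \<open>jacobian\<close> runs over all indices. From \<open>n\<close> on
  the coordinates of f vanish throughout the open set \<open>U\<close>, hence so do their partial
  derivatives.\<close>

lemma jacobian_in_Rn:
  assumes "openin (Euclidean_space m) U" "r \<in> U" "f ` U \<subseteq> Rn n"
  shows "jacobian m f r v \<in> Rn n"
proof -
  have "partial_deriv i (\<lambda>x. f x j) r = 0" if "i < m" "j \<ge> n" for i j
  proof -
    have "partial_deriv i (\<lambda>x. f x j) r = partial_deriv i (\<lambda>x. 0) r"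
      by (rule partial_deriv_cong[OF assms(1,2) that(1)]) (use assms(3) that(2) in \<open>auto simp: Rn_iff\<close>)
    then show ?thesis
      by (simp add: partial_deriv_def)
  qed
  then show ?thesis
    by (simp add: jacobian_def Rn_iff)
qed

lemma jacobian_compose:
  assumes W: "openin (Euclidean_space m) W" and U: "openin (Euclidean_space n) U" and gW: "g ` W \<subseteq> U"
    and f: "C_inf n U k f" and g: "C_inf m W n g" and r: "r \<in> W"
  shows "jacobian m (\<lambda>x. f (g x)) r v = jacobian n f (g r) (jacobian m g r v)"
proof
  fix j
  show "jacobian m (\<lambda>x. f (g x)) r v j = jacobian n f (g r) (jacobian m g r v) j"
  proof (cases "j < k")
    case True
    have C1: "C_k 1 n U (\<lambda>x. f x j)" "\<And>l. l < n \<Longrightarrow> C_k 1 m W (\<lambda>x. g x l)"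
      using f g True unfolding C_inf_def C_inf_fun_def by blast+
    have "jacobian m (\<lambda>x. f (g x)) r v j =
        (\<Sum>i<m. (\<Sum>l<n. partial_deriv l (\<lambda>x. f x j) (g r) * partial_deriv i (\<lambda>x. g x l) r) * v i)"
      unfolding jacobian_def using partial_deriv_compose[OF W U C1 gW r] by simp
    also have "\<dots> = (\<Sum>l<n. \<Sum>i<m. partial_deriv l (\<lambda>x. f x j) (g r) * partial_deriv i (\<lambda>x. g x l) r * v i)"
      by (simp add: sum_distrib_right) (rule sum.swap)
    also have "\<dots> = jacobian n f (g r) (jacobian m g r v) j"
      by (simp add: jacobian_def sum_distrib_left mult.assoc)
    finally show ?thesis .
  next
    \<comment> \<open>Smoothness is demanded of the coordinates below \<open>k\<close> only; beyond
      them both sides vanish, as they lie in \<open>Rn k\<close>.\<close>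
    case False
    have "jacobian m (\<lambda>x. f (g x)) r v \<in> Rn k"
      by (rule jacobian_in_Rn[OF W r]) (use C_infD(1)[OF f] gW in auto)
    moreover have "jacobian n f (g r) (jacobian m g r v) \<in> Rn k"
      by (rule jacobian_in_Rn[OF U]) (use C_infD(1)[OF f] gW r in auto)
    ultimately show ?thesis
      using False by (simp add: Rn_iff)
  qed
qed

lemma jacobian_id:
  assumes "v \<in> Rn m"
  shows "jacobian m (\<lambda>x. x) r v = v"
proof
  fix j
  have "partial_deriv i (\<lambda>x. x j) r = (if i = j then 1 else 0)" for i
    unfolding partial_deriv_def by (rule DERIV_imp_deriv) (auto simp: fun_upd_def)
  then have "jacobian m (\<lambda>x. x) r v j = (\<Sum>i<m. if i = j then v i else 0)"
    unfolding jacobian_def by (intro sum.cong) auto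
  then show "jacobian m (\<lambda>x. x) r v j = v j"
    using assms by (auto simp: Rn_iff)
qed

lemma jacobian_linear:
  "jacobian m f r (\<lambda>i. a * u i + b * v i) = (\<lambda>j. a * jacobian m f r u j + b * jacobian m f r v j)"
  by (simp add: jacobian_def distrib_left sum.distrib sum_distrib_left ac_simps)

lemma jacobian_zero: "jacobian m f r (\<lambda>_. 0) = (\<lambda>_. 0)"
  by (simp add: jacobian_def)

lemma C_inf_jacobian:
  assumes U: "openin (Euclidean_space m) U" and f: "C_inf m U n f"
  shows "C_inf m U n (\<lambda>r. jacobian m f r v)"
  unfolding C_inf_def
proof (intro conjI allI impI)
  show "(\<lambda>r. jacobian m f r v) ` U \<subseteq> Rn n"
    using jacobian_in_Rn[OF U _ C_infD(1)[OF f]] by blast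
  show "C_inf_fun m U (\<lambda>r. jacobian m f r v j)" if "j < n" for j
    unfolding jacobian_def
    by (intro C_inf_fun_sum C_inf_fun_mult C_inf_fun_partial_deriv C_inf_fun_const U C_infD(2)[OF f that]) auto
qed


subsection \<open>Tensors\<close>

text \<open>Induction over the truncations of \<open>v\<close> to its first k coordinates, each step
  splitting off one basis vector by the two-term linearity. The zero vector is the combination with
  both coefficients 0.\<close>

lemma linear_on_Rn_expand:
  assumes L: "\<And>u v a b. u \<in> Rn m \<Longrightarrow> v \<in> Rn m \<Longrightarrow> L (\<lambda>i. a * u i + b * v i) = a * L u + b * (L v :: real)"
    and v: "v \<in> Rn m"
  shows "L v = (\<Sum>a<m. v a * L ((\<lambda>_. 0)(a := 1)))"
proof -
  have v_eq: "v = (\<lambda>i. if i < m then v i else 0)"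
    using v by (auto simp: Rn_iff)
  have "L (\<lambda>i. if i < k then v i else 0) = (\<Sum>a<k. v a * L ((\<lambda>_. 0)(a := 1)))" if "k \<le> m" for k
    using that
  proof (induction k)
    case 0
    show ?case
      using L[of "\<lambda>_. 0" "\<lambda>_. 0" 0 0] by (simp add: Rn_iff)
  next
    case (Suc k)
    have "(\<lambda>i. if i < Suc k then v i else 0) = (\<lambda>i. 1 * (if i < k then v i else 0) + v k * ((\<lambda>_. 0)(k := 1)) i)"
      by (auto simp: less_Suc_eq)
    moreover have "L (\<lambda>i. 1 * (if i < k then v i else 0) + v k * ((\<lambda>_. 0)(k := 1)) i) =
        1 * L (\<lambda>i. if i < k then v i else 0) + v k * L ((\<lambda>_. 0)(k := 1))"
      by (rule L) (use Suc.prems in \<open>auto simp: Rn_iff\<close>)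
    ultimately show ?case
      using Suc by (simp del: fun_upd_apply)
  qed
  from this[OF order_refl] show ?thesis
    unfolding v_eq[symmetric] .
qed

lemma covariant_2_tensor_expand:
  assumes B: "covariant_2_tensor m U B" and r: "r \<in> U" and v: "v \<in> Rn m" and w: "w \<in> Rn m"
  shows "B r v w = (\<Sum>a<m. \<Sum>b<m. v a * w b * B r ((\<lambda>_. 0)(a := 1)) ((\<lambda>_. 0)(b := 1)))"
proof -
  have e: "(\<lambda>_. 0)(a := 1) \<in> Rn m" if "a < m" for a
    using that by (auto simp: Rn_iff)
  have "B r v w = (\<Sum>a<m. v a * B r ((\<lambda>_. 0)(a := 1)) w)"
    by (rule linear_on_Rn_expand[of m "\<lambda>v. B r v w"]) (use B r v w in \<open>auto simp: covariant_2_tensor_def\<close>)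
  also have "\<dots> = (\<Sum>a<m. v a * (\<Sum>b<m. w b * B r ((\<lambda>_. 0)(a := 1)) ((\<lambda>_. 0)(b := 1))))"
  proof (intro sum.cong refl arg_cong2[where f = "(*)"])
    fix a assume "a \<in> {..<m}"
    then show "B r ((\<lambda>_. 0)(a := 1)) w = (\<Sum>b<m. w b * B r ((\<lambda>_. 0)(a := 1)) ((\<lambda>_. 0)(b := 1)))"
      by (intro linear_on_Rn_expand[of m "\<lambda>w. B r ((\<lambda>_. 0)(a := 1)) w"])
        (use B r w e in \<open>auto simp: covariant_2_tensor_def\<close>)
  qed
  finally show ?thesis
    by (simp add: sum_distrib_left mult.assoc)
qed

text \<open>The definition asks for smooth coefficients on constant basis fields. Expanding in these
  coefficients gives smoothness when the base point and both vectors vary, as they do in pullbacks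
  and in plots of T_2 X.\<close>

lemma covariant_2_tensor_smooth:
  assumes U: "openin (Euclidean_space n) U" and B: "covariant_2_tensor n U B"
    and W: "openin (Euclidean_space m) W"
    and f: "C_inf m W n f" "f ` W \<subseteq> U" and v: "C_inf m W n v" and w: "C_inf m W n w"
  shows "C_inf_fun m W (\<lambda>x. B (f x) (v x) (w x))"
proof -
  have "C_inf_fun m W (\<lambda>x. \<Sum>a<n. \<Sum>b<n. v x a * w x b * B (f x) ((\<lambda>_. 0)(a := 1)) ((\<lambda>_. 0)(b := 1)))"
  proof (intro C_inf_fun_sum C_inf_fun_mult W)
    fix a b assume "a \<in> {..<n}" "b \<in> {..<n}"
    then have ab: "a < n" "b < n"
      by auto
    show "C_inf_fun m W (\<lambda>x. v x a)" "C_inf_fun m W (\<lambda>x. w x b)"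
      using C_infD(2)[OF v ab(1)] C_infD(2)[OF w ab(2)] .
    have "C_inf_fun n U (\<lambda>r. B r ((\<lambda>_. 0)(a := 1)) ((\<lambda>_. 0)(b := 1)))"
      using B ab by (simp add: covariant_2_tensor_def)
    then show "C_inf_fun m W (\<lambda>x. B (f x) ((\<lambda>_. 0)(a := 1)) ((\<lambda>_. 0)(b := 1)))"
      by (rule C_inf_fun_compose[OF W U f(2) _ f(1)])
  qed
  moreover have "B (f x) (v x) (w x) = (\<Sum>a<n. \<Sum>b<n. v x a * w x b * B (f x) ((\<lambda>_. 0)(a := 1)) ((\<lambda>_. 0)(b := 1)))"
    if "x \<in> W" for x
    by (rule covariant_2_tensor_expand[OF B]) (use that f(2) C_infD(1)[OF v] C_infD(1)[OF w] in auto)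
  ultimately show ?thesis
    using C_inf_fun_cong[OF W] by (metis (no_types, lifting))
qed

lemma covariant_2_tensor_pullback:
  assumes U: "openin (Euclidean_space n) U" and B: "covariant_2_tensor n U B"
    and W: "openin (Euclidean_space m) W" and f: "C_inf m W n f" "f ` W \<subseteq> U"
  shows "covariant_2_tensor m W (\<lambda>r v w. B (f r) (jacobian m f r v) (jacobian m f r w))"
  unfolding covariant_2_tensor_def
proof (intro conjI ballI allI impI)
  fix r u v w :: vec and a b :: real
  assume r: "r \<in> W"
  have mem: "f r \<in> U" "jacobian m f r v \<in> Rn n" for v
    using f(2) jacobian_in_Rn[OF W r C_infD(1)[OF f(1)]] r by auto
  show "B (f r) (jacobian m f r (\<lambda>i. a * u i + b * v i)) (jacobian m f r w) =
      a * B (f r) (jacobian m f r u) (jacobian m f r w) + b * B (f r) (jacobian m f r v) (jacobian m f r w)"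
    "B (f r) (jacobian m f r w) (jacobian m f r (\<lambda>i. a * u i + b * v i)) =
      a * B (f r) (jacobian m f r w) (jacobian m f r u) + b * B (f r) (jacobian m f r w) (jacobian m f r v)"
    using B mem by (simp_all add: jacobian_linear covariant_2_tensor_def)
next
  fix i j
  show "C_inf_fun m W (\<lambda>r. B (f r) (jacobian m f r ((\<lambda>_. 0)(i := 1))) (jacobian m f r ((\<lambda>_. 0)(j := 1))))"
    by (rule covariant_2_tensor_smooth[OF U B W f C_inf_jacobian[OF W f(1)] C_inf_jacobian[OF W f(1)]])
qed

lemma covariant_2_tensor_local:
  assumes U: "openin (Euclidean_space m) U"
    and "\<And>r. r \<in> U \<Longrightarrow> \<exists>W. r \<in> W \<and> openin (Euclidean_space m) W \<and> covariant_2_tensor m W B"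
  shows "covariant_2_tensor m U B"
  unfolding covariant_2_tensor_def
proof (intro conjI ballI allI impI)
  fix r u v w :: vec and a b :: real
  assume "r \<in> U" and uvw: "u \<in> Rn m" "v \<in> Rn m" "w \<in> Rn m"
  then obtain W where "r \<in> W" "covariant_2_tensor m W B"
    using assms(2) by blast
  then show "B r (\<lambda>i. a * u i + b * v i) w = a * B r u w + b * B r v w"
    "B r w (\<lambda>i. a * u i + b * v i) = a * B r w u + b * B r w v"
    using uvw unfolding covariant_2_tensor_def by blast+
next
  fix i j assume "i < m" "j < m"
  then show "C_inf_fun m U (\<lambda>r. B r ((\<lambda>_. 0)(i := 1)) ((\<lambda>_. 0)(j := 1)))"
    using assms(2) unfolding covariant_2_tensor_def by (intro C_inf_fun_local[OF U]) meson
qed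

lemma covariant_2_tensor_cong:
  assumes U: "openin (Euclidean_space m) U" and B: "covariant_2_tensor m U B"
    and eq: "\<And>r v w. r \<in> U \<Longrightarrow> v \<in> Rn m \<Longrightarrow> w \<in> Rn m \<Longrightarrow> B r v w = B' r v w"
  shows "covariant_2_tensor m U B'"
  unfolding covariant_2_tensor_def
proof (intro conjI ballI allI impI)
  fix r u v w :: vec and a b :: real
  assume r: "r \<in> U" and uvw: "u \<in> Rn m" "v \<in> Rn m" "w \<in> Rn m"
  have c: "(\<lambda>i. a * u i + b * v i) \<in> Rn m"
    using uvw by (simp add: Rn_iff)
  show "B' r (\<lambda>i. a * u i + b * v i) w = a * B' r u w + b * B' r v w"
    "B' r w (\<lambda>i. a * u i + b * v i) = a * B' r w u + b * B' r w v"
    using B r uvw c unfolding covariant_2_tensor_def by (simp_all flip: eq)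
next
  fix i j assume ij: "i < m" "j < m"
  have e: "(\<lambda>_. 0)(a := 1) \<in> Rn m" if "a < m" for a
    using that by (auto simp: Rn_iff)
  have "C_inf_fun m U (\<lambda>r. B r ((\<lambda>_. 0)(i := 1)) ((\<lambda>_. 0)(j := 1)))"
    using B ij by (simp add: covariant_2_tensor_def)
  then show "C_inf_fun m U (\<lambda>r. B' r ((\<lambda>_. 0)(i := 1)) ((\<lambda>_. 0)(j := 1)))"
    using C_inf_fun_cong[OF U, of "\<lambda>r. B r ((\<lambda>_. 0)(i := 1)) ((\<lambda>_. 0)(j := 1))"
        "\<lambda>r. B' r ((\<lambda>_. 0)(i := 1)) ((\<lambda>_. 0)(j := 1))"] eq e ij by blast
qed


section \<open>Density arguments for finite families\<close>

lemma closedin_coincidence_set: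
  fixes a b :: "'a::topological_space \<Rightarrow> 'b::metric_space"
  assumes "continuous_on W a" "continuous_on W b"
  shows "closedin (top_of_set W) {x \<in> W. a x = b x}"
  using closedin_continuous_maps_eq[of euclidean "top_of_set W" a b] assms
  by (simp add: Hausdorff_space_euclidean)

lemma openin_Diff_closedin:
  assumes W: "openin (Euclidean_space m) W" and "openin (Euclidean_space m) Q" "Q \<subseteq> W"
    and S: "closedin (top_of_set W) S"
  shows "openin (Euclidean_space m) (Q - S)"
proof -
  have "openin (Euclidean_space m) (W - S)"
    using S openin_Euclidean_trans[OF W] by (simp add: closedin_def)
  moreover have "Q - S = Q \<inter> (W - S)"
    using assms(3) by blast
  ultimately show ?thesis
    using assms(2) by auto
qed

text \<open>A Baire argument for finitely many closed sets: either one candidate agrees with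
  \<open>a\<close> on all of \<open>O'\<close>, or the points where it fails form a nonempty open
  set on which the remaining candidates suffice.\<close>

lemma finite_cover_open_subset:
  assumes "finite G" and W: "openin (Euclidean_space m) W" and "O' \<noteq> {}"
    and "openin (Euclidean_space m) O'" "O' \<subseteq> W"
    and a: "continuous_on W a" and b: "\<And>\<gamma>. \<gamma> \<in> G \<Longrightarrow> continuous_on W (b \<gamma>)"
    and "\<And>x. x \<in> O' \<Longrightarrow> \<exists>\<gamma>\<in>G. a x = (b \<gamma> x :: 'b::metric_space)"
  shows "\<exists>\<gamma>\<in>G. \<exists>Q. Q \<noteq> {} \<and> openin (Euclidean_space m) Q \<and> Q \<subseteq> O' \<and> (\<forall>x\<in>Q. a x = b \<gamma> x)"
  using assms(1,3,4,5,8) b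
proof (induction G arbitrary: O')
  case (insert \<gamma> G)
  show ?case
  proof (cases "\<forall>x\<in>O'. a x = b \<gamma> x")
    case False
    define Q where "Q = O' - {x \<in> W. a x = b \<gamma> x}"
    have "closedin (top_of_set W) {x \<in> W. a x = b \<gamma> x}"
      by (rule closedin_coincidence_set) (use a insert.prems in auto)
    then have Q: "openin (Euclidean_space m) Q"
      unfolding Q_def by (rule openin_Diff_closedin[OF W insert.prems(2,3)])
    have "\<exists>\<gamma>\<in>G. \<exists>Q'. Q' \<noteq> {} \<and> openin (Euclidean_space m) Q' \<and> Q' \<subseteq> Q \<and> (\<forall>x\<in>Q'. a x = b \<gamma> x)"
    proof (rule insert.IH[OF _ Q])
      show "Q \<noteq> {}"
        using False insert.prems(3) by (auto simp: Q_def)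
      show "\<exists>\<gamma>\<in>G. a x = b \<gamma> x" if "x \<in> Q" for x
        using insert.prems(3) insert.prems(4)[of x] that by (auto simp: Q_def)
    qed (use insert.prems in \<open>auto simp: Q_def\<close>)
    then show ?thesis
      unfolding Q_def by blast
  qed (use insert in blast)
qed auto

text \<open>The part of \<open>W\<close> outside \<open>S\<close> is open, and a nonempty one would
  have to meet \<open>S\<close>. In this form an identity between continuous functions spreads from
  a dense set to all of \<open>W\<close>.\<close>

lemma dense_closed_eq:
  assumes W: "openin (Euclidean_space m) W" and S: "closedin (top_of_set W) S"
    and "\<And>Q. Q \<noteq> {} \<Longrightarrow> openin (Euclidean_space m) Q \<Longrightarrow> Q \<subseteq> W \<Longrightarrow> Q \<inter> S \<noteq> {}"
  shows "W \<subseteq> S"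
proof -
  have "openin (Euclidean_space m) (W - S)"
    by (rule openin_Diff_closedin[OF W W _ S]) simp
  then show ?thesis
    using assms(3)[of "W - S"] by blast
qed

section \<open>Plots and charts\<close>

text \<open>Plots, charts and transitions are partial maps, whereas the calculus treats a total
  function together with an open set; this passes from the second form to the first.\<close>

definition pmap :: "'a set \<Rightarrow> ('a \<Rightarrow> 'b) \<Rightarrow> 'a \<rightharpoonup> 'b" where
  "pmap U f = (\<lambda>x. if x \<in> U then Some (f x) else None)"

lemma dom_pmap [simp]: "dom (pmap U f) = U"
  by (auto simp: pmap_def dom_def)

lemma ran_pmap [simp]: "ran (pmap U f) = f ` U"
  by (auto simp: pmap_def ran_def)

lemma pmap_apply: "x \<in> U \<Longrightarrow> pmap U f x = Some (f x)"
  by (simp add: pmap_def)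

lemma map_option_pmap: "map_option h \<circ> pmap U f = pmap U (\<lambda>x. h (f x))"
  by (auto simp: pmap_def)

lemma dom_map_option_comp [simp]: "dom (map_option h \<circ> p) = dom p"
  by (auto simp: dom_def)

lemma subspace_UNIV: "subspace X UNIV = X"
  by (cases X) (simp add: subspace_def)

lemma points_subspace [simp]: "points (subspace X A) = points X \<inter> A"
  by (simp add: subspace_def)

lemma plots_subspace: "p \<in> plots (subspace X A) m \<longleftrightarrow> p \<in> plots X m \<and> ran p \<subseteq> A"
  by (simp add: subspace_def)

lemma points_euclid [simp]: "points (euclid n) = Rn n"
  by (simp add: euclid_def)

lemma plots_euclid:
  "p \<in> plots (euclid n) m \<longleftrightarrow> openin (Euclidean_space m) (dom p) \<and> C_inf m (dom p) n (the \<circ> p)"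
  by (simp add: euclid_def)

lemma pmap_plot_euclid:
  assumes "openin (Euclidean_space m) U"
  shows "pmap U f \<in> plots (euclid n) m \<longleftrightarrow> C_inf m U n f"
  using assms C_inf_cong[OF assms, of "the \<circ> pmap U f" f] by (simp add: plots_euclid pmap_apply)

lemma diffeological_spaceD:
  assumes "diffeological_space X"
  shows "p \<in> plots X m \<Longrightarrow> openin (Euclidean_space m) (dom p)"
    and "p \<in> plots X m \<Longrightarrow> ran p \<subseteq> points X"
    and "p \<in> plots X k \<Longrightarrow> openin (Euclidean_space m) U \<Longrightarrow> C_inf m U k f \<Longrightarrow> f ` U \<subseteq> dom p \<Longrightarrow>
           (p \<circ> f) |` U \<in> plots X m"
    and "openin (Euclidean_space m) (dom q) \<Longrightarrow>
         (\<And>u. u \<in> dom q \<Longrightarrow> \<exists>W. openin (Euclidean_space m) W \<and> u \<in> W \<and> W \<subseteq> dom q \<and> q |` W \<in> plots X m)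
         \<Longrightarrow> q \<in> plots X m"
proof -
  note X = assms[unfolded diffeological_space_def]
  show "p \<in> plots X m \<Longrightarrow> openin (Euclidean_space m) (dom p)" "p \<in> plots X m \<Longrightarrow> ran p \<subseteq> points X"
    using X[THEN conjunct1] by auto
  show "p \<in> plots X k \<Longrightarrow> openin (Euclidean_space m) U \<Longrightarrow> C_inf m U k f \<Longrightarrow> f ` U \<subseteq> dom p \<Longrightarrow>
      (p \<circ> f) |` U \<in> plots X m"
    using X[THEN conjunct2, THEN conjunct2, THEN conjunct1] by auto
  show "openin (Euclidean_space m) (dom q) \<Longrightarrow>
      (\<And>u. u \<in> dom q \<Longrightarrow> \<exists>W. openin (Euclidean_space m) W \<and> u \<in> W \<and> W \<subseteq> dom q \<and> q |` W \<in> plots X m)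
      \<Longrightarrow> q \<in> plots X m"
    by (rule X[THEN conjunct2, THEN conjunct2, THEN conjunct2, rule_format]) blast
qed

lemma plot_restrict:
  assumes "diffeological_space X" "p \<in> plots X m" "openin (Euclidean_space m) U" "U \<subseteq> dom p"
  shows "p |` U \<in> plots X m"
  using diffeological_spaceD(3)[OF assms(1-3) C_inf_id[OF assms(3)]] assms(4) by (simp add: comp_def)

lemma plot_preimage_open:
  "openin (D_topology X) A \<Longrightarrow> p \<in> plots X m \<Longrightarrow> openin (Euclidean_space m) {u \<in> dom p. the (p u) \<in> A}"
  by (simp add: openin_D_topology)

lemma smooth_mapD: "smooth_map X Y h \<Longrightarrow> p \<in> plots X m \<Longrightarrow> map_option h \<circ> p \<in> plots Y m"
  by (simp add: smooth_map_def)

section \<open>Subspaces and Euclidean spaces as diffeological spaces\<close>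

lemma diffeological_space_subspace:
  assumes X: "diffeological_space X"
  shows "diffeological_space (subspace X A)"
proof -
  have ran: "ran p \<subseteq> A" if loc: "\<And>u. u \<in> dom p \<Longrightarrow> \<exists>W. u \<in> W \<and> ran (p |` W) \<subseteq> A" for p :: "vec \<rightharpoonup> 'a"
  proof
    fix a assume "a \<in> ran p"
    then obtain u where u: "p u = Some a"
      by (auto simp: ran_def)
    then obtain W where "u \<in> W" "ran (p |` W) \<subseteq> A"
      using loc[of u] by auto
    then show "a \<in> A"
      using u by (force simp: ran_def restrict_map_def)
  qed
  show ?thesis
    unfolding diffeological_space_def plots_subspace points_subspace
  proof (intro conjI allI impI ballI)
    fix m p
    show "openin (Euclidean_space m) (dom p)" "ran p \<subseteq> points X \<inter> A"
      if "p \<in> plots (subspace X A) m"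
      using diffeological_spaceD(1,2)[OF X, of p m] that by (simp_all add: plots_subspace)
  next
    fix m U x assume "openin (Euclidean_space m) U \<and> x \<in> points X \<inter> A"
    then show "(\<lambda>_. Some x) |` U \<in> plots X m" "ran ((\<lambda>_. Some x) |` U) \<subseteq> A"
      using X unfolding diffeological_space_def by (auto simp: ran_def restrict_map_def)
  next
    fix m U k f p
    assume p: "p \<in> plots (subspace X A) k"
      and f: "openin (Euclidean_space m) U \<and> C_inf m U k f \<and> f ` U \<subseteq> dom p"
    then show "(p \<circ> f) |` U \<in> plots X m"
      using diffeological_spaceD(3)[OF X, where p = p and k = k] by (simp add: plots_subspace)
    show "ran ((p \<circ> f) |` U) \<subseteq> A"
      using p by (auto simp: plots_subspace ran_def restrict_map_def)
  next
    fix m and p :: "vec \<rightharpoonup> 'a"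
    assume p: "openin (Euclidean_space m) (dom p) \<and>
        (\<forall>u \<in> dom p. \<exists>W. openin (Euclidean_space m) W \<and> u \<in> W \<and> W \<subseteq> dom p \<and>
           p |` W \<in> plots X m \<and> ran (p |` W) \<subseteq> A)"
    show "p \<in> plots X m"
      by (rule diffeological_spaceD(4)[OF X]) (use p in blast)+
    show "ran p \<subseteq> A"
      by (rule ran) (use p in blast)
  qed
qed

lemma diffeological_space_euclid: "diffeological_space (euclid n)"
  unfolding diffeological_space_def plots_euclid points_euclid
proof (intro conjI allI impI ballI)
  fix m p assume p: "p \<in> plots (euclid n) m"
  then show "openin (Euclidean_space m) (dom p)"
    by (simp add: plots_euclid)
  show "ran p \<subseteq> Rn n"
    using p C_infD(1) by (fastforce simp: plots_euclid ran_def dom_def)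
next
  fix m U and x :: vec assume Ux: "openin (Euclidean_space m) U \<and> x \<in> Rn n"
  then have U: "openin (Euclidean_space m) U" and x: "x \<in> Rn n"
    by auto
  have eq: "(\<lambda>_. Some x) |` U = pmap U (\<lambda>_. x)"
    by (auto simp: pmap_def restrict_map_def)
  have "C_inf m U n (\<lambda>_. x)"
    using C_inf_fun_const[OF U] x by (auto simp: C_inf_def)
  then have "pmap U (\<lambda>_. x) \<in> plots (euclid n) m"
    using pmap_plot_euclid[OF U] by blast
  then show "openin (Euclidean_space m) (dom ((\<lambda>_. Some x) |` U))"
    "C_inf m (dom ((\<lambda>_. Some x) |` U)) n (the \<circ> (\<lambda>_. Some x) |` U)"
    unfolding eq plots_euclid by blast+
next
  fix m U k f and p :: "vec \<rightharpoonup> vec"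
  assume p: "p \<in> plots (euclid n) k" and f: "openin (Euclidean_space m) U \<and> C_inf m U k f \<and> f ` U \<subseteq> dom p"
  then have U: "openin (Euclidean_space m) U"
    by auto
  have eq: "(p \<circ> f) |` U = pmap U (\<lambda>x. the (p (f x)))"
    using f by (force simp: pmap_def restrict_map_def dom_def)
  have "C_inf m U n (\<lambda>x. (the \<circ> p) (f x))"
    by (rule C_inf_compose[where f = "the \<circ> p" and g = f, OF U, of k "dom p"]) (use p f in \<open>auto simp: plots_euclid\<close>)
  then have "pmap U (\<lambda>x. the (p (f x))) \<in> plots (euclid n) m"
    using pmap_plot_euclid[OF U] by simp
  then show "openin (Euclidean_space m) (dom ((p \<circ> f) |` U))"
    "C_inf m (dom ((p \<circ> f) |` U)) n (the \<circ> (p \<circ> f) |` U)"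
    unfolding eq plots_euclid by blast+
next
  fix m and p :: "vec \<rightharpoonup> vec"
  assume p: "openin (Euclidean_space m) (dom p) \<and>
      (\<forall>u \<in> dom p. \<exists>W. openin (Euclidean_space m) W \<and> u \<in> W \<and> W \<subseteq> dom p \<and>
         openin (Euclidean_space m) (dom (p |` W)) \<and> C_inf m (dom (p |` W)) n (the \<circ> p |` W))"
  then show o: "openin (Euclidean_space m) (dom p)"
    by blast
  show "C_inf m (dom p) n (the \<circ> p)"
  proof (rule C_inf_local[OF o])
    fix u assume "u \<in> dom p"
    then obtain W where W: "openin (Euclidean_space m) W" "u \<in> W" "W \<subseteq> dom p" "C_inf m (dom (p |` W)) n (the \<circ> p |` W)"
      using p by blast
    have "C_inf m W n (the \<circ> p |` W)"
      using W(3,4) by (simp add: Int_absorb1)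
    then have "C_inf m W n (the \<circ> p)"
      using C_inf_cong[OF W(1), of "the \<circ> p |` W" "the \<circ> p"] by simp
    then show "\<exists>W. u \<in> W \<and> openin (Euclidean_space m) W \<and> C_inf m W n (the \<circ> p)"
      using W by blast
  qed
qed

section \<open>The D-topology and the transitions of open subsets of Euclidean spaces\<close>

lemma openin_D_topology_subspace_euclid:
  assumes "openin (Euclidean_space n) A" "A \<subseteq> V"
  shows "openin (D_topology (subspace (euclid n) V)) A"
  unfolding openin_D_topology points_subspace points_euclid
proof (intro conjI allI ballI)
  show "A \<subseteq> Rn n \<inter> V"
    using assms openin_Euclidean_subset by blast
next
  fix m p assume "p \<in> plots (subspace (euclid n) V) m"
  then show "openin (Euclidean_space m) {u \<in> dom p. the (p u) \<in> A}"
    using openin_C_inf_preimage[of m "dom p" n "the \<circ> p" A] assms(1)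
    by (simp add: plots_subspace plots_euclid)
qed

text \<open>The inclusion of the open set \<open>V\<close> is a plot, so D-open sets are open;
  conversely, plots are continuous.\<close>

lemma D_topology_subspace_euclid:
  assumes V: "openin (Euclidean_space n) V"
  shows "D_topology (subspace (euclid n) V) = subtopology (Euclidean_space n) V"
proof (rule topology_eq[THEN iffD2], intro allI iffI)
  fix A
  assume A: "openin (D_topology (subspace (euclid n) V)) A"
  have "pmap V (\<lambda>x. x) \<in> plots (subspace (euclid n) V) n"
    using pmap_plot_euclid[OF V] C_inf_id[OF V] by (simp add: plots_subspace)
  from plot_preimage_open[OF A this] have "openin (Euclidean_space n) {u \<in> V. u \<in> A}"
    by (simp add: pmap_apply cong: conj_cong)
  moreover have "{u \<in> V. u \<in> A} = A"
    using A by (auto simp: openin_D_topology)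
  ultimately show "openin (subtopology (Euclidean_space n) V) A"
    using A by (auto simp: openin_open_subtopology[OF V] openin_D_topology)
next
  fix A assume "openin (subtopology (Euclidean_space n) V) A"
  then show "openin (D_topology (subspace (euclid n) V)) A"
    by (simp add: openin_open_subtopology[OF V] openin_D_topology_subspace_euclid)
qed

lemma openin_D_topology_euclid: "openin (D_topology (euclid n)) A \<longleftrightarrow> openin (Euclidean_space n) A"
proof
  assume A: "openin (D_topology (euclid n)) A"
  have "pmap (Rn n) (\<lambda>x. x) \<in> plots (euclid n) n"
    by (simp add: pmap_plot_euclid C_inf_id)
  from plot_preimage_open[OF A this] have "openin (Euclidean_space n) {u \<in> Rn n. u \<in> A}"
    by (simp add: pmap_apply cong: conj_cong)
  moreover have "{u \<in> Rn n. u \<in> A} = A"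
    using A by (auto simp: openin_D_topology)
  ultimately show "openin (Euclidean_space n) A"
    by simp
next
  assume "openin (Euclidean_space n) A"
  then show "openin (D_topology (euclid n)) A"
    using openin_D_topology_subspace_euclid[of n A UNIV] by (simp add: subspace_UNIV)
qed

text \<open>The double subspaces are the shape in which \<open>transition\<close> asks for
  smoothness. The map \<open>g\<close> agrees with the smooth f on \<open>A\<close> only, since it
  will be \<open>the \<circ> pmap A f\<close> or an \<open>inv_into\<close>.\<close>

lemma smooth_map_subspace_euclid:
  assumes A: "openin (Euclidean_space n) A" and f: "C_inf n A n' f" and "\<And>x. x \<in> A \<Longrightarrow> g x = f x"
    and "f ` A \<subseteq> A'" "A' \<subseteq> V'"
  shows "smooth_map (subspace (subspace (euclid n) V) A) (subspace (subspace (euclid n') V') A') g"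
  unfolding smooth_map_def points_subspace points_euclid plots_subspace
proof (intro conjI allI ballI)
  show "g ` (Rn n \<inter> V \<inter> A) \<subseteq> Rn n' \<inter> V' \<inter> A'"
    using assms C_infD(1)[OF f] by fastforce
next
  fix m p assume "p \<in> plots (subspace (subspace (euclid n) V) A) m"
  then have p: "openin (Euclidean_space m) (dom p)" "C_inf m (dom p) n (the \<circ> p)" "ran p \<subseteq> A"
    by (simp_all add: plots_subspace plots_euclid)
  have pA: "the (p x) \<in> A" if "x \<in> dom p" for x
    using p(3) that by (auto simp: ran_def)
  have "C_inf m (dom p) n' (\<lambda>x. f ((the \<circ> p) x))"
    by (rule C_inf_compose[OF p(1) A _ f p(2)]) (use pA in auto)
  moreover have "map_option g \<circ> p = pmap (dom p) (\<lambda>x. f ((the \<circ> p) x))"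
    using p(3) assms(3) by (force simp: pmap_def ran_def dom_def map_option_case split: option.split)
  ultimately have "map_option g \<circ> p \<in> plots (euclid n') m"
    using pmap_plot_euclid[OF p(1)] by simp
  moreover have "ran (map_option g \<circ> p) \<subseteq> A'"
    using p(3) assms(3,4) by (force simp: ran_def)
  ultimately show "map_option g \<circ> p \<in> plots (euclid n') m" "ran (map_option g \<circ> p) \<subseteq> V'"
      "ran (map_option g \<circ> p) \<subseteq> A'"
    using assms(5) by auto
qed

text \<open>The inverse in \<open>diffeomorphism\<close> is an \<open>inv_into\<close>; injectivity
  identifies it on \<open>A'\<close> with the explicit inverse \<open>h\<close>, whose smoothness is
  known.\<close>

lemma transition_pmap:
  assumes A: "openin (Euclidean_space n) A" "A \<subseteq> V" and A': "openin (Euclidean_space n') A'" "A' \<subseteq> V'"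
    and f: "C_inf n A n' f" "f ` A \<subseteq> A'" and h: "C_inf n' A' n h" "h ` A' \<subseteq> A"
    and hf: "\<And>x. x \<in> A \<Longrightarrow> h (f x) = x" and fh: "\<And>y. y \<in> A' \<Longrightarrow> f (h y) = y"
  shows "transition (subspace (euclid n) V) (subspace (euclid n') V') (pmap A f)"
proof -
  have A'_eq: "f ` A = A'"
    using fh f(2) h(2) by force
  have inj: "inj_on f A"
    using inj_on_inverseI[of A h f] hf by blast
  have pts: "Rn n \<inter> V \<inter> A = A" "Rn n' \<inter> V' \<inter> A' = A'"
    using A A' openin_Euclidean_subset by blast+
  have val: "(the \<circ> pmap A f) x = f x" if "x \<in> A" for x
    using that by (simp add: pmap_apply)
  have inj': "inj_on (the \<circ> pmap A f) A"
    using inj val by (simp add: inj_on_def)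
  have inv: "inv_into A (the \<circ> pmap A f) y = h y" if "y \<in> A'" for y
  proof -
    have "h y \<in> A" "(the \<circ> pmap A f) (h y) = y"
      using that h(2) fh val by auto
    then show ?thesis
      using inv_into_f_eq[OF inj'] by blast
  qed
  have "bij_betw (the \<circ> pmap A f) A A'"
    unfolding bij_betw_def using inj' A'_eq val by (auto simp: image_def)
  moreover have "smooth_map (subspace (subspace (euclid n) V) A) (subspace (subspace (euclid n') V') A') (the \<circ> pmap A f)"
    by (rule smooth_map_subspace_euclid[OF A(1) f(1) val f(2) A'(2)])
  moreover have "smooth_map (subspace (subspace (euclid n') V') A') (subspace (subspace (euclid n) V) A) (inv_into A (the \<circ> pmap A f))"
    by (rule smooth_map_subspace_euclid[OF A'(1) h(1) inv h(2) A(2)])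
  ultimately show ?thesis
    using openin_D_topology_subspace_euclid[OF A] openin_D_topology_subspace_euclid[OF A']
    by (simp add: transition_def diffeomorphism_def A'_eq pts)
qed


subsection \<open>Orbit maps of finite groups\<close>

context
  fixes \<Gamma> :: "(vec \<Rightarrow> vec) set" and n :: nat
  assumes fin: "finite \<Gamma>" and sub: "subgroup \<Gamma> (Diff (euclid n))"
begin

lemma group_Bij: "\<gamma> \<in> \<Gamma> \<Longrightarrow> \<gamma> \<in> Bij (Rn n)"
  using subgroup.subset[OF sub] by (auto simp: Diff_def)

lemma group_maps: "\<gamma> \<in> \<Gamma> \<Longrightarrow> x \<in> Rn n \<Longrightarrow> \<gamma> x \<in> Rn n"
  using group_Bij Bij_imp_funcset by blast

lemma group_smooth:
  assumes "\<gamma> \<in> \<Gamma>"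
  shows "C_inf n (Rn n) n \<gamma>"
proof -
  have "diffeomorphism (euclid n) (euclid n) \<gamma>"
    using subgroup.subset[OF sub] assms by (auto simp: Diff_def)
  then have sm: "smooth_map (euclid n) (euclid n) \<gamma>"
    by (simp add: diffeomorphism_def)
  have "pmap (Rn n) (\<lambda>x. x) \<in> plots (euclid n) n"
    by (simp add: pmap_plot_euclid C_inf_id)
  from smooth_mapD[OF sm this] show ?thesis
    by (simp add: map_option_pmap pmap_plot_euclid)
qed

text \<open>Elements of \<open>Bij\<close> are extensional, so the unit of the group is the identity
  cut off outside \<open>Rn n\<close>.\<close>

lemma group_one: "(\<lambda>x\<in>Rn n. x) \<in> \<Gamma>"
  using subgroup.one_closed[OF sub] by (simp add: Diff_def BijGroup_def)

lemma group_compose: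
  assumes "\<gamma> \<in> \<Gamma>" "\<delta> \<in> \<Gamma>"
  shows "compose (Rn n) \<gamma> \<delta> \<in> \<Gamma>"
  using subgroup.m_closed[OF sub assms] assms group_Bij by (simp add: Diff_def BijGroup_def)

text \<open>Left multiplication by \<open>\<gamma>\<close> is injective on the finite set \<open>\<Gamma>\<close>, hence hits the identity.\<close>

lemma group_inverse:
  assumes \<gamma>: "\<gamma> \<in> \<Gamma>"
  shows "\<exists>\<delta>\<in>\<Gamma>. \<forall>x\<in>Rn n. \<delta> (\<gamma> x) = x \<and> \<gamma> (\<delta> x) = x"
proof -
  have inj\<gamma>: "inj_on \<gamma> (Rn n)"
    using group_Bij[OF \<gamma>] by (simp add: Bij_def bij_betw_def)
  have "inj_on (compose (Rn n) \<gamma>) \<Gamma>"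
  proof (rule inj_onI)
    fix \<delta> \<epsilon> assume d: "\<delta> \<in> \<Gamma>" "\<epsilon> \<in> \<Gamma>" "compose (Rn n) \<gamma> \<delta> = compose (Rn n) \<gamma> \<epsilon>"
    show "\<delta> = \<epsilon>"
    proof (rule extensionalityI[OF Bij_imp_extensional Bij_imp_extensional])
      fix x assume x: "x \<in> Rn n"
      then have "\<gamma> (\<delta> x) = \<gamma> (\<epsilon> x)"
        using d(3) by (metis compose_eq)
      then show "\<delta> x = \<epsilon> x"
        using inj\<gamma> group_maps d(1,2) x by (simp add: inj_on_def)
    qed (use group_Bij d in auto)
  qed
  then have "compose (Rn n) \<gamma> ` \<Gamma> = \<Gamma>"
    using group_compose[OF \<gamma>] by (intro endo_inj_surj[OF fin]) auto
  then obtain \<delta> where d: "\<delta> \<in> \<Gamma>" "compose (Rn n) \<gamma> \<delta> = (\<lambda>x\<in>Rn n. x)"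
    using group_one by (metis imageE)
  have right: "\<gamma> (\<delta> x) = x" if "x \<in> Rn n" for x
    using d(2) that by (metis compose_eq restrict_apply')
  have "\<delta> (\<gamma> x) = x" if x: "x \<in> Rn n" for x
    using right[OF group_maps[OF \<gamma> x]] inj\<gamma> group_maps \<gamma> d(1) x by (simp add: inj_on_def)
  then show ?thesis
    using d(1) right by blast
qed

lemma mem_orbit_map: "x \<in> Rn n \<Longrightarrow> x \<in> orbit_map \<Gamma> x"
  using group_one unfolding orbit_map_def by (metis imageI restrict_apply')

text \<open>Closure under composition gives one inclusion; the same inclusion for the inverse of
  \<gamma>, applied at \<gamma> x, gives the other.\<close>

lemma orbit_map_group:
  assumes \<gamma>: "\<gamma> \<in> \<Gamma>" and x: "x \<in> Rn n"
  shows "orbit_map \<Gamma> (\<gamma> x) = orbit_map \<Gamma> x"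
proof -
  have sub: "orbit_map \<Gamma> (\<gamma> x) \<subseteq> orbit_map \<Gamma> x" if "\<gamma> \<in> \<Gamma>" "x \<in> Rn n" for \<gamma> x
  proof -
    have "\<delta> (\<gamma> x) \<in> orbit_map \<Gamma> x" if "\<delta> \<in> \<Gamma>" for \<delta>
      using group_compose[OF that \<open>\<gamma> \<in> \<Gamma>\<close>] \<open>x \<in> Rn n\<close> compose_eq unfolding orbit_map_def by (metis imageI)
    then show ?thesis
      unfolding orbit_map_def by auto
  qed
  obtain \<delta> where d: "\<delta> \<in> \<Gamma>" "\<delta> (\<gamma> x) = x"
    using group_inverse[OF \<gamma>] x by blast
  then show ?thesis
    using sub[OF \<gamma> x] sub[OF d(1) group_maps[OF \<gamma> x]] by auto
qed

end

lemma plots_quotient: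
  "p \<in> plots (quotient X q) m \<longleftrightarrow> openin (Euclidean_space m) (dom p) \<and>
     (\<forall>u \<in> dom p. \<exists>l \<in> plots X m. u \<in> dom l \<and> map_option q \<circ> l \<subseteq>\<^sub>m p)"
  by (simp add: quotient_def)

lemma pmap_plot_quotient_euclid:
  assumes U: "openin (Euclidean_space n) U"
  shows "pmap U q \<in> plots (quotient (euclid n) q) n"
proof -
  have "pmap U (\<lambda>x. x) \<in> plots (euclid n) n"
    by (simp add: pmap_plot_euclid[OF U] C_inf_id[OF U])
  moreover have "map_option q \<circ> pmap U (\<lambda>x. x) = pmap U q"
    by (simp add: map_option_pmap)
  ultimately have "\<exists>l \<in> plots (euclid n) n. u \<in> dom l \<and> map_option q \<circ> l \<subseteq>\<^sub>m pmap U q" if "u \<in> U" for u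
    using that by (intro bexI[of _ "pmap U (\<lambda>x. x)"]) simp_all
  then show ?thesis
    using U by (simp add: plots_quotient)
qed


subsection \<open>Orbifold charts\<close>

context
  fixes X :: "'a diffeology" and n \<Gamma> \<psi>
  assumes X: "diffeological_space X" and ch: "orbifold_chart X n \<Gamma> \<psi>"
begin

lemma chart_finite: "finite \<Gamma>" and chart_subgroup: "subgroup \<Gamma> (Diff (euclid n))"
  and chart_transition: "transition X (quotient (euclid n) (orbit_map \<Gamma>)) \<psi>"
  using ch by (auto simp: orbifold_chart_def)

lemma chart_dom_subset: "dom \<psi> \<subseteq> points X"
  using chart_transition by (auto simp: transition_def openin_D_topology)

lemma chart_inj: "inj_on (the \<circ> \<psi>) (dom \<psi>)"
  using chart_transition chart_dom_subset
  by (simp add: transition_def diffeomorphism_def bij_betw_def Int_absorb1)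

text \<open>Injectivity of \<psi> turns the choice inside \<open>partial_inverse\<close> into an
  equation for \<psi>. Later arguments about charts use this form.\<close>

lemma orbifold_param_eq_Some:
  "orbifold_param n \<Gamma> \<psi> x = Some a \<longleftrightarrow> x \<in> Rn n \<and> \<psi> a = Some (orbit_map \<Gamma> x)"
proof -
  have "partial_inverse \<psi> y = Some a \<longleftrightarrow> \<psi> a = Some y" for y
  proof
    assume *: "partial_inverse \<psi> y = Some a"
    then have y: "y \<in> ran \<psi>" and a: "a = inv_into (dom \<psi>) (the \<circ> \<psi>) y"
      by (auto simp: partial_inverse_def split: if_splits)
    have "y \<in> (the \<circ> \<psi>) ` dom \<psi>"
      using y by (force simp: ran_def)
    from inv_into_into[OF this] f_inv_into_f[OF this] have "a \<in> dom \<psi>" "(the \<circ> \<psi>) a = y"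
      unfolding a .
    then show "\<psi> a = Some y"
      by auto
  next
    assume *: "\<psi> a = Some y"
    then have "inv_into (dom \<psi>) (the \<circ> \<psi>) y = a"
      using chart_inj by (intro inv_into_f_eq) auto
    then show "partial_inverse \<psi> y = Some a"
      using * by (auto simp: partial_inverse_def ran_def)
  qed
  then show ?thesis
    by (auto simp: orbifold_param_def restrict_map_def)
qed

lemma orbifold_param_dom_iff: "x \<in> dom (orbifold_param n \<Gamma> \<psi>) \<longleftrightarrow> x \<in> Rn n \<and> orbit_map \<Gamma> x \<in> ran \<psi>"
  by (auto simp: dom_def orbifold_param_eq_Some ran_def)

lemma orbifold_param_dom_open: "openin (Euclidean_space n) (dom (orbifold_param n \<Gamma> \<psi>))"
proof -
  have "openin (D_topology (quotient (euclid n) (orbit_map \<Gamma>))) (ran \<psi>)"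
    using chart_transition by (simp add: transition_def)
  from plot_preimage_open[OF this pmap_plot_quotient_euclid[of n "Rn n"]]
  have "openin (Euclidean_space n) {u \<in> Rn n. the (pmap (Rn n) (orbit_map \<Gamma>) u) \<in> ran \<psi>}"
    by simp
  moreover have "{u \<in> Rn n. the (pmap (Rn n) (orbit_map \<Gamma>) u) \<in> ran \<psi>} = dom (orbifold_param n \<Gamma> \<psi>)"
    unfolding set_eq_iff by (auto simp only: mem_Collect_eq orbifold_param_dom_iff pmap_apply option.sel)
  ultimately show ?thesis
    by simp
qed

text \<open>On its open domain the orbit map is a plot of the quotient, and the inverse of \<psi> is
  smooth on the image of \<psi>; the parametrization is their composite.\<close>

lemma orbifold_param_plot: "orbifold_param n \<Gamma> \<psi> \<in> plots X n"
proof -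
  let ?V = "dom (orbifold_param n \<Gamma> \<psi>)"
  have pts: "points X \<inter> dom \<psi> = dom \<psi>"
    using chart_dom_subset by blast
  have "smooth_map (subspace (quotient (euclid n) (orbit_map \<Gamma>)) (ran \<psi>)) (subspace X (dom \<psi>)) (inv_into (dom \<psi>) (the \<circ> \<psi>))"
    using chart_transition by (simp add: transition_def diffeomorphism_def pts)
  moreover have "pmap ?V (orbit_map \<Gamma>) \<in> plots (subspace (quotient (euclid n) (orbit_map \<Gamma>)) (ran \<psi>)) n"
    using pmap_plot_quotient_euclid[OF orbifold_param_dom_open] orbifold_param_dom_iff
    by (auto simp: plots_subspace)
  ultimately have "map_option (inv_into (dom \<psi>) (the \<circ> \<psi>)) \<circ> pmap ?V (orbit_map \<Gamma>) \<in> plots (subspace X (dom \<psi>)) n"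
    by (rule smooth_mapD)
  moreover have "orbifold_param n \<Gamma> \<psi> = pmap ?V (\<lambda>x. inv_into (dom \<psi>) (the \<circ> \<psi>) (orbit_map \<Gamma> x))"
  proof
    fix x
    show "orbifold_param n \<Gamma> \<psi> x = pmap ?V (\<lambda>x. inv_into (dom \<psi>) (the \<circ> \<psi>) (orbit_map \<Gamma> x)) x"
    proof (cases "x \<in> ?V")
      case True
      then have "x \<in> Rn n" "orbit_map \<Gamma> x \<in> ran \<psi>"
        using orbifold_param_dom_iff by blast+
      then have "orbifold_param n \<Gamma> \<psi> x = Some (inv_into (dom \<psi>) (the \<circ> \<psi>) (orbit_map \<Gamma> x))"
        by (simp add: orbifold_param_def partial_inverse_def)
      then show ?thesis
        using True by (simp add: pmap_apply)
    next
      case False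
      then have "orbifold_param n \<Gamma> \<psi> x = None"
        by blast
      then show ?thesis
        using False by (simp add: pmap_def)
    qed
  qed
  ultimately show ?thesis
    by (simp add: map_option_pmap plots_subspace)
qed

lemma orbifold_param_mem: "orbifold_param n \<Gamma> \<psi> x = Some a \<Longrightarrow> a \<in> dom \<psi>"
  by (simp add: orbifold_param_eq_Some domI)

text \<open>Equal values mean equal orbits, and \<open>y\<close> lies in its own orbit. This
  provides the finite family of candidates in all density arguments.\<close>

lemma orbifold_param_eqD:
  assumes "x \<in> dom (orbifold_param n \<Gamma> \<psi>)" "orbifold_param n \<Gamma> \<psi> y = orbifold_param n \<Gamma> \<psi> x"
  shows "\<exists>\<gamma>\<in>\<Gamma>. y = \<gamma> x"
proof -
  obtain a where "orbifold_param n \<Gamma> \<psi> x = Some a" "orbifold_param n \<Gamma> \<psi> y = Some a"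
    using assms by auto
  then have "orbit_map \<Gamma> x = orbit_map \<Gamma> y" "y \<in> Rn n"
    unfolding orbifold_param_eq_Some by auto
  then have "y \<in> orbit_map \<Gamma> x"
    using mem_orbit_map[OF chart_finite chart_subgroup] by auto
  then show ?thesis
    by (auto simp: orbit_map_def)
qed

lemma orbifold_param_group:
  assumes "\<gamma> \<in> \<Gamma>" "x \<in> dom (orbifold_param n \<Gamma> \<psi>)"
  shows "orbifold_param n \<Gamma> \<psi> (\<gamma> x) = orbifold_param n \<Gamma> \<psi> x"
proof -
  obtain a where a: "orbifold_param n \<Gamma> \<psi> x = Some a"
    using assms by auto
  then have "orbifold_param n \<Gamma> \<psi> (\<gamma> x) = Some a"
    using orbit_map_group[OF chart_finite chart_subgroup assms(1)] group_maps[OF chart_finite chart_subgroup assms(1)]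
    unfolding orbifold_param_eq_Some by auto
  then show ?thesis
    using a by simp
qed

text \<open>By definition of the quotient diffeology, plots of the quotient by \<Gamma> lift locally
  to Euclidean space. This is applied to \<psi> after p, on the open set where p takes values in the
  domain of \<psi>.\<close>

lemma chart_lift:
  assumes p: "p \<in> plots X m" and r: "p r = Some a" "a \<in> dom \<psi>"
  shows "\<exists>W l. r \<in> W \<and> openin (Euclidean_space m) W \<and> W \<subseteq> dom p \<and> C_inf m W n l \<and>
     (\<forall>x\<in>W. orbifold_param n \<Gamma> \<psi> (l x) = p x)"
proof -
  let ?U = "{u \<in> dom p. the (p u) \<in> dom \<psi>}"
  have pts: "points X \<inter> dom \<psi> = dom \<psi>"
    using chart_dom_subset by blast
  have "openin (D_topology X) (dom \<psi>)"
    using chart_transition by (simp add: transition_def)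
  from plot_preimage_open[OF this p] have U: "openin (Euclidean_space m) ?U" .
  have "p |` ?U \<in> plots X m"
    by (rule plot_restrict[OF X p U]) auto
  moreover have "ran (p |` ?U) \<subseteq> dom \<psi>"
    by (auto simp: ran_def restrict_map_def split: if_splits)
  ultimately have "p |` ?U \<in> plots (subspace X (dom \<psi>)) m"
    by (simp add: plots_subspace)
  moreover have sm: "smooth_map (subspace X (dom \<psi>)) (subspace (quotient (euclid n) (orbit_map \<Gamma>)) (ran \<psi>)) (the \<circ> \<psi>)"
    using chart_transition by (simp add: transition_def diffeomorphism_def)
  ultimately have "map_option (the \<circ> \<psi>) \<circ> (p |` ?U) \<in> plots (subspace (quotient (euclid n) (orbit_map \<Gamma>)) (ran \<psi>)) m"
    by (intro smooth_mapD[OF sm])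
  then have "map_option (the \<circ> \<psi>) \<circ> (p |` ?U) \<in> plots (quotient (euclid n) (orbit_map \<Gamma>)) m"
    unfolding plots_subspace by (rule conjunct1)
  moreover have "r \<in> dom (map_option (the \<circ> \<psi>) \<circ> (p |` ?U))"
    using r by auto
  ultimately obtain l where l: "l \<in> plots (euclid n) m" "r \<in> dom l"
      and le: "map_option (orbit_map \<Gamma>) \<circ> l \<subseteq>\<^sub>m map_option (the \<circ> \<psi>) \<circ> (p |` ?U)"
    unfolding plots_quotient by blast
  have lR: "the (l x) \<in> Rn n" if "x \<in> dom l" for x
    using l(1) that C_infD(1)[of m "dom l" n "the \<circ> l"] by (auto simp: plots_euclid)
  have *: "\<exists>a. p x = Some a \<and> \<psi> a = Some (orbit_map \<Gamma> (the (l x)))" if x: "x \<in> dom l" for x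
  proof -
    obtain y where y: "l x = Some y"
      using x by blast
    then have "x \<in> dom (map_option (orbit_map \<Gamma>) \<circ> l)"
      by auto
    with le have "(map_option (orbit_map \<Gamma>) \<circ> l) x = (map_option (the \<circ> \<psi>) \<circ> (p |` ?U)) x"
      unfolding map_le_def by blast
    then have "map_option (the \<circ> \<psi>) ((p |` ?U) x) = Some (orbit_map \<Gamma> y)"
      using y by simp
    then obtain a where a: "(p |` ?U) x = Some a" "the (\<psi> a) = orbit_map \<Gamma> y"
      by auto
    then have "x \<in> ?U" "p x = Some a"
      by (auto simp: restrict_map_def split: if_splits)
    then have "a \<in> dom \<psi>"
      by auto
    then show ?thesis
      using a(2) y \<open>p x = Some a\<close> by auto
  qed
  show ?thesis
  proof (intro exI[of _ "dom l"] exI[of _ "the \<circ> l"] conjI ballI)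
    show "orbifold_param n \<Gamma> \<psi> ((the \<circ> l) x) = p x" if "x \<in> dom l" for x
      using *[OF that] lR[OF that] orbifold_param_eq_Some by (metis comp_apply)
    show "dom l \<subseteq> dom p"
    proof
      fix x assume "x \<in> dom l"
      then show "x \<in> dom p"
        using *[of x] by (auto simp only: dom_def mem_Collect_eq)
    qed
    show "openin (Euclidean_space m) (dom l)" "C_inf m (dom l) n (the \<circ> l)"
      using l(1) unfolding plots_euclid by (rule conjunct1, rule conjunct2)
  qed (rule l(2))
qed

end

subsection \<open>Classes in $T_2$\<close>

lemma C_inf_const: "openin (Euclidean_space m) U \<Longrightarrow> a \<in> Rn n \<Longrightarrow> C_inf m U n (\<lambda>_. a)"
  by (auto simp: C_inf_def C_inf_fun_const)

lemma T2_class_reparam: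
  assumes "p \<in> plots X m" "q \<in> plots X k" "r \<in> dom p" "v \<in> Rn m" "w \<in> Rn m"
    and "C_inf m (dom p) k f" "f ` dom p \<subseteq> dom q" "\<And>x. x \<in> dom p \<Longrightarrow> q (f x) = p x"
  shows "T2_class X ((m, p), r, v, w) = T2_class X ((k, q), f r, jacobian m f r v, jacobian m f r w)"
proof -
  have "T2_step X ((m, p), r, v, w) ((k, q), f r, jacobian m f r v, jacobian m f r w)"
    using assms unfolding T2_step_def by auto
  then show ?thesis
    by (intro T2_class_eqI r_into_equivclp)
qed

text \<open>The identity is a morphism from the restricted plot to the larger one, and its
  derivative is the identity.\<close>

lemma T2_class_subplot:
  assumes X: "diffeological_space X" and p: "p \<in> plots X m" "p' \<in> plots X m" "p' \<subseteq>\<^sub>m p"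
    and r: "r \<in> dom p'" and v: "v \<in> Rn m" and w: "w \<in> Rn m"
  shows "T2_class X ((m, p'), r, v, w) = T2_class X ((m, p), r, v, w)"
proof -
  have "T2_class X ((m, p'), r, v, w) =
      T2_class X ((m, p), (\<lambda>x. x) r, jacobian m (\<lambda>x. x) r v, jacobian m (\<lambda>x. x) r w)"
  proof (rule T2_class_reparam[OF p(2,1) r v w C_inf_id])
    show "openin (Euclidean_space m) (dom p')"
      by (rule diffeological_spaceD(1)[OF X p(2)])
    show "(\<lambda>x. x) ` dom p' \<subseteq> dom p"
      using map_le_implies_dom_le[OF p(3)] by (simp only: image_ident)
    show "p x = p' x" if "x \<in> dom p'" for x
      using p(3) that by (simp add: map_le_def)
  qed
  then show ?thesis
    by (simp add: jacobian_id v w)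
qed

section \<open>Points of T_2 and plots of coproducts\<close>

lemma points_T2:
  "points (T2 X) = {T2_class X ((m, p), r, v, w) | m p r v w.
     p \<in> plots X m \<and> r \<in> Rn m \<and> r \<in> dom p \<and> v \<in> Rn m \<and> w \<in> Rn m}"
  unfolding T2_def quotient_def pre_T2_def coproduct_def prod_space_def
  by (auto simp: image_iff) blast+

lemma plots_coproduct:
  "p \<in> plots (coproduct K X) m \<longleftrightarrow> openin (Euclidean_space m) (dom p) \<and>
     (\<forall>u \<in> dom p. \<exists>k \<in> K. \<exists>l \<in> plots (X k) m. u \<in> dom l \<and> map_option (Pair k) \<circ> l \<subseteq>\<^sub>m p)"
  by (simp add: coproduct_def)

lemma points_coproduct: "points (coproduct K X) = Sigma K (\<lambda>k. points (X k))"
  by (simp add: coproduct_def)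

lemma smooth_map_Pair:
  assumes "k \<in> K" "diffeological_space (X k)"
  shows "smooth_map (X k) (coproduct K X) (Pair k)"
  unfolding smooth_map_def points_coproduct plots_coproduct
proof (intro conjI allI ballI)
  show "Pair k ` points (X k) \<subseteq> Sigma K (\<lambda>k. points (X k))"
    using assms(1) by auto
  fix m p u assume p: "p \<in> plots (X k) m"
  then show "openin (Euclidean_space m) (dom (map_option (Pair k) \<circ> p))"
    using diffeological_spaceD(1)[OF assms(2)] by simp
  assume "u \<in> dom (map_option (Pair k) \<circ> p)"
  then have "u \<in> dom p"
    by simp
  then show "\<exists>k' \<in> K. \<exists>l \<in> plots (X k') m. u \<in> dom l \<and> map_option (Pair k') \<circ> l \<subseteq>\<^sub>m map_option (Pair k) \<circ> p"
    using p assms(1) by (intro bexI[of _ k] bexI[of _ p]) simp_all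
qed

subsection \<open>Transitions from Euclidean spaces and generating families\<close>

lemma transition_euclid_plot:
  assumes "transition (euclid m) Y \<xi>"
  shows "\<xi> \<in> plots Y m"
proof -
  have o: "openin (Euclidean_space m) (dom \<xi>)"
    and sm: "smooth_map (subspace (euclid m) (dom \<xi>)) (subspace Y (ran \<xi>)) (the \<circ> \<xi>)"
    using assms by (auto simp: transition_def diffeomorphism_def openin_D_topology_euclid)
  have "pmap (dom \<xi>) (\<lambda>x. x) \<in> plots (subspace (euclid m) (dom \<xi>)) m"
    by (simp add: plots_subspace pmap_plot_euclid o C_inf_id)
  from smooth_mapD[OF sm this] have "pmap (dom \<xi>) (\<lambda>x. (the \<circ> \<xi>) x) \<in> plots Y m"
    unfolding map_option_pmap plots_subspace by (rule conjunct1)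
  moreover have "pmap (dom \<xi>) (\<lambda>x. (the \<circ> \<xi>) x) = \<xi>"
    by (rule ext) (auto simp: pmap_def dom_def)
  ultimately show ?thesis
    by simp
qed

text \<open>The inverse \<open>\<zeta>\<close> of the transition is smooth, so the chain rule
  recovers \<open>v\<close> from its image under the derivative.\<close>

lemma transition_euclid_jacobian_nonzero:
  assumes V: "openin (Euclidean_space k) V" and \<xi>: "transition (euclid m) (subspace (euclid k) V) \<xi>"
    and r: "r \<in> dom \<xi>" and v: "v \<in> Rn m" "v \<noteq> (\<lambda>_. 0)"
  shows "jacobian m (the \<circ> \<xi>) r v \<noteq> (\<lambda>_. 0)"
proof
  assume 0: "jacobian m (the \<circ> \<xi>) r v = (\<lambda>_. 0)"
  define \<zeta> where "\<zeta> = inv_into (dom \<xi>) (the \<circ> \<xi>)"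
  have o: "openin (Euclidean_space m) (dom \<xi>)"
    using \<xi> by (simp add: transition_def openin_D_topology_euclid)
  have ro: "openin (Euclidean_space k) (ran \<xi>)" "ran \<xi> \<subseteq> V"
    using \<xi> openin_open_subtopology[OF V] by (auto simp: transition_def D_topology_subspace_euclid[OF V])
  have pts: "Rn m \<inter> dom \<xi> = dom \<xi>"
    using openin_Euclidean_subset[OF o] by blast
  have inj: "inj_on (the \<circ> \<xi>) (dom \<xi>)"
    and sm: "smooth_map (subspace (subspace (euclid k) V) (ran \<xi>)) (subspace (euclid m) (dom \<xi>)) \<zeta>"
    using \<xi> by (simp_all add: transition_def diffeomorphism_def bij_betw_def pts \<zeta>_def)
  have "pmap (ran \<xi>) (\<lambda>x. x) \<in> plots (subspace (subspace (euclid k) V) (ran \<xi>)) k"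
    using ro by (simp add: plots_subspace pmap_plot_euclid C_inf_id)
  from smooth_mapD[OF sm this] have "pmap (ran \<xi>) \<zeta> \<in> plots (euclid m) k"
    unfolding map_option_pmap plots_subspace by (rule conjunct1)
  then have \<zeta>s: "C_inf k (ran \<xi>) m \<zeta>"
    using pmap_plot_euclid[OF ro(1)] by blast
  have \<xi>s: "C_inf m (dom \<xi>) k (the \<circ> \<xi>)"
    using transition_euclid_plot[OF \<xi>] by (simp add: plots_subspace plots_euclid)
  have img: "(the \<circ> \<xi>) ` dom \<xi> \<subseteq> ran \<xi>"
    by (auto simp: ran_def)
  have "jacobian m (\<lambda>x. \<zeta> ((the \<circ> \<xi>) x)) r v = jacobian k \<zeta> ((the \<circ> \<xi>) r) (jacobian m (the \<circ> \<xi>) r v)"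
    by (rule jacobian_compose[OF o ro(1) img \<zeta>s \<xi>s r])
  moreover have "jacobian m (\<lambda>x. \<zeta> ((the \<circ> \<xi>) x)) r v = jacobian m (\<lambda>x. x) r v"
    by (rule jacobian_cong[OF o r]) (unfold \<zeta>_def, rule inv_into_f_f[OF inj])
  ultimately show False
    using v by (simp add: 0 jacobian_zero jacobian_id)
qed

lemma second_countable_euclidean:
  "second_countable (euclidean :: 'a::second_countable_topology topology)"
proof -
  obtain \<B> :: "'a set set" where "countable \<B>" "topological_basis \<B>"
    using ex_countable_basis by blast
  then show ?thesis
    unfolding second_countable_def open_openin[symmetric]
    by (meson topological_basisE topological_basis_open)
qed

lemma manifold_subspace_euclid:
  assumes V: "openin (Euclidean_space k) V"
  shows "manifold (subspace (euclid k) V)"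
  unfolding manifold_def D_topology_subspace_euclid[OF V]
proof (intro conjI ballI)
  show "diffeological_space (subspace (euclid k) V)"
    by (rule diffeological_space_subspace[OF diffeological_space_euclid])
  show "Hausdorff_space (subtopology (Euclidean_space k) V)"
    by (subst Euclidean_space_eq_top_of_set) (simp add: Hausdorff_space_subtopology)
  show "second_countable (subtopology (Euclidean_space k) V)"
    by (subst Euclidean_space_eq_top_of_set) (intro second_countable_subtopology second_countable_euclidean)
  \<comment> \<open>\<open>euclid k\<close> is written as its subspace on \<open>UNIV\<close> so
    that \<open>transition_pmap\<close> applies.\<close>
  have "transition (subspace (euclid k) UNIV) (subspace (euclid k) V) (pmap V (\<lambda>x. x))"
    by (rule transition_pmap[OF V _ V _ C_inf_id[OF V] _ C_inf_id[OF V]]) auto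
  then have "transition (euclid k) (subspace (euclid k) V) (pmap V (\<lambda>x. x))"
    by (simp only: subspace_UNIV)
  then show "\<exists>n \<xi>. transition (euclid n) (subspace (euclid k) V) \<xi> \<and> x \<in> ran \<xi>"
    if "x \<in> points (subspace (euclid k) V)" for x
    using that by (intro exI[of _ k] exI[of _ "pmap V (\<lambda>x. x)"]) (simp del: domIff)
qed

lemma chart_domain_eq: "chart_domain k \<Gamma> \<psi> = subspace (euclid k) (dom (orbifold_param k \<Gamma> \<psi>))"
  by (simp add: chart_domain_def)

lemma plot_reparam:
  assumes X: "diffeological_space X" and q: "q \<in> plots X k" and U: "openin (Euclidean_space m) U"
    and f: "C_inf m U k f" "f ` U \<subseteq> dom q"
  shows "pmap U (\<lambda>x. the (q (f x))) \<in> plots X m"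
proof -
  have "(q \<circ> f) |` U = pmap U (\<lambda>x. the (q (f x)))"
    using f(2) by (intro ext) (auto simp: pmap_def restrict_map_def)
  then show ?thesis
    using diffeological_spaceD(3)[OF X q U f] by simp
qed

lemma map_option_eq_pmap: "map_option h \<circ> p = pmap (dom p) (\<lambda>x. h (the (p x)))"
  by (rule ext) (auto simp: pmap_def dom_def map_option_case split: option.split)

lemma smooth_map_plot:
  assumes X: "diffeological_space X" and q: "q \<in> plots X k"
  shows "smooth_map (subspace (euclid k) (dom q)) X (the \<circ> q)"
  unfolding smooth_map_def
proof (intro conjI allI ballI)
  show "(the \<circ> q) ` points (subspace (euclid k) (dom q)) \<subseteq> points X"
    using diffeological_spaceD(2)[OF X q] by (auto simp: ran_def)
  fix m p assume "p \<in> plots (subspace (euclid k) (dom q)) m"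
  then have p: "openin (Euclidean_space m) (dom p)" "C_inf m (dom p) k (the \<circ> p)" "ran p \<subseteq> dom q"
    by (simp_all add: plots_subspace plots_euclid)
  have "(the \<circ> p) ` dom p \<subseteq> dom q"
    using p(3) by (auto simp: ran_def)
  from plot_reparam[OF X q p(1,2) this] show "map_option (the \<circ> q) \<circ> p \<in> plots X m"
    by (simp add: map_option_eq_pmap)
qed

text \<open>If every plot of X factors locally through the family, then it is locally a plot of any
  diffeology \<open>Y\<close> that makes the family smooth, hence a plot of \<open>Y\<close> by the
  locality axiom.\<close>

lemma generatesI:
  assumes X: "diffeological_space X" and sm: "\<And>M \<Phi>. (M, \<Phi>) \<in> \<F> \<Longrightarrow> smooth_map M X \<Phi>"
    and lift: "\<And>m p r. p \<in> plots X m \<Longrightarrow> r \<in> dom p \<Longrightarrow>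
      \<exists>M \<Phi> W l. (M, \<Phi>) \<in> \<F> \<and> openin (Euclidean_space m) W \<and> r \<in> W \<and> W \<subseteq> dom p \<and> l \<in> plots M m \<and>
        map_option \<Phi> \<circ> l = p |` W"
  shows "generates \<F> X"
  unfolding generates_def
proof (intro conjI ballI allI impI subsetI)
  fix z assume "z \<in> \<F>"
  then show "case z of (M, \<Phi>) \<Rightarrow> smooth_map M X \<Phi>"
    using sm by (cases z) simp
next
  fix Y m p
  assume Y: "diffeological_space Y \<and> points Y = points X \<and> (\<forall>(M, \<Phi>) \<in> \<F>. smooth_map M Y \<Phi>)"
    and p: "p \<in> plots X m"
  show "p \<in> plots Y m"
  proof (rule diffeological_spaceD(4))
    show "diffeological_space Y"
      using Y by blast
    show "openin (Euclidean_space m) (dom p)"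
      by (rule diffeological_spaceD(1)[OF X p])
    fix r assume "r \<in> dom p"
    from lift[OF p this] obtain M \<Phi> W l where *: "(M, \<Phi>) \<in> \<F>" "openin (Euclidean_space m) W" "r \<in> W" "W \<subseteq> dom p" "l \<in> plots M m"
      "map_option \<Phi> \<circ> l = p |` W"
      by (elim exE conjE)
    have "smooth_map M Y \<Phi>"
      using Y *(1) by fast
    from smooth_mapD[OF this *(5)] have "p |` W \<in> plots Y m"
      unfolding *(6) .
    with *(2-4) show "\<exists>W. openin (Euclidean_space m) W \<and> r \<in> W \<and> W \<subseteq> dom p \<and> p |` W \<in> plots Y m"
      by (intro exI[of _ W] conjI)
  qed
qed


section \<open>An invariant metric on a family of charts\<close>

locale invariant_metric_on_charts =
  fixes X :: "'a diffeology"
    and n :: nat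
    and I :: "'i set"
    and \<Gamma> :: "'i \<Rightarrow> (vec \<Rightarrow> vec) set"
    and \<psi> :: "'i \<Rightarrow> 'a \<rightharpoonup> vec set"
    and \<eta> :: "('i \<times> vec) pre_T2 set \<Rightarrow> real"
  assumes space: "diffeological_space X"
    and charts: "\<And>i. i \<in> I \<Longrightarrow> orbifold_chart X n (\<Gamma> i) (\<psi> i)"
    and cover: "points X = (\<Union>i\<in>I. dom (\<psi> i))"
    and metric: "riemannian_metric (charts_sum n \<Gamma> \<psi> I) \<eta>"
    and invariant: "invariant_metric (charts_sum n \<Gamma> \<psi> I) \<eta> (charts_pseudogroup n \<Gamma> \<psi> I)"
begin

section \<open>The disjoint union of the chart domains and its metric in coordinates\<close>

abbreviation M :: "('i \<times> vec) diffeology" where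
  "M \<equiv> charts_sum n \<Gamma> \<psi> I"

abbreviation \<phi> :: "'i \<Rightarrow> vec \<rightharpoonup> 'a" where
  "\<phi> \<equiv> charts_phi n \<Gamma> \<psi>"

abbreviation V :: "'i \<Rightarrow> vec set" where
  "V i \<equiv> dom (\<phi> i)"

text \<open>The coordinate expression of \<eta> on the summand \<open>V i\<close>, read through the
  inclusion plot. Values of \<eta> are computed through it from here on.\<close>

definition B :: "'i \<Rightarrow> vec \<Rightarrow> vec \<Rightarrow> vec \<Rightarrow> real" where
  "B i y a b = \<eta> (T2_class M ((n, pmap (V i) (Pair i)), y, a, b))"

lemma charts_V_eq: "charts_V n \<Gamma> \<psi> i = subspace (euclid n) (V i)"
  by (simp add: charts_V_def chart_domain_def charts_phi_def)

lemma M_space: "diffeological_space M"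
  using metric by (simp add: riemannian_metric_def manifold_def)

lemma V_open: "i \<in> I \<Longrightarrow> openin (Euclidean_space n) (V i)"
  using orbifold_param_dom_open[OF space charts] by (simp add: charts_phi_def)

lemma V_subset: "i \<in> I \<Longrightarrow> V i \<subseteq> Rn n"
  using V_open openin_Euclidean_subset by blast

lemma phi_plot: "i \<in> I \<Longrightarrow> \<phi> i \<in> plots X n"
  using orbifold_param_plot[OF space charts] by (simp add: charts_phi_def)

lemma plots_M:
  "p \<in> plots M m \<longleftrightarrow> openin (Euclidean_space m) (dom p) \<and>
     (\<forall>u \<in> dom p. \<exists>k \<in> I. \<exists>l \<in> plots (subspace (euclid n) (V k)) m. u \<in> dom l \<and> map_option (Pair k) \<circ> l \<subseteq>\<^sub>m p)"
  by (simp add: charts_sum_def plots_coproduct charts_V_eq)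

lemma points_M: "points M = Sigma I V"
  using V_subset by (fastforce simp: charts_sum_def points_coproduct charts_V_eq)

lemma pair_plot_M:
  assumes "i \<in> I" and W: "openin (Euclidean_space m) W" and l: "C_inf m W n l" "l ` W \<subseteq> V i"
  shows "pmap W (\<lambda>x. (i, l x)) \<in> plots M m"
proof -
  have "pmap W l \<in> plots (subspace (euclid n) (V i)) m"
    using pmap_plot_euclid[OF W] l by (simp add: plots_subspace)
  moreover have "map_option (Pair i) \<circ> pmap W l = pmap W (\<lambda>x. (i, l x))"
    by (simp add: map_option_pmap)
  ultimately have "\<exists>k \<in> I. \<exists>l \<in> plots (subspace (euclid n) (V k)) m.
      u \<in> dom l \<and> map_option (Pair k) \<circ> l \<subseteq>\<^sub>m pmap W (\<lambda>x. (i, l' x))"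
    if "u \<in> W" "l' = l" for u l'
    using that assms(1) by (intro bexI[of _ i] bexI[of _ "pmap W l"]) simp_all
  then show ?thesis
    unfolding plots_M using W by simp
qed

lemma plot_M_local:
  assumes p: "p \<in> plots M m" and u: "u \<in> dom p"
  obtains i W l where "i \<in> I" "u \<in> W" "openin (Euclidean_space m) W" "C_inf m W n l" "l ` W \<subseteq> V i"
    "pmap W (\<lambda>x. (i, l x)) \<subseteq>\<^sub>m p"
proof -
  obtain i l where il: "i \<in> I" "l \<in> plots (subspace (euclid n) (V i)) m" "u \<in> dom l" "map_option (Pair i) \<circ> l \<subseteq>\<^sub>m p"
    using p u unfolding plots_M by blast
  have l: "openin (Euclidean_space m) (dom l)" "C_inf m (dom l) n (the \<circ> l)" "ran l \<subseteq> V i"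
    using il(2) by (simp_all add: plots_subspace plots_euclid)
  have "pmap (dom l) (\<lambda>x. (i, (the \<circ> l) x)) = map_option (Pair i) \<circ> l"
    by (rule ext) (auto simp: pmap_def dom_def map_option_case split: option.split)
  moreover have "(the \<circ> l) ` dom l \<subseteq> V i"
    using l(3) by (auto simp: ran_def)
  ultimately show thesis
    using that[OF il(1,3) l(1,2)] il(4) by simp
qed

text \<open>The plot factors as the inclusion of \<open>V i\<close> after \<open>l\<close>, so its
  class in T_2 is that of the inclusion at the point and vectors pushed forward by
  \<open>l\<close>.\<close>

lemma eta_pair:
  assumes i: "i \<in> I" and W: "openin (Euclidean_space m) W" and l: "C_inf m W n l" "l ` W \<subseteq> V i"
    and r: "r \<in> W" and v: "v \<in> Rn m" and w: "w \<in> Rn m"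
  shows "\<eta> (T2_class M ((m, pmap W (\<lambda>x. (i, l x))), r, v, w)) = B i (l r) (jacobian m l r v) (jacobian m l r w)"
proof -
  have "T2_class M ((m, pmap W (\<lambda>x. (i, l x))), r, v, w) =
     T2_class M ((n, pmap (V i) (Pair i)), l r, jacobian m l r v, jacobian m l r w)"
  proof (rule T2_class_reparam)
    show "pmap W (\<lambda>x. (i, l x)) \<in> plots M m"
      by (rule pair_plot_M[OF i W l])
    show "pmap (V i) (Pair i) \<in> plots M n"
      using pair_plot_M[OF i V_open[OF i] C_inf_id[OF V_open[OF i]]] by simp
    show "pmap (V i) (Pair i) (l x) = pmap W (\<lambda>x. (i, l x)) x" if "x \<in> dom (pmap W (\<lambda>x. (i, l x)))" for x
      using that l(2) by (auto simp: pmap_apply image_subset_iff simp del: domIff)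
  qed (use r v w l in simp_all)
  then show ?thesis
    by (simp add: B_def)
qed

text \<open>A Riemannian metric is tested on parametrizations that are transitions, so this is what
  makes \<open>B i\<close> a smooth field of inner products. A plot of the sum stays locally in one
  summand; hence the image is D-open and the inverse is smooth.\<close>

lemma inclusion_transition:
  assumes i: "i \<in> I"
  shows "transition (euclid n) M (pmap (V i) (Pair i))"
proof -
  have pts: "Rn n \<inter> V i = V i" "points M \<inter> Pair i ` V i = Pair i ` V i"
    using V_subset[OF i] i by (auto simp: points_M)
  have val: "(the \<circ> pmap (V i) (Pair i)) x = (i, x)" if "x \<in> V i" for x
    using that by (simp add: pmap_apply)
  have inj: "inj_on (the \<circ> pmap (V i) (Pair i)) (V i)"
    using val by (auto simp: inj_on_def)
  have inv: "inv_into (V i) (the \<circ> pmap (V i) (Pair i)) (i, x) = x" if "x \<in> V i" for x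
    using inv_into_f_f[OF inj that] val[OF that] by simp
  have invV: "inv_into (V i) (the \<circ> pmap (V i) (Pair i)) c \<in> V i" if c: "c \<in> Pair i ` V i" for c
  proof -
    obtain x where "x \<in> V i" "c = (i, x)"
      using c by blast
    then show ?thesis
      using inv by metis
  qed
  have img: "(the \<circ> pmap (V i) (Pair i)) ` V i = Pair i ` V i"
    by (rule image_cong) (use val in auto)
  have "openin (D_topology M) (Pair i ` V i)"
    unfolding openin_D_topology
  proof (intro conjI allI ballI)
    fix m p assume p: "p \<in> plots M m"
    show "openin (Euclidean_space m) {u \<in> dom p. the (p u) \<in> Pair i ` V i}"
    proof (rule openin_subopen[THEN iffD2], rule ballI)
      fix u assume u: "u \<in> {u \<in> dom p. the (p u) \<in> Pair i ` V i}"
      then obtain k W l where W: "k \<in> I" "u \<in> W" "openin (Euclidean_space m) W" "C_inf m W n l" "l ` W \<subseteq> V k"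
        "pmap W (\<lambda>x. (k, l x)) \<subseteq>\<^sub>m p"
        using plot_M_local[OF p] by blast
      have *: "p x = Some (k, l x)" if "x \<in> W" for x
        using W(6) that by (auto simp: map_le_def pmap_apply dest!: bspec[where x = x])
      then have "k = i"
        using u W(2) by auto
      then have "W \<subseteq> {u \<in> dom p. the (p u) \<in> Pair i ` V i}"
        using * W(5) by (force simp: image_subset_iff)
      then show "\<exists>T. openin (Euclidean_space m) T \<and> u \<in> T \<and> T \<subseteq> {u \<in> dom p. the (p u) \<in> Pair i ` V i}"
        using W(2,3) by blast
    qed
  qed (use pts in auto)
  moreover have "smooth_map (subspace (euclid n) (V i)) (subspace M (Pair i ` V i)) (the \<circ> pmap (V i) (Pair i))"
    unfolding smooth_map_def
  proof (intro conjI allI ballI)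
    show "(the \<circ> pmap (V i) (Pair i)) ` points (subspace (euclid n) (V i)) \<subseteq> points (subspace M (Pair i ` V i))"
      using img by (simp add: pts)
    fix m p assume "p \<in> plots (subspace (euclid n) (V i)) m"
    then have p: "openin (Euclidean_space m) (dom p)" "C_inf m (dom p) n (the \<circ> p)" "ran p \<subseteq> V i"
      by (simp_all add: plots_subspace plots_euclid)
    have pV: "(the \<circ> p) ` dom p \<subseteq> V i"
      using p(3) by (auto simp: ran_def)
    have eq: "map_option (the \<circ> pmap (V i) (Pair i)) \<circ> p = pmap (dom p) (\<lambda>x. (i, (the \<circ> p) x))"
    proof
      fix x
      show "(map_option (the \<circ> pmap (V i) (Pair i)) \<circ> p) x = pmap (dom p) (\<lambda>x. (i, (the \<circ> p) x)) x"
      proof (cases "p x")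
        case (Some y)
        then have "y \<in> V i"
          using p(3) by (auto simp: ran_def)
        then show ?thesis
          using Some val[of y] by (simp add: pmap_def dom_def)
      qed (simp add: pmap_def dom_def)
    qed
    show "map_option (the \<circ> pmap (V i) (Pair i)) \<circ> p \<in> plots (subspace M (Pair i ` V i)) m"
      unfolding eq plots_subspace ran_pmap using pair_plot_M[OF i p(1,2) pV] pV by blast
  qed
  moreover have "smooth_map (subspace M (Pair i ` V i)) (subspace (euclid n) (V i)) (inv_into (V i) (the \<circ> pmap (V i) (Pair i)))"
    (is "smooth_map _ _ ?inv")
    unfolding smooth_map_def
  proof (intro conjI allI ballI)
    show "?inv ` points (subspace M (Pair i ` V i)) \<subseteq> points (subspace (euclid n) (V i))"
      unfolding points_subspace pts points_euclid using invV by blast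
    fix m p assume "p \<in> plots (subspace M (Pair i ` V i)) m"
    then have p: "p \<in> plots M m" "ran p \<subseteq> Pair i ` V i"
      by (simp_all add: plots_subspace)
    have o: "openin (Euclidean_space m) (dom p)"
      using p(1) by (simp add: plots_M)
    have ranV: "ran (map_option ?inv \<circ> p) \<subseteq> V i"
    proof
      fix y assume "y \<in> ran (map_option ?inv \<circ> p)"
      then obtain u c where "p u = Some c" "y = ?inv c"
        by (auto simp: ran_def)
      moreover from this(1) have "c \<in> Pair i ` V i"
        using p(2) by (blast intro: ranI)
      ultimately show "y \<in> V i"
        using invV by blast
    qed
    have "C_inf m (dom p) n (the \<circ> (map_option ?inv \<circ> p))"
    proof (rule C_inf_local[OF o])
      fix u assume u: "u \<in> dom p"
      obtain k W l where W: "k \<in> I" "u \<in> W" "openin (Euclidean_space m) W" "C_inf m W n l" "l ` W \<subseteq> V k"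
        "pmap W (\<lambda>x. (k, l x)) \<subseteq>\<^sub>m p"
        using plot_M_local[OF p(1) u] by blast
      have *: "p x = Some (k, l x)" if "x \<in> W" for x
        using W(6) that by (auto simp: map_le_def pmap_apply dest!: bspec[where x = x])
      have "(the \<circ> (map_option ?inv \<circ> p)) x = l x" if "x \<in> W" for x
      proof -
        have "(k, l x) \<in> Pair i ` V i"
          using *[OF that] p(2) by (auto simp: ran_def)
        then have "?inv (k, l x) = l x"
          using inv by auto
        then show ?thesis
          using *[OF that] by simp
      qed
      then have "C_inf m W n (the \<circ> (map_option ?inv \<circ> p))"
        using C_inf_cong[OF W(3), of "the \<circ> (map_option ?inv \<circ> p)" l] W(4) by blast
      then show "\<exists>W. u \<in> W \<and> openin (Euclidean_space m) W \<and> C_inf m W n (the \<circ> (map_option ?inv \<circ> p))"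
        using W(2,3) by blast
    qed
    then show "map_option ?inv \<circ> p \<in> plots (subspace (euclid n) (V i)) m"
      using o ranV by (simp add: plots_subspace plots_euclid)
  qed
  moreover have "bij_betw (the \<circ> pmap (V i) (Pair i)) (V i) (Pair i ` V i)"
    using inj img by (simp add: bij_betw_def)
  ultimately show ?thesis
    using V_open[OF i] by (simp add: transition_def diffeomorphism_def openin_D_topology_euclid pts)
qed

lemma B_tensor:
  assumes i: "i \<in> I"
  shows "covariant_2_tensor n (V i) (B i)"
    and "symmetric_tensor n (V i) (B i)"
    and "positive_definite_tensor n (V i) (B i)"
proof -
  have "pullback M \<eta> n (pmap (V i) (Pair i)) = B i"
    by (intro ext) (simp add: pullback_def B_def)
  moreover note metric inclusion_transition[OF i]
  ultimately show "covariant_2_tensor n (V i) (B i)" "symmetric_tensor n (V i) (B i)"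
    "positive_definite_tensor n (V i) (B i)"
    unfolding riemannian_metric_def by (metis dom_pmap)+
qed

text \<open>Placed between the summands i and j, the map f is one of the generators of the
  pseudogroup. Invariance of \<eta> is evaluated on it at the class of the inclusion of
  \<open>A\<close>.\<close>

lemma B_transition:
  assumes i: "i \<in> I" and j: "j \<in> I"
    and tr: "transition (charts_V n \<Gamma> \<psi> i) (charts_V n \<Gamma> \<psi> j) (pmap A f)"
    and A: "openin (Euclidean_space n) A" "A \<subseteq> V i"
    and f: "C_inf n A n f" "f ` A \<subseteq> V j" "\<And>x. x \<in> A \<Longrightarrow> \<phi> j (f x) = \<phi> i x"
    and y: "y \<in> A" and a: "a \<in> Rn n" and b: "b \<in> Rn n"
  shows "B j (f y) (jacobian n f y a) (jacobian n f y b) = B i y a b"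
proof -
  define F where "F = summand_map i j (pmap A f)"
  have F: "F (k, x) = (if k = i \<and> x \<in> A then Some (j, f x) else None)" for k x
    by (simp add: F_def summand_map_def pmap_def)
  have domF: "dom F = Pair i ` A"
    by (auto simp: dom_def F split: if_splits)
  \<comment> \<open>The condition on generators is phrased with orbit maps; it follows from
    compatibility with the \<open>\<phi>\<close>, since \<open>\<psi> j\<close> sends
    \<open>\<phi> j (f x)\<close> to the orbit of \<open>f x\<close>.\<close>
  have "map_option (orbit_map (\<Gamma> j)) \<circ> pmap A f \<subseteq>\<^sub>m \<psi> j \<circ>\<^sub>m \<phi> i"
    unfolding map_le_def
  proof
    fix x assume "x \<in> dom (map_option (orbit_map (\<Gamma> j)) \<circ> pmap A f)"
    then have x: "x \<in> A"
      by simp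
    then obtain c where c: "\<phi> j (f x) = Some c"
      using f(2) by blast
    then have "\<psi> j c = Some (orbit_map (\<Gamma> j) (f x))"
      using orbifold_param_eq_Some[OF space charts[OF j]] by (simp add: charts_phi_def)
    then show "(map_option (orbit_map (\<Gamma> j)) \<circ> pmap A f) x = (\<psi> j \<circ>\<^sub>m \<phi> i) x"
      using c f(3)[OF x] x by (simp add: map_comp_def pmap_apply)
  qed
  then have "F \<in> {summand_map i j f | i j f. i \<in> I \<and> j \<in> I \<and>
      transition (charts_V n \<Gamma> \<psi> i) (charts_V n \<Gamma> \<psi> j) f \<and>
      map_option (orbit_map (\<Gamma> j)) \<circ> f \<subseteq>\<^sub>m \<psi> j \<circ>\<^sub>m \<phi> i}"
    using i j tr unfolding F_def by blast
  then have FP: "F \<in> charts_pseudogroup n \<Gamma> \<psi> I"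
    unfolding charts_pseudogroup_def by (rule hull_inc)
  have AM: "pmap A (Pair i) \<in> plots M n" and Af: "pmap A (\<lambda>x. (j, f x)) \<in> plots M n"
    using pair_plot_M[OF i A(1) C_inf_id[OF A(1)]] pair_plot_M[OF j A(1) f(1,2)] A(2) by simp_all
  have plotS: "pmap A (Pair i) \<in> plots (subspace M (dom F)) n"
    using AM by (simp add: plots_subspace domF)
  have sm_id: "smooth_map (subspace M (dom F)) M id"
    by (auto simp: smooth_map_def plots_subspace option.map_id0)
  have sm_F: "smooth_map (subspace M (dom F)) M (the \<circ> F)"
    unfolding smooth_map_def
  proof (intro conjI allI ballI)
    show "(the \<circ> F) ` points (subspace M (dom F)) \<subseteq> points M"
      using f(2) j by (auto simp: domF points_M F)
    fix m p assume "p \<in> plots (subspace M (dom F)) m"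
    then have p: "p \<in> plots M m" "ran p \<subseteq> Pair i ` A"
      by (simp_all add: plots_subspace domF)
    show "map_option (the \<circ> F) \<circ> p \<in> plots M m"
    proof (rule diffeological_spaceD(4)[OF M_space])
      show o: "openin (Euclidean_space m) (dom (map_option (the \<circ> F) \<circ> p))"
        using p(1) by (simp add: plots_M)
      fix u assume "u \<in> dom (map_option (the \<circ> F) \<circ> p)"
      then obtain k W l where W: "k \<in> I" "u \<in> W" "openin (Euclidean_space m) W" "C_inf m W n l" "l ` W \<subseteq> V k"
        "pmap W (\<lambda>x. (k, l x)) \<subseteq>\<^sub>m p"
        using plot_M_local[OF p(1), of u] by (metis dom_map_option_comp)
      have *: "p x = Some (k, l x)" if "x \<in> W" for x
        using W(6) that by (auto simp: map_le_def pmap_apply dest!: bspec[where x = x])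
      have **: "k = i" "l x \<in> A" if "x \<in> W" for x
        using *[OF that] p(2) by (auto simp: ran_def)
      have "pmap W (\<lambda>x. (j, f (l x))) \<in> plots M m"
      proof (rule pair_plot_M[OF j W(3)])
        show "C_inf m W n (\<lambda>x. f (l x))"
          by (rule C_inf_compose[OF W(3) A(1) _ f(1) W(4)]) (use ** in auto)
        show "(\<lambda>x. f (l x)) ` W \<subseteq> V j"
          using **(2) f(2) by blast
      qed
      moreover have "(map_option (the \<circ> F) \<circ> p) |` W = pmap W (\<lambda>x. (j, f (l x)))"
        using * ** by (intro ext) (auto simp: restrict_map_def pmap_def F)
      moreover have "W \<subseteq> dom (map_option (the \<circ> F) \<circ> p)"
        using * by auto
      ultimately show "\<exists>W. openin (Euclidean_space m) W \<and> u \<in> W \<and> W \<subseteq> dom (map_option (the \<circ> F) \<circ> p) \<and>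
          (map_option (the \<circ> F) \<circ> p) |` W \<in> plots M m"
        using W(2,3) by metis
    qed
  qed
  define c where "c = T2_class (subspace M (dom F)) ((n, pmap A (Pair i)), y, a, b)"
  have "c \<in> points (T2 (subspace M (dom F)))"
    unfolding points_T2 c_def
  proof (intro CollectI exI conjI)
    show "T2_class (subspace M (dom F)) ((n, pmap A (Pair i)), y, a, b) =
        T2_class (subspace M (dom F)) ((n, pmap A (Pair i)), y, a, b)"
      by (rule refl)
    show "y \<in> Rn n"
      using y openin_Euclidean_subset[OF A(1)] by blast
    show "y \<in> dom (pmap A (Pair i))"
      unfolding dom_pmap by (rule y)
  qed (use plotS a b in auto)
  then have "\<eta> (T2_map M (the \<circ> F) c) = \<eta> (T2_map M id c)"
    using invariant FP by (simp add: invariant_metric_def)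
  moreover have "T2_map M id c = T2_class M ((n, pmap A (\<lambda>x. (i, x))), y, a, b)"
    unfolding c_def T2_map_T2_class[OF sm_id] by (simp add: option.map_id0)
  moreover have "map_option (the \<circ> F) \<circ> pmap A (Pair i) = pmap A (\<lambda>x. (j, f x))"
    unfolding map_option_pmap by (auto simp: pmap_def F)
  then have "T2_map M (the \<circ> F) c = T2_class M ((n, pmap A (\<lambda>x. (j, f x))), y, a, b)"
    unfolding c_def T2_map_T2_class[OF sm_F] by simp
  moreover have "\<eta> (T2_class M ((n, pmap A (\<lambda>x. (i, x))), y, a, b)) = B i y a b"
    using eta_pair[OF i A(1) C_inf_id[OF A(1)] _ y a b] A(2) by (simp add: jacobian_id a b)
  ultimately show ?thesis
    using eta_pair[OF j A(1) f(1,2) y a b] by simp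
qed

subsection \<open>Local lifts of plots\<close>

text \<open>Here \<open>p\<close> may be any partial map into X. With \<open>p = \<phi> i\<close> a
  lift is a local change of charts, so plots and chart changes are treated alike; that
  \<open>W\<close> lies in the domain of \<open>p\<close> follows from the equation.\<close>

definition lift :: "'i \<Rightarrow> nat \<Rightarrow> vec set \<Rightarrow> (vec \<Rightarrow> vec) \<Rightarrow> (vec \<rightharpoonup> 'a) \<Rightarrow> bool" where
  "lift i m W l p \<longleftrightarrow> i \<in> I \<and> openin (Euclidean_space m) W \<and> C_inf m W n l \<and> l ` W \<subseteq> V i \<and>
     (\<forall>x\<in>W. \<phi> i (l x) = p x)"

lemma liftD:
  assumes "lift i m W l p"
  shows "i \<in> I" "openin (Euclidean_space m) W" "C_inf m W n l" "l ` W \<subseteq> V i"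
    "x \<in> W \<Longrightarrow> l x \<in> V i" "x \<in> W \<Longrightarrow> \<phi> i (l x) = p x" "W \<subseteq> dom p"
proof -
  show "i \<in> I" "openin (Euclidean_space m) W" "C_inf m W n l" and l: "l ` W \<subseteq> V i"
    "x \<in> W \<Longrightarrow> \<phi> i (l x) = p x"
    using assms by (auto simp: lift_def)
  then show "x \<in> W \<Longrightarrow> l x \<in> V i"
    by blast
  show "W \<subseteq> dom p"
  proof
    fix x assume "x \<in> W"
    then have "l x \<in> V i" "\<phi> i (l x) = p x"
      using assms by (auto simp: lift_def)
    then show "x \<in> dom p"
      by (simp add: domIff)
  qed
qed

lemma phi_eqD:
  assumes "i \<in> I" "x \<in> V i" "\<phi> i y = \<phi> i x"
  shows "\<exists>\<gamma>\<in>\<Gamma> i. y = \<gamma> x"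
  using orbifold_param_eqD[OF space charts[OF assms(1)]] assms(2,3) by (simp add: charts_phi_def)

lemma phi_group:
  assumes "i \<in> I" "\<gamma> \<in> \<Gamma> i" "x \<in> V i"
  shows "\<phi> i (\<gamma> x) = \<phi> i x"
  using orbifold_param_group[OF space charts[OF assms(1)]] assms(2,3) by (simp add: charts_phi_def)

lemma group_facts:
  assumes "i \<in> I"
  shows "finite (\<Gamma> i)" "subgroup (\<Gamma> i) (Diff (euclid n))"
  using charts[OF assms] by (auto simp: orbifold_chart_def)

lemma lift_exists_chart:
  assumes j: "j \<in> I" and p: "p \<in> plots X m" and r: "p r = Some a" "a \<in> dom (\<psi> j)"
  shows "\<exists>W l. r \<in> W \<and> lift j m W l p"
proof -
  obtain W l where W: "r \<in> W" "openin (Euclidean_space m) W" "W \<subseteq> dom p" "C_inf m W n l"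
    "\<And>x. x \<in> W \<Longrightarrow> \<phi> j (l x) = p x"
    using chart_lift[OF space charts[OF j] p r] by (auto simp: charts_phi_def)
  have "l ` W \<subseteq> V j"
    using W(3,5) by (force simp: subset_iff domIff)
  then have "lift j m W l p"
    using W j by (simp add: lift_def)
  then show ?thesis
    using W(1) by blast
qed

lemma lift_exists:
  assumes p: "p \<in> plots X m" and r: "r \<in> dom p"
  obtains i W l where "r \<in> W" "lift i m W l p"
proof -
  obtain a where a: "p r = Some a"
    using r by blast
  then have "a \<in> points X"
    using diffeological_spaceD(2)[OF space p] by (auto simp: ran_def)
  then obtain i where "i \<in> I" "a \<in> dom (\<psi> i)"
    unfolding cover by (elim UN_E)
  from lift_exists_chart[OF this(1) p a this(2)] show thesis
    by (elim exE conjE that)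
qed

lemma lift_compose:
  assumes l: "lift i k W l q" and U: "openin (Euclidean_space m) U" and f: "C_inf m U k f" "f ` U \<subseteq> W"
    and eq: "\<And>x. x \<in> U \<Longrightarrow> q (f x) = p x"
  shows "lift i m U (\<lambda>x. l (f x)) p"
proof -
  have "C_inf m U n (\<lambda>x. l (f x))"
    by (rule C_inf_compose[OF U liftD(2)[OF l] f(2) liftD(3)[OF l] f(1)])
  then show ?thesis
    using l U f(2) eq by (auto simp: lift_def image_subset_iff)
qed

lemma lift_restrict:
  assumes l: "lift i m W l p" and U: "openin (Euclidean_space m) U" "U \<subseteq> W"
  shows "lift i m U l p"
  using lift_compose[OF l U(1) C_inf_id[OF U(1)]] U(2) by simp

section \<open>The tensor attached to a lift and its independence of the lift\<close>

lemma lift_value_smooth: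
  assumes l: "lift i m W l p"
  shows "covariant_2_tensor m W (\<lambda>r v w. B i (l r) (jacobian m l r v) (jacobian m l r w))"
  by (rule covariant_2_tensor_pullback[OF V_open B_tensor(1) liftD(2) liftD(3,4)[OF l]])
    (use liftD(1,2)[OF l] l in auto)

lemma lift_value_continuous:
  assumes l: "lift i m W l p"
  shows "continuous_on W (\<lambda>r. B i (l r) (jacobian m l r v) (jacobian m l r w))"
proof (rule C_inf_fun_continuous[OF liftD(2)[OF l]])
  note i = liftD(1)[OF l] and W = liftD(2)[OF l]
  show "C_inf_fun m W (\<lambda>r. B i (l r) (jacobian m l r v) (jacobian m l r w))"
    by (rule covariant_2_tensor_smooth[OF V_open[OF i] B_tensor(1)[OF i] W liftD(3,4)[OF l]
        C_inf_jacobian[OF W liftD(3)[OF l]] C_inf_jacobian[OF W liftD(3)[OF l]]])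
qed

text \<open>By continuity it suffices to find, in every nonempty open subset \<open>Q\<close> of the domain of \<open>f\<close>, a
  point near which \<open>f\<close> is a transition. If \<open>g\<close> is a lift in the other direction, then \<open>g \<circ> f\<close>
  coincides with some \<open>\<gamma> \<in> \<Gamma> i\<close> on a nonempty open \<open>O' \<subseteq> Q\<close>, so with \<open>\<gamma>' = \<gamma>\<close>$^{-1}$ the map
  \<open>h = \<gamma>' \<circ> g\<close> is a smooth left inverse of \<open>f\<close> there. Likewise \<open>f \<circ> h\<close> coincides with some
  \<open>\<delta> \<in> \<Gamma> j\<close> on a nonempty open \<open>P\<close>; since \<open>f \<circ> h\<close> is idempotent, it is the identity on the open
  set \<open>C = \<delta> ` P\<close>, where \<open>h\<close> is therefore a smooth inverse of \<open>f\<close>. No inverse function theorem is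
  needed.\<close>

lemma lift_transition_isometry:
  assumes f: "lift j n W f (\<phi> i)" and i: "i \<in> I" and x: "x \<in> W" and a: "a \<in> Rn n" and b: "b \<in> Rn n"
  shows "B j (f x) (jacobian n f x a) (jacobian n f x b) = B i x a b"
proof -
  note j = liftD(1)[OF f] and W = liftD(2)[OF f] and fs = liftD(3)[OF f] and fV = liftD(4)[OF f]
  have fphi: "\<phi> j (f x) = \<phi> i x" if "x \<in> W" for x
    using liftD(6)[OF f that] .
  have WV: "W \<subseteq> V i"
    using liftD(7)[OF f] .
  define S where "S = {x \<in> W. B j (f x) (jacobian n f x a) (jacobian n f x b) = B i x a b}"
  have "C_inf_fun n W (\<lambda>x. B i x a b)"
    by (rule covariant_2_tensor_smooth[OF V_open[OF i] B_tensor(1)[OF i] W C_inf_id[OF W]])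
      (use WV C_inf_const[OF W] a b in auto)
  then have "closedin (top_of_set W) S"
    unfolding S_def by (intro closedin_coincidence_set lift_value_continuous[OF f] C_inf_fun_continuous[OF W])
  moreover have "Q \<inter> S \<noteq> {}" if Q: "Q \<noteq> {}" "openin (Euclidean_space n) Q" "Q \<subseteq> W" for Q
  proof -
    obtain x0 where x0: "x0 \<in> Q"
      using Q(1) by blast
    then have "x0 \<in> W"
      using Q(3) by blast
    then obtain c where c: "\<phi> i x0 = Some c"
      using WV by blast
    then have "c \<in> dom (\<psi> i)"
      using orbifold_param_mem[OF space charts[OF i]] by (simp add: charts_phi_def)
    moreover have "\<phi> j (f x0) = Some c"
      using fphi[OF \<open>x0 \<in> W\<close>] c by simp
    \<comment> \<open>The common value \<open>c\<close> lies in the domain of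
      \<open>\<psi> i\<close>, so the plot \<open>\<phi> j\<close> lifts through chart i near
      \<open>f x0\<close>.\<close>
    ultimately obtain W' g where W': "f x0 \<in> W'" and g: "lift i n W' g (\<phi> j)"
      using lift_exists_chart[OF i phi_plot[OF j]] by blast
    note W'o = liftD(2)[OF g] and gs = liftD(3)[OF g] and gV = liftD(4)[OF g]
    have gphi: "\<phi> i (g y) = \<phi> j y" if "y \<in> W'" for y
      using liftD(6)[OF g that] .
    have W'V: "W' \<subseteq> V j"
      using liftD(7)[OF g] .
    have Qo: "openin (Euclidean_space n) Q" and fsQ: "C_inf n Q n f"
      using Q(2) C_inf_subset[OF fs Q(3) openin_Euclidean_subset[OF W]] by auto
    define O1 where "O1 = {x \<in> Q. f x \<in> W'}"
    have O1: "openin (Euclidean_space n) O1" "x0 \<in> O1" "O1 \<subseteq> Q"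
      unfolding O1_def using openin_C_inf_preimage[OF Qo fsQ W'o] x0 W' by auto
    have fsO1: "C_inf n O1 n f"
      by (rule C_inf_subset[OF fsQ O1(3) openin_Euclidean_subset[OF Qo]])
    have gfs: "C_inf n O1 n (\<lambda>x. g (f x))"
      by (rule C_inf_compose[OF O1(1) W'o _ gs fsO1]) (auto simp: O1_def)
    have contG: "continuous_on U \<gamma>" if "k \<in> I" "\<gamma> \<in> \<Gamma> k" "openin (Euclidean_space n) U" for k \<gamma> U
      using C_inf_continuous[OF that(3)] C_inf_subset[OF group_smooth[OF group_facts[OF that(1)] that(2)]]
        openin_Euclidean_subset[OF that(3)] by blast
    have "\<exists>\<gamma>\<in>\<Gamma> i. g (f x) = \<gamma> x" if "x \<in> O1" for x
    proof (rule phi_eqD[OF i])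
      show "x \<in> V i"
        using that O1(3) Q(3) WV by blast
      show "\<phi> i (g (f x)) = \<phi> i x"
        using that gphi fphi Q(3) by (auto simp: O1_def)
    qed
    then have "\<exists>\<gamma>\<in>\<Gamma> i. \<exists>Q. Q \<noteq> {} \<and> openin (Euclidean_space n) Q \<and> Q \<subseteq> O1 \<and> (\<forall>x\<in>Q. g (f x) = \<gamma> x)"
      using O1(2) contG[OF i _ O1(1)]
      by (intro finite_cover_open_subset[where b = "\<lambda>\<gamma>. \<gamma>", OF group_facts(1)[OF i] O1(1) _ O1(1) subset_refl
            C_inf_continuous[OF O1(1) gfs]]) auto
    then obtain \<gamma> O' where \<gamma>: "\<gamma> \<in> \<Gamma> i" and O': "O' \<noteq> {}" "openin (Euclidean_space n) O'" "O' \<subseteq> O1"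
      and O'_eq: "\<forall>x\<in>O'. g (f x) = \<gamma> x"
      by (elim bexE exE conjE)
    obtain \<gamma>' where \<gamma>': "\<gamma>' \<in> \<Gamma> i" "\<forall>x\<in>Rn n. \<gamma>' (\<gamma> x) = x \<and> \<gamma> (\<gamma>' x) = x"
      using group_inverse[OF group_facts[OF i] \<gamma>] by blast
    define h where "h y = \<gamma>' (g y)" for y
    have O'R: "O' \<subseteq> Rn n"
      by (rule openin_Euclidean_subset[OF O'(2)])
    have hs: "C_inf n W' n h"
      unfolding h_def
      by (rule C_inf_compose[OF W'o openin_topspace C_infD(1)[OF gs] group_smooth[OF group_facts[OF i] \<gamma>'(1)] gs])
    have hf: "h (f x) = x" if "x \<in> O'" for x
      unfolding h_def O'_eq[rule_format, OF that] using that O'R \<gamma>'(2) by blast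
    have O'W: "O' \<subseteq> W" and fO': "f x \<in> W'" if "x \<in> O'" for x
      using O'(3) O1(3) Q(3) that by (auto simp: O1_def)
    define P0 where "P0 = {y \<in> W'. h y \<in> O'}"
    have P0: "openin (Euclidean_space n) P0"
      unfolding P0_def by (rule openin_C_inf_preimage[OF W'o hs O'(2)])
    have "P0 \<noteq> {}"
      using O'(1) fO' hf unfolding P0_def by fastforce
    have "\<exists>\<delta>\<in>\<Gamma> j. f (h y) = \<delta> y" if "y \<in> P0" for y
    proof (rule phi_eqD[OF j])
      have y: "y \<in> W'" "h y \<in> O'"
        using that by (auto simp: P0_def)
      show "y \<in> V j"
        using y W'V by blast
      have "\<phi> j (f (h y)) = \<phi> i (h y)"
        using y O'W fphi by blast
      also have "\<dots> = \<phi> i (g y)"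
        unfolding h_def using phi_group[OF i \<gamma>'(1)] y gV by blast
      also have "\<dots> = \<phi> j y"
        by (rule gphi[OF y(1)])
      finally show "\<phi> j (f (h y)) = \<phi> j y" .
    qed
    moreover have "continuous_on P0 (\<lambda>y. f (h y))"
    proof (rule C_inf_continuous[OF P0 C_inf_compose[OF P0 W _ fs]])
      show "h ` P0 \<subseteq> W"
        using O'W by (auto simp: P0_def)
      show "C_inf n P0 n h"
        by (rule C_inf_subset[OF hs _ openin_Euclidean_subset[OF W'o]]) (auto simp: P0_def)
    qed
    ultimately have "\<exists>\<delta>\<in>\<Gamma> j. \<exists>Q. Q \<noteq> {} \<and> openin (Euclidean_space n) Q \<and> Q \<subseteq> P0 \<and> (\<forall>y\<in>Q. f (h y) = \<delta> y)"
      using contG[OF j _ P0]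
      by (intro finite_cover_open_subset[where b = "\<lambda>\<gamma>. \<gamma>" and a = "\<lambda>y. f (h y)", OF group_facts(1)[OF j] P0 \<open>P0 \<noteq> {}\<close> P0 subset_refl]) auto
    then obtain \<delta> P where \<delta>: "\<delta> \<in> \<Gamma> j" and P: "P \<noteq> {}" "openin (Euclidean_space n) P" "P \<subseteq> P0"
      and P_eq: "\<forall>y\<in>P. f (h y) = \<delta> y"
      by (elim bexE exE conjE)
    obtain \<delta>' where \<delta>'_mem: "\<delta>' \<in> \<Gamma> j" and "\<forall>x\<in>Rn n. \<delta>' (\<delta> x) = x \<and> \<delta> (\<delta>' x) = x"
      using group_inverse[OF group_facts[OF j] \<delta>] by blast
    then have \<delta>': "\<delta>' \<in> \<Gamma> j" "\<And>x. x \<in> Rn n \<Longrightarrow> \<delta>' (\<delta> x) = x" "\<And>x. x \<in> Rn n \<Longrightarrow> \<delta> (\<delta>' x) = x"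
      by auto
    define C where "C = {z \<in> Rn n. \<delta>' z \<in> P}"
    have C: "openin (Euclidean_space n) C"
      unfolding C_def
      by (rule openin_C_inf_preimage[OF openin_topspace group_smooth[OF group_facts[OF j] \<delta>'(1)] P(2)])
    have C': "z \<in> W' \<and> h z \<in> O' \<and> f (h z) = z" if "z \<in> C" for z
    proof -
      have y: "\<delta>' z \<in> P" "\<delta>' z \<in> P0"
        using that P(3) by (auto simp: C_def)
      have z: "z = f (h (\<delta>' z))"
        using P_eq[rule_format, OF y(1)] \<delta>'(3) that by (simp add: C_def)
      have m: "h (\<delta>' z) \<in> O'"
        using y(2) by (simp add: P0_def)
      then have "z \<in> W'" "h z = h (\<delta>' z)"
        using fO' hf z by metis+
      then show ?thesis
        using m z by simp
    qed
    define A where "A = {x \<in> O'. f x \<in> C}"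
    have fsO': "C_inf n O' n f"
      by (rule C_inf_subset[OF fsO1 O'(3) openin_Euclidean_subset[OF O1(1)]])
    have A: "openin (Euclidean_space n) A"
      unfolding A_def by (rule openin_C_inf_preimage[OF O'(2) fsO' C])
    have AV: "A \<subseteq> V i" "A \<subseteq> W" "A \<subseteq> Q"
      using O'W WV O'(3) O1(3) unfolding A_def by blast+
    have fsA: "C_inf n A n f"
      by (rule C_inf_subset[OF fs AV(2) openin_Euclidean_subset[OF W]])
    have tr: "transition (charts_V n \<Gamma> \<psi> i) (charts_V n \<Gamma> \<psi> j) (pmap A f)"
      unfolding charts_V_eq
    proof (rule transition_pmap[OF A AV(1) C _ fsA])
      show "C \<subseteq> V j"
        using C' W'V by blast
      show "f ` A \<subseteq> C"
        by (auto simp: A_def)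
      show "C_inf n C n h"
        by (rule C_inf_subset[OF hs _ openin_Euclidean_subset[OF W'o]]) (use C' in auto)
      show "h ` C \<subseteq> A"
        using C' by (auto simp: A_def)
    qed (use C' hf in \<open>auto simp: A_def\<close>)
    \<comment> \<open>The set \<open>A\<close> is nonempty: it contains the image under
      \<open>h\<close> of the point \<open>\<delta> y\<close> of \<open>C\<close>.\<close>
    obtain y where y: "y \<in> P"
      using P(1) by blast
    have "\<delta> y \<in> C"
      using y \<delta>'(2) group_maps[OF group_facts[OF j] \<delta>] openin_Euclidean_subset[OF P(2)] by (auto simp: C_def)
    then have xA: "h (\<delta> y) \<in> A"
      using C' by (simp add: A_def)
    have "B j (f (h (\<delta> y))) (jacobian n f (h (\<delta> y)) a) (jacobian n f (h (\<delta> y)) b) = B i (h (\<delta> y)) a b"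
      by (rule B_transition[OF i j tr A AV(1) fsA _ _ xA a b]) (use AV(2) fV fphi in blast)+
    then have "h (\<delta> y) \<in> Q \<inter> S"
      using xA AV by (auto simp: S_def)
    then show ?thesis
      by blast
  qed
  ultimately have "W \<subseteq> S"
    by (rule dense_closed_eq[OF W])
  then show ?thesis
    using x by (auto simp: S_def)
qed

lemma lift_compose_value:
  assumes l: "lift i k W l q" and U: "openin (Euclidean_space m) U" and f: "C_inf m U k f" "f ` U \<subseteq> W"
    and r: "r \<in> U"
  shows "B i (l (f r)) (jacobian m (\<lambda>x. l (f x)) r v) (jacobian m (\<lambda>x. l (f x)) r w) =
     B i (l (f r)) (jacobian k l (f r) (jacobian m f r v)) (jacobian k l (f r) (jacobian m f r w))"
  using jacobian_compose[OF U liftD(2)[OF l] f(2) liftD(3)[OF l] f(1) r] by simp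

lemma jacobian_lift_in_Rn:
  assumes "lift i m W l p" "r \<in> W"
  shows "jacobian m l r v \<in> Rn n"
  using jacobian_in_Rn[OF liftD(2)[OF assms(1)] assms(2) C_infD(1)[OF liftD(3)[OF assms(1)]]] .

text \<open>On a dense open set, two lifts through the same chart differ locally by an element of the group,
  and group elements are themselves lifts of \<open>\<phi> j\<close>, hence isometries.\<close>

lemma lift_value_unique_same_chart:
  assumes l: "lift j m W l p" and l': "lift j m W l' p" and r: "r \<in> W"
  shows "B j (l' r) (jacobian m l' r v) (jacobian m l' r w) = B j (l r) (jacobian m l r v) (jacobian m l r w)"
proof -
  note j = liftD(1)[OF l] and W = liftD(2)[OF l]
  define S where "S = {r \<in> W. B j (l' r) (jacobian m l' r v) (jacobian m l' r w) =
      B j (l r) (jacobian m l r v) (jacobian m l r w)}"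
  have "closedin (top_of_set W) S"
    unfolding S_def by (intro closedin_coincidence_set lift_value_continuous[OF l] lift_value_continuous[OF l'])
  moreover have "Q \<inter> S \<noteq> {}" if Q: "Q \<noteq> {}" "openin (Euclidean_space m) Q" "Q \<subseteq> W" for Q
  proof -
    have "\<exists>\<gamma>\<in>\<Gamma> j. l' x = \<gamma> (l x)" if "x \<in> Q" for x
    proof -
      have "x \<in> W"
        using that Q(3) by blast
      then show ?thesis
        using phi_eqD[OF j liftD(5)[OF l]] liftD(6)[OF l] liftD(6)[OF l'] by simp
    qed
    moreover have "continuous_on W (\<lambda>x. \<gamma> (l x))" if "\<gamma> \<in> \<Gamma> j" for \<gamma>
      by (rule C_inf_continuous[OF W C_inf_compose[OF W openin_topspace C_infD(1)[OF liftD(3)[OF l]]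
              group_smooth[OF group_facts[OF j] that] liftD(3)[OF l]]])
    ultimately have "\<exists>\<gamma>\<in>\<Gamma> j. \<exists>Q'. Q' \<noteq> {} \<and> openin (Euclidean_space m) Q' \<and> Q' \<subseteq> Q \<and> (\<forall>x\<in>Q'. l' x = \<gamma> (l x))"
      by (intro finite_cover_open_subset[where b = "\<lambda>\<gamma> x. \<gamma> (l x)", OF group_facts(1)[OF j] W Q
            C_inf_continuous[OF W liftD(3)[OF l']]]) auto
    then obtain \<gamma> Q' where \<gamma>: "\<gamma> \<in> \<Gamma> j" and Q': "Q' \<noteq> {}" "openin (Euclidean_space m) Q'" "Q' \<subseteq> Q"
      and Q'_eq: "\<And>x. x \<in> Q' \<Longrightarrow> l' x = \<gamma> (l x)"
      by (elim bexE exE conjE) simp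
    obtain x where x: "x \<in> Q'"
      using Q'(1) by blast
    have xW: "x \<in> W"
      using x Q'(3) Q(3) by blast
    have \<gamma>l: "lift j n (V j) \<gamma> (\<phi> j)"
      unfolding lift_def
    proof (intro conjI ballI)
      show "C_inf n (V j) n \<gamma>"
        by (rule C_inf_subset[OF group_smooth[OF group_facts[OF j] \<gamma>] V_subset[OF j]]) simp
      show "\<phi> j (\<gamma> x) = \<phi> j x" if "x \<in> V j" for x
        by (rule phi_group[OF j \<gamma> that])
      then show "\<gamma> ` V j \<subseteq> V j"
        by (auto simp: domIff)
    qed (use j V_open in auto)
    have "Q' \<subseteq> W"
      using Q'(3) Q(3) by blast
    then have lQ': "C_inf m Q' n l" "l ` Q' \<subseteq> V j"
      using C_inf_subset[OF liftD(3)[OF l] _ openin_Euclidean_subset[OF W]] liftD(4)[OF l] by blast+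
    have "jacobian m l' x = jacobian m (\<lambda>x. \<gamma> (l x)) x"
      by (rule ext) (rule jacobian_cong[OF Q'(2) x Q'_eq])
    then have "B j (l' x) (jacobian m l' x v) (jacobian m l' x w) =
        B j (\<gamma> (l x)) (jacobian n \<gamma> (l x) (jacobian m l x v)) (jacobian n \<gamma> (l x) (jacobian m l x w))"
      using lift_compose_value[OF \<gamma>l Q'(2) lQ' x] Q'_eq[OF x] by simp
    also have "\<dots> = B j (l x) (jacobian m l x v) (jacobian m l x w)"
      using lift_transition_isometry[OF \<gamma>l j] liftD(5)[OF l xW] jacobian_lift_in_Rn[OF l xW] by blast
    finally have "x \<in> S"
      using xW by (simp add: S_def)
    then show ?thesis
      using x Q'(3) by blast
  qed
  ultimately have "W \<subseteq> S"
    by (rule dense_closed_eq[OF W])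
  then show ?thesis
    using r by (auto simp: S_def)
qed

text \<open>Near \<open>l r\<close> the plot \<open>\<phi> i\<close> has a lift f through chart j.
  Then f after \<open>l\<close> and \<open>l'\<close> are lifts through the same chart, and f
  preserves the metric.\<close>

lemma lift_value_unique:
  assumes l: "lift i m W l p" and l': "lift j m W' l' p" and r: "r \<in> W" "r \<in> W'"
  shows "B i (l r) (jacobian m l r v) (jacobian m l r w) = B j (l' r) (jacobian m l' r v) (jacobian m l' r w)"
proof -
  note i = liftD(1)[OF l] and j = liftD(1)[OF l']
  obtain c where c: "p r = Some c"
    using liftD(7)[OF l] r(1) by blast
  have "\<phi> j (l' r) = Some c" "\<phi> i (l r) = Some c"
    using liftD(6)[OF l' r(2)] liftD(6)[OF l r(1)] c by auto
  moreover from this(1) have "c \<in> dom (\<psi> j)"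
    using orbifold_param_mem[OF space charts[OF j]] by (simp add: charts_phi_def)
  ultimately obtain W1 f where W1: "l r \<in> W1" and f: "lift j n W1 f (\<phi> i)"
    using lift_exists_chart[OF j phi_plot[OF i]] by blast
  \<comment> \<open>Here both f after \<open>l\<close> and \<open>l'\<close> are defined.\<close>
  define W2 where "W2 = {x \<in> W. l x \<in> W1} \<inter> W'"
  have W2: "openin (Euclidean_space m) W2" "r \<in> W2" "W2 \<subseteq> W" "W2 \<subseteq> W'" "l ` W2 \<subseteq> W1"
    unfolding W2_def
    using openin_Int[OF openin_C_inf_preimage[OF liftD(2,3)[OF l] liftD(2)[OF f]] liftD(2)[OF l']] r W1 by auto
  have lW2: "C_inf m W2 n l"
    by (rule C_inf_subset[OF liftD(3)[OF l] W2(3) openin_Euclidean_subset[OF liftD(2)[OF l]]])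
  have fl: "lift j m W2 (\<lambda>x. f (l x)) p"
    by (rule lift_compose[OF f W2(1) lW2 W2(5)]) (use W2(3) liftD(6)[OF l] in blast)
  have "B i (l r) (jacobian m l r v) (jacobian m l r w) =
      B j (f (l r)) (jacobian n f (l r) (jacobian m l r v)) (jacobian n f (l r) (jacobian m l r w))"
    using lift_transition_isometry[OF f i W1] jacobian_lift_in_Rn[OF l r(1)] by simp
  also have "\<dots> = B j (f (l r)) (jacobian m (\<lambda>x. f (l x)) r v) (jacobian m (\<lambda>x. f (l x)) r w)"
    using lift_compose_value[OF f W2(1) lW2 W2(5,2)] by simp
  also have "\<dots> = B j (l' r) (jacobian m l' r v) (jacobian m l' r w)"
    by (rule lift_value_unique_same_chart[OF lift_restrict[OF l' W2(1,4)] fl W2(2)])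
  finally show ?thesis .
qed


subsection \<open>The descended metric\<close>

text \<open>The local lift is chosen by \<open>SOME\<close>; \<open>lift_value_unique\<close> makes
  the value independent of it. For points in the domain of a plot a lift exists, because the charts
  cover X.\<close>

definition pre_metric :: "'a pre_T2 \<Rightarrow> real" where
  "pre_metric = (\<lambda>((m, p), r, v, w). SOME t. \<exists>i W l. r \<in> W \<and> lift i m W l p \<and>
     t = B i (l r) (jacobian m l r v) (jacobian m l r w))"

lemma pre_metric_eq:
  assumes "lift i m W l p" "r \<in> W"
  shows "pre_metric ((m, p), r, v, w) = B i (l r) (jacobian m l r v) (jacobian m l r w)"
  unfolding pre_metric_def prod.case
proof (rule some_equality)
  show "\<exists>i' W' l'. r \<in> W' \<and> lift i' m W' l' p \<and>
      B i (l r) (jacobian m l r v) (jacobian m l r w) = B i' (l' r) (jacobian m l' r v) (jacobian m l' r w)"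
    using assms by blast
  fix t assume "\<exists>i W l. r \<in> W \<and> lift i m W l p \<and> t = B i (l r) (jacobian m l r v) (jacobian m l r w)"
  then show "t = B i (l r) (jacobian m l r v) (jacobian m l r w)"
    using lift_value_unique[OF _ assms(1) _ assms(2)] by blast
qed

text \<open>A lift of \<open>q\<close> near \<open>f r\<close>, composed with f, is a lift of
  \<open>p\<close> near \<open>r\<close>; the chain rule then matches the two values.\<close>

lemma pre_metric_step:
  assumes "T2_step X a b"
  shows "pre_metric a = pre_metric b"
proof -
  obtain m p r v w k q r' v' w' where eq: "a = ((m, p), r, v, w)" "b = ((k, q), r', v', w')"
    by (metis prod.exhaust)
  from assms obtain f where p: "p \<in> plots X m" and q: "q \<in> plots X k" and r: "r \<in> dom p"
    and f: "C_inf m (dom p) k f" "f ` dom p \<subseteq> dom q" "\<And>x. x \<in> dom p \<Longrightarrow> q (f x) = p x"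
    and r': "r' = f r" "v' = jacobian m f r v" "w' = jacobian m f r w"
    unfolding eq T2_step_def by auto
  have "f r \<in> dom q"
    using r f(2) by blast
  then obtain i W l where W: "f r \<in> W" and l: "lift i k W l q"
    by (rule lift_exists[OF q])
  have U: "openin (Euclidean_space m) {x \<in> dom p. f x \<in> W}" (is "openin _ ?U")
    by (rule openin_C_inf_preimage[OF diffeological_spaceD(1)[OF space p] f(1) liftD(2)[OF l]])
  have fU: "C_inf m ?U k f" "f ` ?U \<subseteq> W"
    using C_inf_subset[OF f(1) _ openin_Euclidean_subset[OF diffeological_spaceD(1)[OF space p]]] by auto
  have rU: "r \<in> ?U"
    using r W by blast
  have "pre_metric a = B i (l (f r)) (jacobian m (\<lambda>x. l (f x)) r v) (jacobian m (\<lambda>x. l (f x)) r w)"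
    unfolding eq by (rule pre_metric_eq[OF lift_compose[OF l U fU] rU]) (use f(3) in blast)
  also have "\<dots> = B i (l (f r)) (jacobian k l (f r) (jacobian m f r v)) (jacobian k l (f r) (jacobian m f r w))"
    by (rule lift_compose_value[OF l U fU rU])
  also have "\<dots> = pre_metric b"
    unfolding eq r' by (rule pre_metric_eq[OF l W, symmetric])
  finally show ?thesis .
qed

definition metric_on_orbifold :: "'a pre_T2 set \<Rightarrow> real" where
  "metric_on_orbifold = descend pre_metric"

lemma metric_on_orbifold_class: "metric_on_orbifold (T2_class X a) = pre_metric a"
proof -
  have "pre_metric b = pre_metric a" if "equivclp (T2_step X) a b" for b
    using that by (induction rule: equivclp_induct) (use pre_metric_step in auto)
  moreover have "a \<in> T2_class X a"
    by (simp add: T2_class_def)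
  ultimately have "pre_metric ` T2_class X a = {pre_metric a}"
    unfolding T2_class_def by blast
  then show ?thesis
    by (simp add: metric_on_orbifold_def descend_def)
qed

lemma pullback_metric_eq:
  assumes "lift i m W l p" "r \<in> W"
  shows "pullback X metric_on_orbifold m p r v w = B i (l r) (jacobian m l r v) (jacobian m l r w)"
  unfolding pullback_def metric_on_orbifold_class by (rule pre_metric_eq[OF assms])


subsection \<open>The descended function is a weak Riemannian metric\<close>

lemma metric_covariant:
  assumes p: "p \<in> plots X m"
  shows "covariant_2_tensor m (dom p) (pullback X metric_on_orbifold m p)"
proof (rule covariant_2_tensor_local[OF diffeological_spaceD(1)[OF space p]])
  fix r assume "r \<in> dom p"
  then obtain i W l where W: "r \<in> W" and l: "lift i m W l p"
    by (rule lift_exists[OF p])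
  have "covariant_2_tensor m W (pullback X metric_on_orbifold m p)"
    by (rule covariant_2_tensor_cong[OF liftD(2)[OF l] lift_value_smooth[OF l]]) (simp add: pullback_metric_eq[OF l])
  then show "\<exists>W. r \<in> W \<and> openin (Euclidean_space m) W \<and> covariant_2_tensor m W (pullback X metric_on_orbifold m p)"
    using W liftD(2)[OF l] by blast
qed

lemma metric_symmetric:
  assumes p: "p \<in> plots X m"
  shows "symmetric_tensor m (dom p) (pullback X metric_on_orbifold m p)"
  unfolding symmetric_tensor_def
proof (intro ballI)
  fix r v w assume "r \<in> dom p"
  then obtain i W l where W: "r \<in> W" and l: "lift i m W l p"
    by (rule lift_exists[OF p])
  have "B i (l r) (jacobian m l r v) (jacobian m l r w) = B i (l r) (jacobian m l r w) (jacobian m l r v)"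
    using B_tensor(2)[OF liftD(1)[OF l]] liftD(5)[OF l W] jacobian_lift_in_Rn[OF l W]
    unfolding symmetric_tensor_def by blast
  then show "pullback X metric_on_orbifold m p r v w = pullback X metric_on_orbifold m p r w v"
    by (simp add: pullback_metric_eq[OF l W])
qed

text \<open>Definiteness concerns nonzero vectors, but the derivative of a lift of an arbitrary plot
  may kill a vector. At zero, linearity gives the value 0.\<close>

lemma B_positive:
  assumes i: "i \<in> I" and y: "y \<in> V i" and a: "a \<in> Rn n"
  shows "B i y a a \<ge> 0"
proof (cases "a = (\<lambda>_. 0)")
  case True
  have "B i y (\<lambda>k. 0 * a k + 0 * a k) a = 0 * B i y a a + 0 * B i y a a"
    using B_tensor(1)[OF i] y a unfolding covariant_2_tensor_def by blast
  then show ?thesis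
    using True by simp
next
  case False
  then show ?thesis
    using B_tensor(3)[OF i] y a unfolding positive_definite_tensor_def by (simp add: less_imp_le)
qed

lemma metric_positive:
  assumes p: "p \<in> plots X m"
  shows "positive_tensor m (dom p) (pullback X metric_on_orbifold m p)"
  unfolding positive_tensor_def
proof (intro ballI)
  fix r v assume "r \<in> dom p"
  then obtain i W l where W: "r \<in> W" and l: "lift i m W l p"
    by (rule lift_exists[OF p])
  show "pullback X metric_on_orbifold m p r v v \<ge> 0"
    unfolding pullback_metric_eq[OF l W]
    by (rule B_positive[OF liftD(1)[OF l] liftD(5)[OF l W] jacobian_lift_in_Rn[OF l W]])
qed

text \<open>A plot of T_2 X lifts locally to the coproduct, and there locally to a single summand.
  So the plot \<open>p\<close> is fixed while the base point and the two vectors vary smoothly, and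
  smoothness is that of the tensor pulled back along \<open>p\<close>.\<close>

lemma metric_smooth: "smooth_map (T2 X) real_line metric_on_orbifold"
  unfolding smooth_map_def
proof (intro conjI allI ballI)
  show "metric_on_orbifold ` points (T2 X) \<subseteq> points real_line"
    by (simp add: real_line_def)
  fix m P assume P: "P \<in> plots (T2 X) m"
  have o: "openin (Euclidean_space m) (dom P)"
    using P by (simp add: T2_def plots_quotient)
  have "C_inf_fun m (dom P) (the \<circ> (map_option metric_on_orbifold \<circ> P))"
  proof (rule C_inf_fun_local[OF o])
    fix u assume "u \<in> dom P"
    then obtain l where l: "l \<in> plots (pre_T2 X) m" "u \<in> dom l" "map_option (T2_class X) \<circ> l \<subseteq>\<^sub>m P"
      using P unfolding T2_def plots_quotient by blast
    obtain kp l' where kp: "kp \<in> {(m, p). p \<in> plots X m}"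
      and l': "l' \<in> plots ((\<lambda>(m, p). prod_space (subspace (euclid m) (dom p)) (prod_space (euclid m) (euclid m))) kp) m"
      "u \<in> dom l'" "map_option (Pair kp) \<circ> l' \<subseteq>\<^sub>m l"
      using l(1,2) unfolding pre_T2_def plots_coproduct by blast
    obtain k p where kp_eq: "kp = (k, p)"
      by (cases kp)
    have p: "p \<in> plots X k"
      using kp by (simp add: kp_eq)
    define R where "R x = fst (the (l' x))" for x
    define v where "v x = fst (snd (the (l' x)))" for x
    define w where "w x = snd (snd (the (l' x)))" for x
    have "map_option fst \<circ> l' \<in> plots (subspace (euclid k) (dom p)) m"
      "map_option fst \<circ> (map_option snd \<circ> l') \<in> plots (euclid k) m"
      "map_option snd \<circ> (map_option snd \<circ> l') \<in> plots (euclid k) m"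
      using l'(1) by (simp_all add: kp_eq prod_space_def)
    moreover have "map_option fst \<circ> l' = pmap (dom l') R"
      "map_option fst \<circ> (map_option snd \<circ> l') = pmap (dom l') v"
      "map_option snd \<circ> (map_option snd \<circ> l') = pmap (dom l') w"
      unfolding map_option_eq_pmap[of _ l'] map_option_pmap R_def v_def w_def by (rule refl)+
    ultimately have pl: "pmap (dom l') R \<in> plots (subspace (euclid k) (dom p)) m"
      "pmap (dom l') v \<in> plots (euclid k) m" "pmap (dom l') w \<in> plots (euclid k) m"
      by simp_all
    have W: "openin (Euclidean_space m) (dom l')"
      using pl(2) by (simp add: plots_euclid)
    have Rvw: "C_inf m (dom l') k R" "R ` dom l' \<subseteq> dom p" "C_inf m (dom l') k v" "C_inf m (dom l') k w"
      using pl pmap_plot_euclid[OF W] by (simp_all add: plots_subspace)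
    have smooth: "C_inf_fun m (dom l') (\<lambda>x. pullback X metric_on_orbifold k p (R x) (v x) (w x))"
      by (rule covariant_2_tensor_smooth[OF diffeological_spaceD(1)[OF space p] metric_covariant[OF p] W Rvw])
    have val: "(the \<circ> (map_option metric_on_orbifold \<circ> P)) x = pullback X metric_on_orbifold k p (R x) (v x) (w x)"
      if x: "x \<in> dom l'" for x
    proof -
      have "(map_option (Pair kp) \<circ> l') x = Some ((k, p), R x, v x, w x)"
        using x by (auto simp: R_def v_def w_def kp_eq)
      then have "l x = Some ((k, p), R x, v x, w x)"
        using l'(3) x unfolding map_le_def by force
      then have "P x = Some (T2_class X ((k, p), R x, v x, w x))"
        using l(3) unfolding map_le_def by force
      then show ?thesis
        by (simp add: pullback_def)
    qed
    have "C_inf_fun m (dom l') (the \<circ> (map_option metric_on_orbifold \<circ> P))"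
      using C_inf_fun_cong[where f = "the \<circ> (map_option metric_on_orbifold \<circ> P)"
          and g = "\<lambda>x. pullback X metric_on_orbifold k p (R x) (v x) (w x)", OF W val] smooth by (rule iffD2)
    then show "\<exists>W. u \<in> W \<and> openin (Euclidean_space m) W \<and> C_inf_fun m W (the \<circ> (map_option metric_on_orbifold \<circ> P))"
      using W l'(2) by (intro exI[of _ "dom l'"] conjI)
  qed
  then show "map_option metric_on_orbifold \<circ> P \<in> plots real_line m"
    using o by (simp add: real_line_def)
qed

lemma weak_metric: "weak_riemannian_metric X metric_on_orbifold"
  unfolding weak_riemannian_metric_def
  using metric_smooth metric_covariant metric_symmetric metric_positive by blast


subsection \<open>Compatibility with the colimit\<close>

lemma phi_smooth: "i \<in> I \<Longrightarrow> smooth_map (charts_V n \<Gamma> \<psi> i) X (the \<circ> \<phi> i)"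
  unfolding charts_V_eq by (rule smooth_map_plot[OF space phi_plot])

lemma points_T2_charts_V:
  assumes "c \<in> points (T2 (charts_V n \<Gamma> \<psi> i))"
  obtains m p r v w where "c = T2_class (charts_V n \<Gamma> \<psi> i) ((m, p), r, v, w)" "p \<in> plots (charts_V n \<Gamma> \<psi> i) m"
    "r \<in> dom p" "r \<in> Rn m" "v \<in> Rn m" "w \<in> Rn m"
  using assms unfolding points_T2 by blast

text \<open>A plot \<open>p\<close> of \<open>V i\<close> is its own lift, for the plot
  \<open>\<phi> i\<close> after \<open>p\<close> of X. So the descended metric is computed by
  \<open>B i\<close>, which \<open>eta_pair\<close> identifies with \<eta>.\<close>

lemma metric_T2_phi:
  assumes i: "i \<in> I" and c: "c \<in> points (T2 (charts_V n \<Gamma> \<psi> i))"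
  shows "metric_on_orbifold (T2_map X (the \<circ> \<phi> i) c) = \<eta> (T2_map M (Pair i) c)"
proof -
  obtain m p r v w where c_eq: "c = T2_class (charts_V n \<Gamma> \<psi> i) ((m, p), r, v, w)"
    and p: "p \<in> plots (charts_V n \<Gamma> \<psi> i) m" and r: "r \<in> dom p" and vw: "v \<in> Rn m" "w \<in> Rn m"
    using c by (rule points_T2_charts_V)
  have p': "openin (Euclidean_space m) (dom p)" "C_inf m (dom p) n (\<lambda>x. the (p x))" "ran p \<subseteq> V i"
    using p by (simp_all add: charts_V_eq plots_subspace plots_euclid comp_def)
  have pV: "(\<lambda>x. the (p x)) ` dom p \<subseteq> V i"
    using p'(3) by (auto simp: ran_def)
  have sP: "smooth_map (charts_V n \<Gamma> \<psi> i) M (Pair i)"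
    unfolding charts_sum_def
    by (rule smooth_map_Pair[OF i]) (simp add: charts_V_eq diffeological_space_subspace diffeological_space_euclid)
  have "lift i m (dom p) (\<lambda>x. the (p x)) (map_option (the \<circ> \<phi> i) \<circ> p)"
    unfolding lift_def
  proof (intro conjI ballI)
    fix x assume "x \<in> dom p"
    then obtain y where y: "p x = Some y"
      by blast
    then have "y \<in> V i"
      using p'(3) by (auto simp: ran_def)
    then show "\<phi> i (the (p x)) = (map_option (the \<circ> \<phi> i) \<circ> p) x"
      using y by auto
  qed (use i p' pV in auto)
  then have "metric_on_orbifold (T2_map X (the \<circ> \<phi> i) c) =
      B i (the (p r)) (jacobian m (\<lambda>x. the (p x)) r v) (jacobian m (\<lambda>x. the (p x)) r w)"
    unfolding c_eq T2_map_T2_class[OF phi_smooth[OF i]] metric_on_orbifold_class using r by (rule pre_metric_eq)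
  also have "\<dots> = \<eta> (T2_class M ((m, pmap (dom p) (\<lambda>x. (i, the (p x)))), r, v, w))"
    by (rule eta_pair[OF i p'(1,2) pV r vw, symmetric])
  also have "\<dots> = \<eta> (T2_map M (Pair i) c)"
    unfolding c_eq T2_map_T2_class[OF sP] map_option_eq_pmap by (rule refl)
  finally show ?thesis .
qed

text \<open>Functoriality of T_2 applied to \<open>\<phi> j\<close> after f equal to
  \<open>\<phi> i\<close>. The membership facts are carried along so that, in the induction over a
  class, \<open>metric_T2_phi\<close> applies to each representative.\<close>

lemma colim_step_invariant:
  assumes "colim_T2_step I (charts_V n \<Gamma> \<psi>) (charts_mor n \<Gamma> \<psi>) a b"
  shows "fst a \<in> I \<and> snd a \<in> points (T2 (charts_V n \<Gamma> \<psi> (fst a)))"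
    "fst b \<in> I \<and> snd b \<in> points (T2 (charts_V n \<Gamma> \<psi> (fst b)))"
    "T2_map X (the \<circ> \<phi> (fst a)) (snd a) = T2_map X (the \<circ> \<phi> (fst b)) (snd b)"
proof -
  obtain i c j d where ab: "a = (i, c)" "b = (j, d)"
    by (cases a, cases b)
  obtain f where i: "i \<in> I" and j: "j \<in> I" and c: "c \<in> points (T2 (charts_V n \<Gamma> \<psi> i))"
    and f: "f \<in> charts_mor n \<Gamma> \<psi> i j" and d: "d = T2_map (charts_V n \<Gamma> \<psi> j) f c"
    using assms unfolding ab colim_T2_step_def by auto
  have sf: "smooth_map (charts_V n \<Gamma> \<psi> i) (charts_V n \<Gamma> \<psi> j) f"
    and ff: "\<And>x. x \<in> points (charts_V n \<Gamma> \<psi> i) \<Longrightarrow> \<phi> j (f x) = \<phi> i x"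
    using f by (auto simp: charts_mor_def)
  obtain m p r v w where c_eq: "c = T2_class (charts_V n \<Gamma> \<psi> i) ((m, p), r, v, w)"
    and p: "p \<in> plots (charts_V n \<Gamma> \<psi> i) m" and r: "r \<in> dom p" "r \<in> Rn m" and vw: "v \<in> Rn m" "w \<in> Rn m"
    using c by (rule points_T2_charts_V)
  have d_eq: "d = T2_class (charts_V n \<Gamma> \<psi> j) ((m, map_option f \<circ> p), r, v, w)"
    unfolding d c_eq by (rule T2_map_T2_class[OF sf])
  have "d \<in> points (T2 (charts_V n \<Gamma> \<psi> j))"
    unfolding points_T2
  proof (intro CollectI exI conjI)
    show "d = T2_class (charts_V n \<Gamma> \<psi> j) ((m, map_option f \<circ> p), r, v, w)"
      by (rule d_eq)
    show "r \<in> dom (map_option f \<circ> p)"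
      using r(1) by simp
  qed (rule smooth_mapD[OF sf p] r vw)+
  moreover have "map_option (the \<circ> \<phi> j) \<circ> (map_option f \<circ> p) = map_option (the \<circ> \<phi> i) \<circ> p"
  proof
    fix x
    show "(map_option (the \<circ> \<phi> j) \<circ> (map_option f \<circ> p)) x = (map_option (the \<circ> \<phi> i) \<circ> p) x"
    proof (cases "p x")
      case (Some y)
      moreover have "ran p \<subseteq> points (charts_V n \<Gamma> \<psi> i)"
        by (rule diffeological_spaceD(2)[OF _ p])
          (simp add: charts_V_eq diffeological_space_subspace diffeological_space_euclid)
      ultimately have "y \<in> points (charts_V n \<Gamma> \<psi> i)"
        by (blast intro: ranI)
      then show ?thesis
        using Some ff by simp
    qed simp
  qed
  then have "T2_map X (the \<circ> \<phi> i) c = T2_map X (the \<circ> \<phi> j) d"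
    unfolding c_eq d_eq T2_map_T2_class[OF phi_smooth[OF i]] T2_map_T2_class[OF phi_smooth[OF j]] by simp
  ultimately show "fst a \<in> I \<and> snd a \<in> points (T2 (charts_V n \<Gamma> \<psi> (fst a)))"
    "fst b \<in> I \<and> snd b \<in> points (T2 (charts_V n \<Gamma> \<psi> (fst b)))"
    "T2_map X (the \<circ> \<phi> (fst a)) (snd a) = T2_map X (the \<circ> \<phi> (fst b)) (snd b)"
    using i j c by (simp_all add: ab)
qed

text \<open>Both maps are given by \<open>descend\<close>, so the image of a class must be shown to
  be a singleton. For the colimit metric this comes from \<open>metric_T2_phi\<close>: on each
  representative \<eta> is the value of the descended metric at the common image in T_2 X.\<close>

lemma metric_colim:
  assumes "c \<in> points (charts_colim n \<Gamma> \<psi> I)"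
  shows "metric_on_orbifold (charts_colim_map n \<Gamma> \<psi> X c) = charts_colim_metric n \<Gamma> \<psi> I \<eta> c"
proof -
  let ?R = "colim_T2_step I (charts_V n \<Gamma> \<psi>) (charts_mor n \<Gamma> \<psi>)"
  obtain a where a: "fst a \<in> I" "snd a \<in> points (T2 (charts_V n \<Gamma> \<psi> (fst a)))" and c: "c = {b. equivclp ?R a b}"
    using assms unfolding charts_colim_def colim_T2_def quotient_def coproduct_def by auto
  have *: "fst b \<in> I \<and> snd b \<in> points (T2 (charts_V n \<Gamma> \<psi> (fst b))) \<and>
      T2_map X (the \<circ> \<phi> (fst b)) (snd b) = T2_map X (the \<circ> \<phi> (fst a)) (snd a)"
    if "equivclp ?R a b" for b
    using that
  proof (induction rule: equivclp_induct)
    case base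
    then show ?case
      using a by simp
  next
    case (step y z)
    from step.hyps(2) show ?case
    proof
      assume "?R y z"
      from colim_step_invariant[OF this] step.IH show ?case
        by metis
    next
      assume "?R z y"
      from colim_step_invariant[OF this] step.IH show ?case
        by metis
    qed
  qed
  have ac: "a \<in> c"
    by (simp add: c)
  have "(\<lambda>(i, c). T2_map X (the \<circ> \<phi> i) c) ` c = {T2_map X (the \<circ> \<phi> (fst a)) (snd a)}"
  proof (rule equalityI; rule subsetI)
    fix z assume "z \<in> (\<lambda>(i, c). T2_map X (the \<circ> \<phi> i) c) ` c"
    then obtain b where "equivclp ?R a b" "z = T2_map X (the \<circ> \<phi> (fst b)) (snd b)"
      unfolding c case_prod_beta by blast
    then show "z \<in> {T2_map X (the \<circ> \<phi> (fst a)) (snd a)}"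
      using *[of b] by (simp only: singleton_iff)
  next
    fix z assume "z \<in> {T2_map X (the \<circ> \<phi> (fst a)) (snd a)}"
    then show "z \<in> (\<lambda>(i, c). T2_map X (the \<circ> \<phi> i) c) ` c"
      using ac unfolding case_prod_beta by blast
  qed
  then have map: "charts_colim_map n \<Gamma> \<psi> X c = T2_map X (the \<circ> \<phi> (fst a)) (snd a)"
    by (simp add: charts_colim_map_def descend_def)
  have val: "\<eta> (T2_map M (Pair (fst b)) (snd b)) = metric_on_orbifold (T2_map X (the \<circ> \<phi> (fst a)) (snd a))"
    if "equivclp ?R a b" for b
    using *[OF that] metric_T2_phi[of "fst b" "snd b"] by simp
  have "(\<lambda>(i, c). \<eta> (T2_map M (Pair i) c)) ` c = {metric_on_orbifold (T2_map X (the \<circ> \<phi> (fst a)) (snd a))}"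
  proof (rule equalityI; rule subsetI)
    fix z assume "z \<in> (\<lambda>(i, c). \<eta> (T2_map M (Pair i) c)) ` c"
    then obtain b where "equivclp ?R a b" "z = \<eta> (T2_map M (Pair (fst b)) (snd b))"
      unfolding c case_prod_beta by blast
    then show "z \<in> {metric_on_orbifold (T2_map X (the \<circ> \<phi> (fst a)) (snd a))}"
      using val[of b] by (simp only: singleton_iff)
  next
    fix z assume "z \<in> {metric_on_orbifold (T2_map X (the \<circ> \<phi> (fst a)) (snd a))}"
    then have "z = (\<lambda>(i, c). \<eta> (T2_map M (Pair i) c)) a"
      using val[of a] unfolding case_prod_beta by simp
    then show "z \<in> (\<lambda>(i, c). \<eta> (T2_map M (Pair i) c)) ` c"
      using ac by blast
  qed
  then show ?thesis
    by (simp add: map charts_colim_metric_def descend_def)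
qed


subsection \<open>Definiteness\<close>

abbreviation q :: "'i \<times> vec \<Rightarrow> 'a" where
  "q \<equiv> charts_quotient_map n \<Gamma> \<psi>"

lemma q_apply: "q (i, x) = the (\<phi> i x)"
  by (simp add: charts_quotient_map_def)

lemma q_smooth: "smooth_map M X q"
  unfolding smooth_map_def
proof (intro conjI allI ballI)
  have "the (\<phi> i x) \<in> points X" if "i \<in> I" "x \<in> V i" for i x
    using diffeological_spaceD(2)[OF space phi_plot[OF that(1)]] that(2) by (auto simp: ran_def)
  then show "q ` points M \<subseteq> points X"
    unfolding points_M image_subset_iff by (metis SigmaE q_apply)
  fix m p assume p: "p \<in> plots M m"
  show "map_option q \<circ> p \<in> plots X m"
  proof (rule diffeological_spaceD(4)[OF space])
    show "openin (Euclidean_space m) (dom (map_option q \<circ> p))"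
      using p by (simp add: plots_M)
    fix u assume "u \<in> dom (map_option q \<circ> p)"
    then have u: "u \<in> dom p"
      by simp
    obtain i W l where W: "i \<in> I" "u \<in> W" "openin (Euclidean_space m) W" "C_inf m W n l" "l ` W \<subseteq> V i"
      "pmap W (\<lambda>x. (i, l x)) \<subseteq>\<^sub>m p"
      using p u by (rule plot_M_local)
    have px: "p x = Some (i, l x)" if "x \<in> W" for x
      using W(6) that by (auto simp: map_le_def pmap_apply dest!: bspec[where x = x])
    have "(map_option q \<circ> p) |` W = pmap W (\<lambda>x. the (\<phi> i (l x)))"
      by (rule ext) (auto simp: restrict_map_def pmap_def px q_apply)
    then have "(map_option q \<circ> p) |` W \<in> plots X m"
      using plot_reparam[OF space phi_plot[OF W(1)] W(3,4,5)] by simp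
    moreover have "W \<subseteq> dom (map_option q \<circ> p)"
      using px by auto
    ultimately show "\<exists>W. openin (Euclidean_space m) W \<and> u \<in> W \<and> W \<subseteq> dom (map_option q \<circ> p) \<and>
        (map_option q \<circ> p) |` W \<in> plots X m"
      using W(2,3) by blast
  qed
qed

lemma lift_plot_eq:
  assumes l: "lift i m W l p"
  shows "pmap W (\<lambda>x. the (\<phi> i (l x))) = p |` W"
proof
  fix x
  show "pmap W (\<lambda>x. the (\<phi> i (l x))) x = (p |` W) x"
    using liftD(6)[OF l, of x] liftD(7)[OF l] by (cases "x \<in> W") (auto simp: pmap_def restrict_map_def)
qed

section \<open>Generating families and definiteness along them\<close>

lemma generates_sum: "generates {(M, q)} X"
proof (rule generatesI[OF space])
  show "smooth_map M' X \<Phi>" if "(M', \<Phi>) \<in> {(M, q)}" for M' \<Phi>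
    using that q_smooth by simp
  fix m p r assume p: "p \<in> plots X m" and r: "r \<in> dom p"
  then obtain i W l where W: "r \<in> W" and l: "lift i m W l p"
    by (rule lift_exists)
  have "pmap W (\<lambda>x. (i, l x)) \<in> plots M m"
    by (rule pair_plot_M[OF liftD(1-4)[OF l]])
  moreover have "map_option q \<circ> pmap W (\<lambda>x. (i, l x)) = p |` W"
    using lift_plot_eq[OF l] by (simp add: map_option_pmap q_apply)
  ultimately show "\<exists>M' \<Phi> W l. (M', \<Phi>) \<in> {(M, q)} \<and> openin (Euclidean_space m) W \<and> r \<in> W \<and> W \<subseteq> dom p \<and>
      l \<in> plots M' m \<and> map_option \<Phi> \<circ> l = p |` W"
    using W liftD(2,7)[OF l] by (intro exI[of _ M] exI[of _ q] exI[of _ W] exI[of _ "pmap W (\<lambda>x. (i, l x))"]) simp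
qed

text \<open>The bound variables \<open>n\<close>, \<open>\<Gamma>\<close> and \<open>\<psi>\<close>
  shadow the parameters of the locale: the family consists of all orbifold charts of X, in every
  dimension, as in \<open>riemannian_orbifold\<close>.\<close>

abbreviation chart_family :: "(vec diffeology \<times> (vec \<Rightarrow> 'a)) set" where
  "chart_family \<equiv> {(chart_domain n \<Gamma> \<psi>, the \<circ> orbifold_param n \<Gamma> \<psi>) | n \<Gamma> \<psi>. orbifold_chart X n \<Gamma> \<psi>}"

lemma generates_charts: "generates chart_family X"
proof (rule generatesI[OF space])
  show "smooth_map M' X \<Phi>" if mem: "(M', \<Phi>) \<in> chart_family" for M' \<Phi>
  proof -
    obtain k \<Gamma>' \<psi>' where "orbifold_chart X k \<Gamma>' \<psi>'" "M' = chart_domain k \<Gamma>' \<psi>'" "\<Phi> = the \<circ> orbifold_param k \<Gamma>' \<psi>'"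
      using mem by blast
    then show ?thesis
      using smooth_map_plot[OF space orbifold_param_plot[OF space]] by (simp add: chart_domain_eq)
  qed
  fix m p r assume p: "p \<in> plots X m" and r: "r \<in> dom p"
  then obtain i W l where W: "r \<in> W" and l: "lift i m W l p"
    by (rule lift_exists)
  have "pmap W l \<in> plots (charts_V n \<Gamma> \<psi> i) m"
    using pmap_plot_euclid[OF liftD(2)[OF l]] liftD(3,4)[OF l] by (simp add: charts_V_eq plots_subspace)
  moreover have "map_option (the \<circ> \<phi> i) \<circ> pmap W l = p |` W"
    using lift_plot_eq[OF l] by (simp add: map_option_pmap)
  moreover have "(charts_V n \<Gamma> \<psi> i, the \<circ> \<phi> i) \<in> chart_family"
    using charts[OF liftD(1)[OF l]] unfolding charts_V_def charts_phi_def by blast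
  ultimately show "\<exists>M' \<Phi> W l. (M', \<Phi>) \<in> chart_family \<and> openin (Euclidean_space m) W \<and> r \<in> W \<and> W \<subseteq> dom p \<and>
      l \<in> plots M' m \<and> map_option \<Phi> \<circ> l = p |` W"
    using W liftD(2,7)[OF l] by blast
qed

text \<open>Where \<open>\<xi>\<close> stays in the summand i, its second component is a lift of
  \<open>q\<close> after \<open>\<xi>\<close>, so both sides are values of \<open>B i\<close>.
  Restricting \<open>\<xi>\<close> to that piece does not change the class in T_2.\<close>

lemma pullback_q:
  assumes \<xi>: "\<xi> \<in> plots M m" and r: "r \<in> dom \<xi>" and v: "v \<in> Rn m" and w: "w \<in> Rn m"
  shows "pullback M (metric_on_orbifold \<circ> T2_map X q) m \<xi> r v w = pullback M \<eta> m \<xi> r v w"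
proof -
  obtain i W l where W: "i \<in> I" "r \<in> W" "openin (Euclidean_space m) W" "C_inf m W n l" "l ` W \<subseteq> V i"
    "pmap W (\<lambda>x. (i, l x)) \<subseteq>\<^sub>m \<xi>"
    using \<xi> r by (rule plot_M_local)
  have \<xi>x: "\<xi> x = Some (i, l x)" if "x \<in> W" for x
    using W(6) that by (auto simp: map_le_def pmap_apply dest!: bspec[where x = x])
  have l: "lift i m W l (map_option q \<circ> \<xi>)"
    unfolding lift_def
  proof (intro conjI ballI)
    fix x assume "x \<in> W"
    moreover from this obtain y where "\<phi> i (l x) = Some y"
      using W(5) by blast
    ultimately show "\<phi> i (l x) = (map_option q \<circ> \<xi>) x"
      by (simp add: \<xi>x q_apply)
  qed (use W in auto)
  have "pullback M (metric_on_orbifold \<circ> T2_map X q) m \<xi> r v w =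
      metric_on_orbifold (T2_map X q (T2_class M ((m, \<xi>), r, v, w)))"
    by (simp add: pullback_def)
  also have "\<dots> = B i (l r) (jacobian m l r v) (jacobian m l r w)"
    unfolding T2_map_T2_class[OF q_smooth] metric_on_orbifold_class
    by (rule pre_metric_eq[OF l W(2)])
  also have "\<dots> = \<eta> (T2_class M ((m, pmap W (\<lambda>x. (i, l x))), r, v, w))"
    by (rule eta_pair[OF W(1,3-5,2) v w, symmetric])
  also have "T2_class M ((m, pmap W (\<lambda>x. (i, l x))), r, v, w) = T2_class M ((m, \<xi>), r, v, w)"
    by (rule T2_class_subplot[OF M_space \<xi> pair_plot_M[OF W(1,3-5)] W(6) _ v w]) (simp add: W(2) del: domIff)
  finally show ?thesis
    by (simp add: pullback_def)
qed

lemma definite_sum: "definite_wrt X metric_on_orbifold {(M, q)}"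
proof -
  have "riemannian_metric M (metric_on_orbifold \<circ> T2_map X q)"
    unfolding riemannian_metric_def
  proof (intro conjI allI impI)
    show "manifold M"
      using metric by (simp add: riemannian_metric_def)
    fix m \<xi> assume \<xi>: "transition (euclid m) M \<xi>"
    note pl = transition_euclid_plot[OF \<xi>]
    have \<eta>: "covariant_2_tensor m (dom \<xi>) (pullback M \<eta> m \<xi>)"
      "symmetric_tensor m (dom \<xi>) (pullback M \<eta> m \<xi>)"
      "positive_definite_tensor m (dom \<xi>) (pullback M \<eta> m \<xi>)"
      using metric \<xi> by (simp_all add: riemannian_metric_def)
    show "covariant_2_tensor m (dom \<xi>) (pullback M (metric_on_orbifold \<circ> T2_map X q) m \<xi>)"
      by (rule covariant_2_tensor_cong[OF diffeological_spaceD(1)[OF M_space pl] \<eta>(1)])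
        (rule pullback_q[OF pl, symmetric])
    show "symmetric_tensor m (dom \<xi>) (pullback M (metric_on_orbifold \<circ> T2_map X q) m \<xi>)"
      using \<eta>(2) unfolding symmetric_tensor_def by (simp add: pullback_q[OF pl] del: domIff)
    show "positive_definite_tensor m (dom \<xi>) (pullback M (metric_on_orbifold \<circ> T2_map X q) m \<xi>)"
      using \<eta>(3) unfolding positive_definite_tensor_def by (simp add: pullback_q[OF pl] del: domIff)
  qed
  then show ?thesis
    using generates_sum by (simp add: definite_wrt_def)
qed

text \<open>With a lift \<open>l\<close> of the chart and a lift \<open>g\<close> in the other direction, \<open>g \<circ> l\<close> agrees with
  elements \<open>\<gamma>\<close> of the finite group on a dense open set. Hence \<open>D(g \<circ> l) v\<close> equals some \<open>D\<gamma> v\<close> everywhere,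
  and \<open>D l v\<close> does not vanish.\<close>

lemma chart_positive_definite:
  assumes ch: "orbifold_chart X n \<Gamma>' \<psi>'" and x: "x \<in> dom (orbifold_param n \<Gamma>' \<psi>')"
    and v: "v \<in> Rn n" "v \<noteq> (\<lambda>_. 0)"
  shows "pullback X metric_on_orbifold n (orbifold_param n \<Gamma>' \<psi>') x v v > 0"
proof -
  let ?\<phi>' = "orbifold_param n \<Gamma>' \<psi>'"
  note fin = chart_finite[OF space ch] and sub = chart_subgroup[OF space ch]
  have pl: "?\<phi>' \<in> plots X n"
    by (rule orbifold_param_plot[OF space ch])
  obtain i W l where W: "x \<in> W" and l: "lift i n W l ?\<phi>'"
    using pl x by (rule lift_exists)
  note i = liftD(1)[OF l]
  obtain c where c: "?\<phi>' x = Some c"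
    using x by blast
  have "\<phi> i (l x) = Some c" "c \<in> dom \<psi>'"
    using liftD(6)[OF l W] c orbifold_param_mem[OF space ch c] by auto
  \<comment> \<open>The plot \<open>\<phi> i\<close> is lifted back through the given chart, near
    the image of \<open>x\<close>.\<close>
  from chart_lift[OF space ch phi_plot[OF i] this]
  obtain W' g where W': "l x \<in> W'" "openin (Euclidean_space n) W'" "W' \<subseteq> V i" and g: "C_inf n W' n g"
    and g_eq: "\<forall>y\<in>W'. ?\<phi>' (g y) = \<phi> i y"
    by blast
  define U where "U = {y \<in> W. l y \<in> W'}"
  have U: "openin (Euclidean_space n) U"
    unfolding U_def by (rule openin_C_inf_preimage[OF liftD(2,3)[OF l] W'(2)])
  have UW: "U \<subseteq> W" "l ` U \<subseteq> W'" "x \<in> U"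
    using W W'(1) by (auto simp: U_def)
  have lU: "C_inf n U n l"
    by (rule C_inf_subset[OF liftD(3)[OF l] UW(1) openin_Euclidean_subset[OF liftD(2)[OF l]]])
  have gl: "C_inf n U n (\<lambda>y. g (l y))"
    by (rule C_inf_compose[OF U W'(2) UW(2) g lU])
  have gam: "C_inf n U n \<gamma>" if "\<gamma> \<in> \<Gamma>'" for \<gamma>
    by (rule C_inf_subset[OF group_smooth[OF fin sub that] openin_Euclidean_subset[OF U]]) simp
  have orbit: "\<exists>\<gamma>\<in>\<Gamma>'. g (l y) = \<gamma> y" if "y \<in> U" for y
  proof (rule orbifold_param_eqD[OF space ch])
    have y: "y \<in> W" "l y \<in> W'"
      using that by (auto simp: U_def)
    show "y \<in> dom ?\<phi>'"
      using y(1) liftD(7)[OF l] by blast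
    show "?\<phi>' (g (l y)) = ?\<phi>' y"
      using g_eq y(2) liftD(6)[OF l y(1)] by simp
  qed
  \<comment> \<open>The group element may change from point to point; as \<Gamma>' is finite, the
    union of the coincidence sets of the derivatives is still closed.\<close>
  define S where "S = (\<Union>\<gamma>\<in>\<Gamma>'. {y \<in> U. jacobian n (\<lambda>y. g (l y)) y v = jacobian n \<gamma> y v})"
  have "closedin (top_of_set U) S"
    unfolding S_def
  proof (rule closedin_Union[OF finite_imageI[OF fin]])
    fix T assume "T \<in> (\<lambda>\<gamma>. {y \<in> U. jacobian n (\<lambda>y. g (l y)) y v = jacobian n \<gamma> y v}) ` \<Gamma>'"
    then obtain \<gamma> where \<gamma>: "\<gamma> \<in> \<Gamma>'" "T = {y \<in> U. jacobian n (\<lambda>y. g (l y)) y v = jacobian n \<gamma> y v}"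
      by blast
    show "closedin (top_of_set U) T"
      unfolding \<gamma>(2)
      by (intro closedin_coincidence_set C_inf_continuous[OF U C_inf_jacobian[OF U gl]]
          C_inf_continuous[OF U C_inf_jacobian[OF U gam[OF \<gamma>(1)]]])
  qed
  moreover have "Q \<inter> S \<noteq> {}" if Q: "Q \<noteq> {}" "openin (Euclidean_space n) Q" "Q \<subseteq> U" for Q
  proof -
    have "\<exists>\<gamma>\<in>\<Gamma>'. \<exists>Q'. Q' \<noteq> {} \<and> openin (Euclidean_space n) Q' \<and> Q' \<subseteq> Q \<and> (\<forall>y\<in>Q'. g (l y) = \<gamma> y)"
      by (rule finite_cover_open_subset[where b = "\<lambda>\<gamma>. \<gamma>", OF fin U Q C_inf_continuous[OF U gl]])
        (use Q(3) orbit C_inf_continuous[OF U gam] in auto)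
    then obtain \<gamma> Q' where \<gamma>: "\<gamma> \<in> \<Gamma>'" and Q': "Q' \<noteq> {}" "openin (Euclidean_space n) Q'" "Q' \<subseteq> Q"
      and eq: "\<forall>y\<in>Q'. g (l y) = \<gamma> y"
      by (elim bexE exE conjE)
    obtain y where y: "y \<in> Q'"
      using Q'(1) by blast
    have "jacobian n (\<lambda>y. g (l y)) y v = jacobian n \<gamma> y v"
      by (rule jacobian_cong[OF Q'(2) y]) (use eq in blast)
    then have "y \<in> S"
      unfolding S_def using \<gamma> y Q'(3) Q(3) by blast
    then show ?thesis
      using y Q'(3) by blast
  qed
  ultimately have "U \<subseteq> S"
    by (rule dense_closed_eq[OF U])
  then obtain \<gamma> where \<gamma>: "\<gamma> \<in> \<Gamma>'" "jacobian n (\<lambda>y. g (l y)) x v = jacobian n \<gamma> x v"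
    using UW(3) by (auto simp: S_def)
  have Dl: "jacobian n l x v \<noteq> (\<lambda>_. 0)"
  proof
    assume "jacobian n l x v = (\<lambda>_. 0)"
    then have 0: "jacobian n \<gamma> x v = (\<lambda>_. 0)"
      using \<gamma>(2) jacobian_compose[OF U W'(2) UW(2) g lU UW(3), of v] by (simp add: jacobian_zero)
    \<comment> \<open>A smooth inverse of \<gamma> makes the derivative of \<gamma>
      injective.\<close>
    obtain \<gamma>' where \<gamma>': "\<gamma>' \<in> \<Gamma>'" "\<forall>x\<in>Rn n. \<gamma>' (\<gamma> x) = x \<and> \<gamma> (\<gamma>' x) = x"
      using group_inverse[OF fin sub \<gamma>(1)] by blast
    have xR: "x \<in> Rn n"
      using UW(3) openin_Euclidean_subset[OF U] by blast
    have "jacobian n (\<lambda>y. \<gamma>' (\<gamma> y)) x v = jacobian n \<gamma>' (\<gamma> x) (jacobian n \<gamma> x v)"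
      by (rule jacobian_compose[OF openin_topspace openin_topspace _ group_smooth[OF fin sub \<gamma>'(1)]
            group_smooth[OF fin sub \<gamma>(1)] xR]) (use group_maps[OF fin sub \<gamma>(1)] in blast)
    moreover have "jacobian n (\<lambda>y. \<gamma>' (\<gamma> y)) x v = jacobian n (\<lambda>y. y) x v"
      by (rule jacobian_cong[OF openin_topspace xR]) (use \<gamma>'(2) in blast)
    ultimately show False
      using v by (simp add: 0 jacobian_zero jacobian_id)
  qed
  show ?thesis
    unfolding pullback_metric_eq[OF l W]
    using B_tensor(3)[OF i] liftD(5)[OF l W] jacobian_lift_in_Rn[OF l W] Dl
    unfolding positive_definite_tensor_def by blast
qed

text \<open>A chart with empty domain may have any dimension; its parametrization then has no points
  and definiteness is vacuous. This explains the conditional form of the assumption on k.\<close>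

lemma chart_riemannian:
  assumes ch: "orbifold_chart X k \<Gamma>' \<psi>'" and k: "dom \<psi>' \<noteq> {} \<Longrightarrow> k = n"
  shows "riemannian_metric (chart_domain k \<Gamma>' \<psi>') (metric_on_orbifold \<circ> T2_map X (the \<circ> orbifold_param k \<Gamma>' \<psi>'))"
proof -
  let ?\<phi>' = "orbifold_param k \<Gamma>' \<psi>'"
  let ?V = "dom ?\<phi>'"
  note V = orbifold_param_dom_open[OF space ch]
  note pl = orbifold_param_plot[OF space ch]
  have sm: "smooth_map (subspace (euclid k) ?V) X (the \<circ> ?\<phi>')"
    by (rule smooth_map_plot[OF space pl])
  show ?thesis
    unfolding riemannian_metric_def chart_domain_eq
  proof (intro conjI allI impI)
    show "manifold (subspace (euclid k) ?V)"
      by (rule manifold_subspace_euclid[OF V])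
    fix m \<xi> assume \<xi>: "transition (euclid m) (subspace (euclid k) ?V) \<xi>"
    note \<xi>pl = transition_euclid_plot[OF \<xi>]
    have eq: "pullback (subspace (euclid k) ?V) (metric_on_orbifold \<circ> T2_map X (the \<circ> ?\<phi>')) m \<xi> =
        pullback X metric_on_orbifold m (map_option (the \<circ> ?\<phi>') \<circ> \<xi>)"
      by (intro ext) (simp only: pullback_def comp_apply T2_map_T2_class[OF sm])
    have Xpl: "map_option (the \<circ> ?\<phi>') \<circ> \<xi> \<in> plots X m"
      by (rule smooth_mapD[OF sm \<xi>pl])
    show "covariant_2_tensor m (dom \<xi>) (pullback (subspace (euclid k) ?V) (metric_on_orbifold \<circ> T2_map X (the \<circ> ?\<phi>')) m \<xi>)"
      "symmetric_tensor m (dom \<xi>) (pullback (subspace (euclid k) ?V) (metric_on_orbifold \<circ> T2_map X (the \<circ> ?\<phi>')) m \<xi>)"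
      unfolding eq using metric_covariant[OF Xpl] metric_symmetric[OF Xpl] by simp_all
    show "positive_definite_tensor m (dom \<xi>) (pullback (subspace (euclid k) ?V) (metric_on_orbifold \<circ> T2_map X (the \<circ> ?\<phi>')) m \<xi>)"
      unfolding eq positive_definite_tensor_def
    proof (intro ballI impI)
      fix r v assume r: "r \<in> dom \<xi>" and v: "v \<in> Rn m" "v \<noteq> (\<lambda>_. 0)"
      have \<xi>s: "openin (Euclidean_space m) (dom \<xi>)" "C_inf m (dom \<xi>) k (the \<circ> \<xi>)" "ran \<xi> \<subseteq> ?V"
        using \<xi>pl by (simp_all add: plots_subspace plots_euclid)
      have \<xi>V: "(the \<circ> \<xi>) x \<in> ?V" if "x \<in> dom \<xi>" for x
        using \<xi>s(3) that by (auto simp: ran_def)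
      obtain a where "?\<phi>' ((the \<circ> \<xi>) r) = Some a"
        using \<xi>V[OF r] by blast
      then have "dom \<psi>' \<noteq> {}"
        using orbifold_param_mem[OF space ch] by blast
      then have kn: "k = n"
        by (rule k)
      have Dv: "jacobian m (the \<circ> \<xi>) r v \<in> Rn k"
        by (rule jacobian_in_Rn[OF \<xi>s(1) r C_infD(1)[OF \<xi>s(2)]])
      \<comment> \<open>Reparametrizing by \<open>\<xi>\<close> moves the question to the chart
        itself, at the vector pushed forward by \<open>\<xi>\<close>, which is nonzero because
        \<open>\<xi>\<close> is a transition.\<close>
      have "T2_class X ((m, map_option (the \<circ> ?\<phi>') \<circ> \<xi>), r, v, v) =
          T2_class X ((k, ?\<phi>'), (the \<circ> \<xi>) r, jacobian m (the \<circ> \<xi>) r v, jacobian m (the \<circ> \<xi>) r v)"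
      proof (rule T2_class_reparam[OF Xpl pl _ v(1) v(1)])
        show "?\<phi>' ((the \<circ> \<xi>) x) = (map_option (the \<circ> ?\<phi>') \<circ> \<xi>) x" if x: "x \<in> dom (map_option (the \<circ> ?\<phi>') \<circ> \<xi>)" for x
        proof -
          obtain y where y: "\<xi> x = Some y"
            using x unfolding dom_map_option_comp by blast
          then have "y \<in> ?V"
            using \<xi>s(3) by (blast intro: ranI)
          then show ?thesis
            using y by auto
        qed
        show "(the \<circ> \<xi>) ` dom (map_option (the \<circ> ?\<phi>') \<circ> \<xi>) \<subseteq> ?V"
          unfolding dom_map_option_comp using \<xi>V by blast
        show "C_inf m (dom (map_option (the \<circ> ?\<phi>') \<circ> \<xi>)) k (the \<circ> \<xi>)"
          unfolding dom_map_option_comp by (rule \<xi>s(2))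
        show "r \<in> dom (map_option (the \<circ> ?\<phi>') \<circ> \<xi>)"
          unfolding dom_map_option_comp by (rule r)
      qed
      then have "pullback X metric_on_orbifold m (map_option (the \<circ> ?\<phi>') \<circ> \<xi>) r v v =
          pullback X metric_on_orbifold k ?\<phi>' ((the \<circ> \<xi>) r) (jacobian m (the \<circ> \<xi>) r v) (jacobian m (the \<circ> \<xi>) r v)"
        by (simp only: pullback_def)
      also have "\<dots> > 0"
        using chart_positive_definite[OF ch[unfolded kn] \<xi>V[OF r, unfolded kn] Dv[unfolded kn]
            transition_euclid_jacobian_nonzero[OF V \<xi> r v]] by (simp only: kn)
      finally show "pullback X metric_on_orbifold m (map_option (the \<circ> ?\<phi>') \<circ> \<xi>) r v v > 0" .
    qed
  qed
qed

lemma definite_charts: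
  assumes "\<And>m \<Gamma>' \<psi>'. orbifold_chart X m \<Gamma>' \<psi>' \<Longrightarrow> dom \<psi>' \<noteq> {} \<Longrightarrow> m = n"
  shows "definite_wrt X metric_on_orbifold chart_family"
  unfolding definite_wrt_def
proof (intro conjI ballI)
  show "generates chart_family X"
    by (rule generates_charts)
  fix z assume "z \<in> chart_family"
  then obtain k \<Gamma>' \<psi>' where "z = (chart_domain k \<Gamma>' \<psi>', the \<circ> orbifold_param k \<Gamma>' \<psi>')" and ch: "orbifold_chart X k \<Gamma>' \<psi>'"
    by blast
  then show "case z of (N, \<Phi>) \<Rightarrow> riemannian_metric N (metric_on_orbifold \<circ> T2_map X \<Phi>)"
    using chart_riemannian[OF ch assms[OF ch]] by simp
qed

end

theorem mainTheorem5:
  fixes X :: "'a diffeology"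
    and n :: nat
    and I :: "'i set"
    and \<Gamma> :: "'i \<Rightarrow> (vec \<Rightarrow> vec) set"
    and \<psi> :: "'i \<Rightarrow> 'a \<rightharpoonup> vec set"
    and \<eta> :: "('i \<times> vec) pre_T2 set \<Rightarrow> real"
  assumes "diffeological_n_orbifold n X"
    and "countable I"
    and "\<And>i. i \<in> I \<Longrightarrow> orbifold_chart X n (\<Gamma> i) (\<psi> i)"
    and "points X = (\<Union>i\<in>I. dom (\<psi> i))"
    and "riemannian_metric (charts_sum n \<Gamma> \<psi> I) \<eta>"
    and "invariant_metric (charts_sum n \<Gamma> \<psi> I) \<eta> (charts_pseudogroup n \<Gamma> \<psi> I)"
  shows "\<exists>\<eta>' :: 'a pre_T2 set \<Rightarrow> real.
    weak_riemannian_metric X \<eta>' \<and>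
    (\<forall>c \<in> points (charts_colim n \<Gamma> \<psi> I).
       \<eta>' (charts_colim_map n \<Gamma> \<psi> X c) = charts_colim_metric n \<Gamma> \<psi> I \<eta> c) \<and>
    definite_wrt X \<eta>' {(charts_sum n \<Gamma> \<psi> I, charts_quotient_map n \<Gamma> \<psi>)} \<and>
    riemannian_orbifold X \<eta>'"
proof -
  have orb: "diffeological_orbifold X"
    and dim: "\<And>m \<Gamma> \<psi>. orbifold_chart X m \<Gamma> \<psi> \<Longrightarrow> dom \<psi> \<noteq> {} \<Longrightarrow> m = n"
    using assms(1) unfolding diffeological_n_orbifold_def by blast+
  interpret invariant_metric_on_charts X n I \<Gamma> \<psi> \<eta>
    by standard (use orb assms(3-6) in \<open>simp_all add: diffeological_orbifold_def\<close>)
  \<comment> \<open>The n-orbifold hypothesis fixes the dimension of every nonempty chart, including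
    charts outside the given collection.\<close>
  have "definite_wrt X metric_on_orbifold chart_family"
    by (rule definite_charts) (rule dim)
  then have "riemannian_orbifold X metric_on_orbifold"
    unfolding riemannian_orbifold_def using orb weak_metric by blast
  then show ?thesis
    using weak_metric metric_colim definite_sum by blast
qed

end
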